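(* Let $\mathcal{A}$ be an abelian category with a generator, small direct sums and exact small products, and let $S$ be an inverse sequence in $\mathcal{A}$. If $S$ is $\lambda$-complete for any limit ordinal $\lambda$, then $\lim^1S=0$.
   Context: A generator of $\mathcal{A}$ is an object $G$ such that the functor $\mathcal{A}(G,-)$ is faithful. An inverse sequence $S$ in $\mathcal{A}$ consists of objects $S_i$ and morphisms $f_i:S_{i+1}\to S_i$, $i\in\omega=\{0,1,2,\dots\}$, i.e. it is a functor $\omega^{\mathrm{op}}\to\mathcal{A}$. Inverse sequences form an abelian category $\mathcal{A}^{\omega^{\mathrm{op}}}$, in which kernels, cokernels, images and limits are computed componentwise. $\lim^1 S$ (the first right derived functor of the limit) is the cokernel of $1-F:\prod_i S_i\to\prod_i S_i$, where $\mathrm{pr}_jF=f_j\,\mathrm{pr}_{j+1}$. $I(S)\rightarrowtail S$ is the inverse sequence of images $I(S)_i=\mathrm{Im}(f_i:S_{i+1}\to S_i)$. For ordinals: $I^0(S)=S$, $I^{\alpha+1}(S)=I(I^\alpha(S))$, and $I^\lambda(S)=\lim_{\alpha<\lambda}I^\alpha(S)$ for a (nonzero) limit ordinal $\lambda$ (a limit in $\mathcal{A}^{\omega^{\mathrm{op}}}$). The canonical maps $I^\alpha(S)\to S$ are monomorphisms; put $S^\alpha=\mathrm{Coker}(I^\alpha(S)\rightarrowtail S)$. For a limit ordinal $\lambda$ put $\widehat S^\lambda=\lim_{\beta<\lambda}S^\beta$ (a limit in $\mathcal{A}^{\omega^{\mathrm{op}}}$). $S$ is called $\lambda$-complete if the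 natural map $S\to\widehat S^\lambda$, induced by the projections $S\to S^\beta$, is an epimorphism. *)

theory Defs
  imports "HOL-Algebra.Group" "HOL-Library.Equipollence"
begin

section \<open>Small sets and ordinals\<close>

(* A type stands in for a Grothendieck universe containing the natural numbers: a set is small
   if it has fewer elements than the type.  The type has a well-order whose proper initial
   segments are small, so it is order-isomorphic to an inaccessible cardinal, and its elements
   are exactly the small ordinals. *)

definition small :: "'u itself \<Rightarrow> 'a set \<Rightarrow> bool" where
  "small U A \<longleftrightarrow> A \<prec> (UNIV :: 'u set)"

definition universe_type :: "'u::wellorder itself \<Rightarrow> bool" where
  "universe_type U \<longleftrightarrow>
     small U (UNIV :: nat set) \<and>
     (\<forall>\<alpha>::'u. small U {..<\<alpha>}) \<and>
     (\<forall>A::'u set. small U A \<longrightarrow> small U (Pow A)) \<and>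
     (\<forall>(I::'u set) (B::'u \<Rightarrow> 'u set).
        small U I \<and> (\<forall>i\<in>I. small U (B i)) \<longrightarrow> small U (\<Union>i\<in>I. B i))"

definition zero_ord :: "'u::wellorder" where
  "zero_ord = (LEAST \<alpha>. True)"

(* Meaningful because a well-order as in universe_type has no greatest element. *)
definition succ_ord :: "'u::wellorder \<Rightarrow> 'u" where
  "succ_ord \<alpha> = (LEAST \<beta>. \<alpha> < \<beta>)"

definition limit_ord :: "'u::wellorder \<Rightarrow> bool" where
  "limit_ord \<kappa> \<longleftrightarrow> (\<exists>\<alpha>. \<alpha> < \<kappa>) \<and> (\<forall>\<alpha><\<kappa>. \<exists>\<beta>. \<alpha> < \<beta> \<and> \<beta> < \<kappa>)"


section \<open>Categories enriched in abelian groups\<close>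

record ('o, 'm) cat =
  ob  :: "'o set"
  arr :: "'m set"
  src :: "'m \<Rightarrow> 'o"
  tgt :: "'m \<Rightarrow> 'o"
  idn :: "'o \<Rightarrow> 'm"
  cmp :: "'m \<Rightarrow> 'm \<Rightarrow> 'm"  (infixl \<open>\<cdot>\<index>\<close> 70)
  add :: "'m \<Rightarrow> 'm \<Rightarrow> 'm"
  zer :: "'o \<Rightarrow> 'o \<Rightarrow> 'm"

definition Hom :: "('o, 'm) cat \<Rightarrow> 'o \<Rightarrow> 'o \<Rightarrow> 'm set" where
  "Hom C A B = {f \<in> arr C. src C f = A \<and> tgt C f = B}"

definition hom_group :: "('o, 'm) cat \<Rightarrow> 'o \<Rightarrow> 'o \<Rightarrow> 'm monoid" where
  "hom_group C A B = \<lparr>carrier = Hom C A B, monoid.mult = add C, one = zer C A B\<rparr>"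

definition sub :: "('o, 'm) cat \<Rightarrow> 'm \<Rightarrow> 'm \<Rightarrow> 'm" where
  "sub C f g = add C f (inv\<^bsub>hom_group C (src C f) (tgt C f)\<^esub> g)"

locale category =
  fixes C :: "('o, 'm) cat" (structure)
  assumes src_ob: "f \<in> arr C \<Longrightarrow> src C f \<in> ob C"
    and tgt_ob: "f \<in> arr C \<Longrightarrow> tgt C f \<in> ob C"
    and idn_Hom: "A \<in> ob C \<Longrightarrow> idn C A \<in> Hom C A A"
    and cmp_Hom: "\<lbrakk>f \<in> Hom C A B; g \<in> Hom C B D\<rbrakk> \<Longrightarrow> g \<cdot> f \<in> Hom C A D"
    and idn_left: "f \<in> Hom C A B \<Longrightarrow> idn C B \<cdot> f = f"
    and idn_right: "f \<in> Hom C A B \<Longrightarrow> f \<cdot> idn C A = f"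
    and cmp_assoc: "\<lbrakk>f \<in> Hom C A B; g \<in> Hom C B D; h \<in> Hom C D E\<rbrakk>
                      \<Longrightarrow> (h \<cdot> g) \<cdot> f = h \<cdot> (g \<cdot> f)"

locale preadditive_category = category +
  assumes comm_group_Hom: "\<lbrakk>A \<in> ob C; B \<in> ob C\<rbrakk> \<Longrightarrow> comm_group (hom_group C A B)"
    and cmp_add_left: "\<lbrakk>f \<in> Hom C A B; g \<in> Hom C B D; h \<in> Hom C B D\<rbrakk>
                        \<Longrightarrow> add C g h \<cdot> f = add C (g \<cdot> f) (h \<cdot> f)"
    and cmp_add_right: "\<lbrakk>f \<in> Hom C A B; g \<in> Hom C A B; h \<in> Hom C B D\<rbrakk>
                        \<Longrightarrow> h \<cdot> add C f g = add C (h \<cdot> f) (h \<cdot> g)"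

definition is_zero :: "('o, 'm) cat \<Rightarrow> 'o \<Rightarrow> bool" where
  "is_zero C Z \<longleftrightarrow> Z \<in> ob C \<and>
     (\<forall>A\<in>ob C. (\<exists>!f. f \<in> Hom C Z A) \<and> (\<exists>!f. f \<in> Hom C A Z))"

definition is_mono :: "('o, 'm) cat \<Rightarrow> 'm \<Rightarrow> bool" where
  "is_mono C f \<longleftrightarrow> f \<in> arr C \<and>
     (\<forall>X\<in>ob C. \<forall>g\<in>Hom C X (src C f). \<forall>h\<in>Hom C X (src C f).
        f \<cdot>\<^bsub>C\<^esub> g = f \<cdot>\<^bsub>C\<^esub> h \<longrightarrow> g = h)"

definition is_epi :: "('o, 'm) cat \<Rightarrow> 'm \<Rightarrow> bool" where
  "is_epi C f \<longleftrightarrow> f \<in> arr C \<and>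
     (\<forall>X\<in>ob C. \<forall>g\<in>Hom C (tgt C f) X. \<forall>h\<in>Hom C (tgt C f) X.
        g \<cdot>\<^bsub>C\<^esub> f = h \<cdot>\<^bsub>C\<^esub> f \<longrightarrow> g = h)"

definition is_kernel :: "('o, 'm) cat \<Rightarrow> 'm \<Rightarrow> 'm \<Rightarrow> bool" where
  "is_kernel C f k \<longleftrightarrow> f \<in> arr C \<and> k \<in> arr C \<and> tgt C k = src C f \<and>
     f \<cdot>\<^bsub>C\<^esub> k = zer C (src C k) (tgt C f) \<and>
     (\<forall>X\<in>ob C. \<forall>h\<in>Hom C X (src C f). f \<cdot>\<^bsub>C\<^esub> h = zer C X (tgt C f) \<longrightarrow>
        (\<exists>!u. u \<in> Hom C X (src C k) \<and> k \<cdot>\<^bsub>C\<^esub> u = h))"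

definition is_cokernel :: "('o, 'm) cat \<Rightarrow> 'm \<Rightarrow> 'm \<Rightarrow> bool" where
  "is_cokernel C f q \<longleftrightarrow> f \<in> arr C \<and> q \<in> arr C \<and> src C q = tgt C f \<and>
     q \<cdot>\<^bsub>C\<^esub> f = zer C (src C f) (tgt C q) \<and>
     (\<forall>X\<in>ob C. \<forall>h\<in>Hom C (tgt C f) X. h \<cdot>\<^bsub>C\<^esub> f = zer C (src C f) X \<longrightarrow>
        (\<exists>!u. u \<in> Hom C (tgt C q) X \<and> u \<cdot>\<^bsub>C\<^esub> q = h))"

definition is_image :: "('o, 'm) cat \<Rightarrow> 'm \<Rightarrow> 'm \<Rightarrow> bool" where
  "is_image C f m \<longleftrightarrow> (\<exists>q. is_cokernel C f q \<and> is_kernel C q m)"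

definition short_exact :: "('o, 'm) cat \<Rightarrow> 'm \<Rightarrow> 'm \<Rightarrow> bool" where
  "short_exact C f g \<longleftrightarrow> is_kernel C g f \<and> is_cokernel C f g"

definition is_biproduct ::
    "('o, 'm) cat \<Rightarrow> 'o \<Rightarrow> 'o \<Rightarrow> 'o \<Rightarrow> 'm \<Rightarrow> 'm \<Rightarrow> 'm \<Rightarrow> 'm \<Rightarrow> bool" where
  "is_biproduct C A B P i\<^sub>1 i\<^sub>2 p\<^sub>1 p\<^sub>2 \<longleftrightarrow> P \<in> ob C \<and>
     i\<^sub>1 \<in> Hom C A P \<and> i\<^sub>2 \<in> Hom C B P \<and> p\<^sub>1 \<in> Hom C P A \<and> p\<^sub>2 \<in> Hom C P B \<and>
     p\<^sub>1 \<cdot>\<^bsub>C\<^esub> i\<^sub>1 = idn C A \<and> p\<^sub>2 \<cdot>\<^bsub>C\<^esub> i\<^sub>2 = idn C B \<and>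
     add C (i\<^sub>1 \<cdot>\<^bsub>C\<^esub> p\<^sub>1) (i\<^sub>2 \<cdot>\<^bsub>C\<^esub> p\<^sub>2) = idn C P"

locale abelian_category = preadditive_category +
  assumes ex_zero: "\<exists>Z. is_zero C Z"
    and ex_biproduct: "\<lbrakk>A \<in> ob C; B \<in> ob C\<rbrakk>
                         \<Longrightarrow> \<exists>P i\<^sub>1 i\<^sub>2 p\<^sub>1 p\<^sub>2. is_biproduct C A B P i\<^sub>1 i\<^sub>2 p\<^sub>1 p\<^sub>2"
    and ex_kernel: "f \<in> arr C \<Longrightarrow> \<exists>k. is_kernel C f k"
    and ex_cokernel: "f \<in> arr C \<Longrightarrow> \<exists>q. is_cokernel C f q"
    and mono_normal: "is_mono C f \<Longrightarrow> \<exists>g. is_kernel C g f"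
    and epi_normal: "is_epi C f \<Longrightarrow> \<exists>g. is_cokernel C g f"


section \<open>Generators, products, coproducts, inverse limits\<close>

definition locally_small :: "'u itself \<Rightarrow> ('o, 'm) cat \<Rightarrow> bool" where
  "locally_small U C \<longleftrightarrow> (\<forall>A\<in>ob C. \<forall>B\<in>ob C. small U (Hom C A B))"

(* The map under inj_on is the action of the functor Hom(G,-) on the morphisms A \<rightarrow> B. *)
definition is_generator :: "('o, 'm) cat \<Rightarrow> 'o \<Rightarrow> bool" where
  "is_generator C G \<longleftrightarrow> G \<in> ob C \<and>
     (\<forall>A\<in>ob C. \<forall>B\<in>ob C. inj_on (\<lambda>f. \<lambda>h\<in>Hom C G A. f \<cdot>\<^bsub>C\<^esub> h) (Hom C A B))"

definition is_product ::
    "('o, 'm) cat \<Rightarrow> 'i set \<Rightarrow> ('i \<Rightarrow> 'o) \<Rightarrow> 'o \<Rightarrow> ('i \<Rightarrow> 'm) \<Rightarrow> bool" where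
  "is_product C I X P \<pi> \<longleftrightarrow> P \<in> ob C \<and> (\<forall>i\<in>I. \<pi> i \<in> Hom C P (X i)) \<and>
     (\<forall>Y\<in>ob C. \<forall>f. (\<forall>i\<in>I. f i \<in> Hom C Y (X i)) \<longrightarrow>
        (\<exists>!h. h \<in> Hom C Y P \<and> (\<forall>i\<in>I. \<pi> i \<cdot>\<^bsub>C\<^esub> h = f i)))"

definition is_coproduct ::
    "('o, 'm) cat \<Rightarrow> 'i set \<Rightarrow> ('i \<Rightarrow> 'o) \<Rightarrow> 'o \<Rightarrow> ('i \<Rightarrow> 'm) \<Rightarrow> bool" where
  "is_coproduct C I X P \<iota> \<longleftrightarrow> P \<in> ob C \<and> (\<forall>i\<in>I. \<iota> i \<in> Hom C (X i) P) \<and>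
     (\<forall>Y\<in>ob C. \<forall>f. (\<forall>i\<in>I. f i \<in> Hom C (X i) Y) \<longrightarrow>
        (\<exists>!h. h \<in> Hom C P Y \<and> (\<forall>i\<in>I. h \<cdot>\<^bsub>C\<^esub> \<iota> i = f i)))"

(* Every small set is in bijection with a small subset of 'u, so index sets in 'u suffice. *)
definition has_small_products :: "'u itself \<Rightarrow> ('o, 'm) cat \<Rightarrow> bool" where
  "has_small_products U C \<longleftrightarrow>
     (\<forall>(I::'u set) X. small U I \<and> (\<forall>i\<in>I. X i \<in> ob C) \<longrightarrow> (\<exists>P \<pi>. is_product C I X P \<pi>))"

definition has_small_coproducts :: "'u itself \<Rightarrow> ('o, 'm) cat \<Rightarrow> bool" where
  "has_small_coproducts U C \<longleftrightarrow>
     (\<forall>(I::'u set) X. small U I \<and> (\<forall>i\<in>I. X i \<in> ob C) \<longrightarrow> (\<exists>P \<iota>. is_coproduct C I X P \<iota>))"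

definition small_products_exact :: "'u itself \<Rightarrow> ('o, 'm) cat \<Rightarrow> bool" where
  "small_products_exact U C \<longleftrightarrow>
     (\<forall>(I::'u set) X Y Z f g P \<pi> Q \<rho> R \<sigma> f' g'.
        small U I \<and>
        (\<forall>i\<in>I. f i \<in> Hom C (X i) (Y i) \<and> g i \<in> Hom C (Y i) (Z i) \<and> short_exact C (f i) (g i)) \<and>
        is_product C I X P \<pi> \<and> is_product C I Y Q \<rho> \<and> is_product C I Z R \<sigma> \<and>
        f' \<in> Hom C P Q \<and> (\<forall>i\<in>I. \<rho> i \<cdot>\<^bsub>C\<^esub> f' = f i \<cdot>\<^bsub>C\<^esub> \<pi> i) \<and>
        g' \<in> Hom C Q R \<and> (\<forall>i\<in>I. \<sigma> i \<cdot>\<^bsub>C\<^esub> g' = g i \<cdot>\<^bsub>C\<^esub> \<rho> i)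
        \<longrightarrow> short_exact C f' g')"

(* D with transition maps u a b : D b \<rightarrow> D a (for a \<le> b) is a contravariant functor on
   the ordered set A; L with projections \<rho> is its limit. *)
definition is_inverse_limit ::
    "('o, 'm) cat \<Rightarrow> 'i::order set \<Rightarrow> ('i \<Rightarrow> 'o) \<Rightarrow> ('i \<Rightarrow> 'i \<Rightarrow> 'm) \<Rightarrow> 'o \<Rightarrow> ('i \<Rightarrow> 'm) \<Rightarrow> bool" where
  "is_inverse_limit C A D u L \<rho> \<longleftrightarrow> L \<in> ob C \<and>
     (\<forall>a\<in>A. \<rho> a \<in> Hom C L (D a)) \<and>
     (\<forall>a\<in>A. \<forall>b\<in>A. a \<le> b \<longrightarrow> u a b \<cdot>\<^bsub>C\<^esub> \<rho> b = \<rho> a) \<and>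
     (\<forall>Y\<in>ob C. \<forall>f.
        (\<forall>a\<in>A. f a \<in> Hom C Y (D a)) \<and> (\<forall>a\<in>A. \<forall>b\<in>A. a \<le> b \<longrightarrow> u a b \<cdot>\<^bsub>C\<^esub> f b = f a) \<longrightarrow>
        (\<exists>!h. h \<in> Hom C Y L \<and> (\<forall>a\<in>A. \<rho> a \<cdot>\<^bsub>C\<^esub> h = f a)))"


section \<open>Inverse sequences\<close>

record ('o, 'm) invseq =
  obj  :: "nat \<Rightarrow> 'o"
  bond :: "nat \<Rightarrow> 'm"

record ('o, 'm) invseq_map =
  msrc  :: "('o, 'm) invseq"
  mtgt  :: "('o, 'm) invseq"
  level :: "nat \<Rightarrow> 'm"

definition seq_cat :: "('o, 'm) cat \<Rightarrow> (('o, 'm) invseq, ('o, 'm) invseq_map) cat" where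
  "seq_cat C =
     (let Obs = {S. \<forall>i. obj S i \<in> ob C \<and> bond S i \<in> Hom C (obj S (Suc i)) (obj S i)} in
      \<lparr>ob = Obs,
       arr = {\<phi>. msrc \<phi> \<in> Obs \<and> mtgt \<phi> \<in> Obs \<and>
                (\<forall>i. level \<phi> i \<in> Hom C (obj (msrc \<phi>) i) (obj (mtgt \<phi>) i) \<and>
                     level \<phi> i \<cdot>\<^bsub>C\<^esub> bond (msrc \<phi>) i = bond (mtgt \<phi>) i \<cdot>\<^bsub>C\<^esub> level \<phi> (Suc i))},
       src = msrc,
       tgt = mtgt,
       idn = (\<lambda>S. \<lparr>msrc = S, mtgt = S, level = (\<lambda>i. idn C (obj S i))\<rparr>),
       cmp = (\<lambda>\<psi> \<phi>. \<lparr>msrc = msrc \<phi>, mtgt = mtgt \<psi>, level = (\<lambda>i. level \<psi> i \<cdot>\<^bsub>C\<^esub> level \<phi> i)\<rparr>),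
       add = (\<lambda>\<phi> \<psi>. \<lparr>msrc = msrc \<phi>, mtgt = mtgt \<phi>, level = (\<lambda>i. add C (level \<phi> i) (level \<psi> i))\<rparr>),
       zer = (\<lambda>S T. \<lparr>msrc = S, mtgt = T, level = (\<lambda>i. zer C (obj S i) (obj T i))\<rparr>)\<rparr>)"

(* The object L is a cokernel of 1 - F on the product P of the S_i. *)
definition is_lim1 :: "('o, 'm) cat \<Rightarrow> ('o, 'm) invseq \<Rightarrow> 'o \<Rightarrow> bool" where
  "is_lim1 C S L \<longleftrightarrow>
     (\<exists>P \<pi> F q. is_product C UNIV (obj S) P \<pi> \<and>
        F \<in> Hom C P P \<and> (\<forall>j. \<pi> j \<cdot>\<^bsub>C\<^esub> F = bond S j \<cdot>\<^bsub>C\<^esub> \<pi> (Suc j)) \<and>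
        is_cokernel C (sub C (idn C P) F) q \<and> L = tgt C q)"

(* m is the inclusion I(S) \<rightarrow> S; that it is a morphism of inverse sequences determines
   the bonding maps of I(S). *)
definition is_image_seq ::
    "('o, 'm) cat \<Rightarrow> ('o, 'm) invseq \<Rightarrow> ('o, 'm) invseq \<Rightarrow> ('o, 'm) invseq_map \<Rightarrow> bool" where
  "is_image_seq C S T m \<longleftrightarrow> m \<in> Hom (seq_cat C) T S \<and> (\<forall>i. is_image C (bond S i) (level m i))"

(* J \<alpha> is I^\<alpha>(S), and t \<alpha> \<beta> : J \<beta> \<rightarrow> J \<alpha> (for \<alpha> \<le> \<beta>) are the canonical maps.  Images and
   limits, hence the whole tower, are determined up to isomorphism only. *)
definition is_image_tower ::
    "('o, 'm) cat \<Rightarrow> ('o, 'm) invseq \<Rightarrow> ('u::wellorder \<Rightarrow> ('o, 'm) invseq)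
       \<Rightarrow> ('u \<Rightarrow> 'u \<Rightarrow> ('o, 'm) invseq_map) \<Rightarrow> bool" where
  "is_image_tower C S J t \<longleftrightarrow>
     (\<forall>\<alpha>. J \<alpha> \<in> ob (seq_cat C)) \<and>
     (\<forall>\<alpha> \<beta>. \<alpha> \<le> \<beta> \<longrightarrow> t \<alpha> \<beta> \<in> Hom (seq_cat C) (J \<beta>) (J \<alpha>)) \<and>
     (\<forall>\<alpha>. t \<alpha> \<alpha> = idn (seq_cat C) (J \<alpha>)) \<and>
     (\<forall>\<alpha> \<beta> \<gamma>. \<alpha> \<le> \<beta> \<and> \<beta> \<le> \<gamma> \<longrightarrow> t \<alpha> \<beta> \<cdot>\<^bsub>seq_cat C\<^esub> t \<beta> \<gamma> = t \<alpha> \<gamma>) \<and>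
     J zero_ord = S \<and>
     (\<forall>\<alpha>. is_image_seq C (J \<alpha>) (J (succ_ord \<alpha>)) (t \<alpha> (succ_ord \<alpha>))) \<and>
     (\<forall>\<kappa>. limit_ord \<kappa> \<longrightarrow> is_inverse_limit (seq_cat C) {..<\<kappa>} J t (J \<kappa>) (\<lambda>\<alpha>. t \<alpha> \<kappa>))"

(* Here p \<beta> : S \<rightarrow> Q \<beta> is the projection onto S^\<beta> = Coker(I^\<beta>(S) \<rightarrow> S), u \<alpha> \<beta> : Q \<beta> \<rightarrow> Q \<alpha>
   are the induced maps, and L with projections \<rho> is the limit of the Q \<beta> for \<beta> < \<kappa>.  All these
   data exist and are unique up to isomorphism when C has small limits. *)
definition is_complete :: "('o, 'm) cat \<Rightarrow> ('o, 'm) invseq \<Rightarrow> 'u::wellorder \<Rightarrow> bool" where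
  "is_complete C S \<kappa> \<longleftrightarrow>
     (\<exists>(J :: 'u \<Rightarrow> ('o, 'm) invseq) t Q p u L \<rho> h.
        is_image_tower C S J t \<and>
        (\<forall>\<beta><\<kappa>. p \<beta> \<in> Hom (seq_cat C) S (Q \<beta>) \<and> is_cokernel (seq_cat C) (t zero_ord \<beta>) (p \<beta>)) \<and>
        (\<forall>\<alpha> \<beta>. \<alpha> \<le> \<beta> \<and> \<beta> < \<kappa> \<longrightarrow>
           u \<alpha> \<beta> \<in> Hom (seq_cat C) (Q \<beta>) (Q \<alpha>) \<and> u \<alpha> \<beta> \<cdot>\<^bsub>seq_cat C\<^esub> p \<beta> = p \<alpha>) \<and>
        is_inverse_limit (seq_cat C) {..<\<kappa>} Q u L \<rho> \<and>
        h \<in> Hom (seq_cat C) S L \<and> (\<forall>\<beta><\<kappa>. \<rho> \<beta> \<cdot>\<^bsub>seq_cat C\<^esub> h = p \<beta>) \<and>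
        is_epi (seq_cat C) h)"

end

(* lim^1 S = 0 means that 1 - F is epi on \<Prod> S_i, i.e. that a = a F implies a = 0 for all a.

   Epimorphic bonds (Roos): call d : G -> X liftable if it lifts along every epi onto X.  Exactness
   of products makes the liftable maps into X jointly epimorphic: an epi U -> G dominating all epis
   onto G is a pullback of a product of epis.  Using a copower of G, liftable maps lift along epis to
   liftable maps.  Hence y_i = x_i + f_i y_(i+1) has liftable solutions for liftable x.

   The quotients S/I^\<beta>(S): on each of them the system y_i = x_i + f_i y_(i+1) is uniquely solvable
   in generalized elements.  Unique solvability passes from S/J to S/I(J), as the bonds induce maps
   (S/J)_(i+1) -> (S/I(J))_i, and to inverse limits; by completeness S/I^\<lambda>(S) is the limit of the
   S/I^\<beta>(S), \<beta> < \<lambda>.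

   The tower I^\<beta>(S) becomes stationary, for reasons of size, at some I^\<alpha>(S), whose bonds are epi.
   The product of the sequences I^\<alpha>(S)_i -> S_i -> (S/I^\<alpha>(S))_i is exact, which combines the two
   cases. *)
theory Submission
  imports Defs
begin

section \<open>Preadditive categories\<close>

text \<open>In a category without elements, each choice of a preimage y_(i+1) passes to a new epi
  cover of the domain, and nothing guarantees that infinitely many covers have a common refinement.
  Liftable maps avoid this: every choice stays on the fixed domain G, as if G were projective. On
  the quotients, uniqueness is carried along with existence because it is what makes the solutions
  over different S/I^\<beta>(S) compatible in a limit. Completeness is used at limit ordinals: it
  makes S -> lim S/I^\<beta>(S) a quotient map, and its kernel is the intersection I^\<lambda>(S) of
  the I^\<beta>(S). Two matters of form shape the rest. Images and limits are fixed only up to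
  isomorphism, and completeness at each \<lambda> brings a tower of its own; so the induction runs
  over all towers at once, and towers are compared as subobjects of S. Moreover, limits, cokernels
  and epis are hypothesized among inverse sequences but used in the base category; they are
  evaluated place by place through the two adjoints of evaluation.\<close>

context category
begin

lemma HomD:
  assumes "f \<in> Hom C A B"
  shows "f \<in> arr C" "src C f = A" "tgt C f = B" "A \<in> ob C" "B \<in> ob C"
  using assms src_ob tgt_ob by (auto simp: Hom_def)

lemma HomI: "f \<in> arr C \<Longrightarrow> f \<in> Hom C (src C f) (tgt C f)"
  by (simp add: Hom_def)

lemma is_epiD:
  assumes "is_epi C f" "f \<in> Hom C A B" "g \<in> Hom C B X" "h \<in> Hom C B X" "g \<cdot> f = h \<cdot> f"
  shows "g = h"
  using assms HomD[OF assms(2)] HomD[OF assms(3)] unfolding is_epi_def by blast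

lemma is_monoD:
  assumes "is_mono C f" "f \<in> Hom C A B" "g \<in> Hom C X A" "h \<in> Hom C X A" "f \<cdot> g = f \<cdot> h"
  shows "g = h"
  using assms HomD[OF assms(2)] HomD[OF assms(3)] unfolding is_mono_def by blast

lemma is_epi_cmp:
  assumes "is_epi C f" "f \<in> Hom C A B" "is_epi C g" "g \<in> Hom C B D"
  shows "is_epi C (g \<cdot> f)"
  unfolding is_epi_def
proof (intro conjI ballI impI)
  have gf: "g \<cdot> f \<in> Hom C A D" using assms cmp_Hom by blast
  then show "g \<cdot> f \<in> arr C" using HomD by blast
  fix X h k assume "X \<in> ob C" and h: "h \<in> Hom C (tgt C (g \<cdot> f)) X"
    and k: "k \<in> Hom C (tgt C (g \<cdot> f)) X" and eq: "h \<cdot> (g \<cdot> f) = k \<cdot> (g \<cdot> f)"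
  have h': "h \<in> Hom C D X" and k': "k \<in> Hom C D X" using h k HomD[OF gf] by auto
  have "(h \<cdot> g) \<cdot> f = (k \<cdot> g) \<cdot> f"
    using eq cmp_assoc[OF assms(2) assms(4) h'] cmp_assoc[OF assms(2) assms(4) k'] by simp
  then have "h \<cdot> g = k \<cdot> g"
    using is_epiD[OF assms(1,2)] cmp_Hom[OF assms(4) h'] cmp_Hom[OF assms(4) k'] by blast
  then show "h = k" using is_epiD[OF assms(3,4) h' k'] by blast
qed

section \<open>Products, coproducts, generators and inverse limits\<close>

lemma is_product_Hom: "is_product C I X P \<pi> \<Longrightarrow> i \<in> I \<Longrightarrow> \<pi> i \<in> Hom C P (X i)"
  by (simp add: is_product_def)

lemma is_product_ex1:
  assumes "is_product C I X P \<pi>" "Y \<in> ob C" "\<And>i. i \<in> I \<Longrightarrow> f i \<in> Hom C Y (X i)"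
  shows "\<exists>!h. h \<in> Hom C Y P \<and> (\<forall>i\<in>I. \<pi> i \<cdot> h = f i)"
proof -
  have "\<forall>f. (\<forall>i\<in>I. f i \<in> Hom C Y (X i)) \<longrightarrow> (\<exists>!h. h \<in> Hom C Y P \<and> (\<forall>i\<in>I. \<pi> i \<cdot> h = f i))"
    using assms(1,2) unfolding is_product_def by blast
  from this[THEN spec, of f] show ?thesis using assms(3) by blast
qed

lemma is_product_lift:
  assumes "is_product C I X P \<pi>" "Y \<in> ob C" "\<And>i. i \<in> I \<Longrightarrow> f i \<in> Hom C Y (X i)"
  obtains h where "h \<in> Hom C Y P" "\<And>i. i \<in> I \<Longrightarrow> \<pi> i \<cdot> h = f i"
  using is_product_ex1[OF assms] by blast

lemma is_product_eqI:
  assumes P: "is_product C I X P \<pi>" and h: "h \<in> Hom C Y P" and k: "k \<in> Hom C Y P"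
    and eq: "\<And>i. i \<in> I \<Longrightarrow> \<pi> i \<cdot> h = \<pi> i \<cdot> k"
  shows "h = k"
proof -
  have "\<exists>!h. h \<in> Hom C Y P \<and> (\<forall>i\<in>I. \<pi> i \<cdot> h = \<pi> i \<cdot> k)"
    using is_product_ex1[OF P HomD(4)[OF h], of "\<lambda>i. \<pi> i \<cdot> k"] is_product_Hom[OF P] k cmp_Hom by blast
  then show ?thesis using h k eq by blast
qed

lemma is_coproduct_Hom: "is_coproduct C I X P \<iota> \<Longrightarrow> i \<in> I \<Longrightarrow> \<iota> i \<in> Hom C (X i) P"
  by (simp add: is_coproduct_def)

lemma is_coproduct_ex1:
  assumes "is_coproduct C I X P \<iota>" "Y \<in> ob C" "\<And>i. i \<in> I \<Longrightarrow> f i \<in> Hom C (X i) Y"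
  shows "\<exists>!h. h \<in> Hom C P Y \<and> (\<forall>i\<in>I. h \<cdot> \<iota> i = f i)"
proof -
  have "\<forall>f. (\<forall>i\<in>I. f i \<in> Hom C (X i) Y) \<longrightarrow> (\<exists>!h. h \<in> Hom C P Y \<and> (\<forall>i\<in>I. h \<cdot> \<iota> i = f i))"
    using assms(1,2) unfolding is_coproduct_def by blast
  from this[THEN spec, of f] show ?thesis using assms(3) by blast
qed

lemma is_coproduct_desc:
  assumes "is_coproduct C I X P \<iota>" "Y \<in> ob C" "\<And>i. i \<in> I \<Longrightarrow> f i \<in> Hom C (X i) Y"
  obtains h where "h \<in> Hom C P Y" "\<And>i. i \<in> I \<Longrightarrow> h \<cdot> \<iota> i = f i"
  using is_coproduct_ex1[OF assms] by blast

lemma is_coproduct_eqI: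
  assumes P: "is_coproduct C I X P \<iota>" and h: "h \<in> Hom C P Y" and k: "k \<in> Hom C P Y"
    and eq: "\<And>i. i \<in> I \<Longrightarrow> h \<cdot> \<iota> i = k \<cdot> \<iota> i"
  shows "h = k"
proof -
  have "\<exists>!h. h \<in> Hom C P Y \<and> (\<forall>i\<in>I. h \<cdot> \<iota> i = k \<cdot> \<iota> i)"
    using is_coproduct_ex1[OF P HomD(5)[OF h], of "\<lambda>i. k \<cdot> \<iota> i"] is_coproduct_Hom[OF P] k cmp_Hom by blast
  then show ?thesis using h k eq by blast
qed

text \<open>The hypotheses on products and coproducts speak of index sets in \<open>'u\<close>,
  while the proof indexes by \<open>nat\<close>, by sets of arrows and by sets of such sets. This
  lemma and the next two move families along an injection \<open>e\<close>; forwards, the family on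
  the image is read off through \<open>inv_into\<close>.\<close>

lemma is_product_reindex:
  assumes P: "is_product C I X P \<pi>" and e: "inj_on e I"
  shows "is_product C (e ` I) (\<lambda>k. X (inv_into I e k)) P (\<lambda>k. \<pi> (inv_into I e k))"
  unfolding is_product_def
proof (intro conjI ballI allI impI)
  show "P \<in> ob C" using P by (simp add: is_product_def)
  show "\<pi> (inv_into I e k) \<in> Hom C P (X (inv_into I e k))" if "k \<in> e ` I" for k
    using is_product_Hom[OF P] inv_into_into[OF that] by blast
  fix Y f assume Y: "Y \<in> ob C" and f: "\<forall>k\<in>e ` I. f k \<in> Hom C Y (X (inv_into I e k))"
  have "\<exists>!h. h \<in> Hom C Y P \<and> (\<forall>i\<in>I. \<pi> i \<cdot> h = f (e i))"
    using is_product_ex1[OF P Y, of "\<lambda>i. f (e i)"] f e by simp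
  then show "\<exists>!h. h \<in> Hom C Y P \<and> (\<forall>k\<in>e ` I. \<pi> (inv_into I e k) \<cdot> h = f k)"
    using e by simp
qed

lemma is_product_unreindex:
  assumes P: "is_product C (e ` I) X P \<pi>" and e: "inj_on e I"
  shows "is_product C I (\<lambda>i. X (e i)) P (\<lambda>i. \<pi> (e i))"
  unfolding is_product_def
proof (intro conjI ballI allI impI)
  show "P \<in> ob C" using P by (simp add: is_product_def)
  show "\<pi> (e i) \<in> Hom C P (X (e i))" if "i \<in> I" for i
    using is_product_Hom[OF P] that by blast
  fix Y f assume Y: "Y \<in> ob C" and f: "\<forall>i\<in>I. f i \<in> Hom C Y (X (e i))"
  have "f (inv_into I e k) \<in> Hom C Y (X k)" if "k \<in> e ` I" for k
    using that f e by auto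
  from is_product_ex1[OF P Y this]
  show "\<exists>!h. h \<in> Hom C Y P \<and> (\<forall>i\<in>I. \<pi> (e i) \<cdot> h = f i)"
    using e by simp
qed

lemma is_coproduct_unreindex:
  assumes P: "is_coproduct C (e ` I) X P \<iota>" and e: "inj_on e I"
  shows "is_coproduct C I (\<lambda>i. X (e i)) P (\<lambda>i. \<iota> (e i))"
  unfolding is_coproduct_def
proof (intro conjI ballI allI impI)
  show "P \<in> ob C" using P by (simp add: is_coproduct_def)
  show "\<iota> (e i) \<in> Hom C (X (e i)) P" if "i \<in> I" for i
    using is_coproduct_Hom[OF P] that by blast
  fix Y f assume Y: "Y \<in> ob C" and f: "\<forall>i\<in>I. f i \<in> Hom C (X (e i)) Y"
  have "f (inv_into I e k) \<in> Hom C (X k) Y" if "k \<in> e ` I" for k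
    using that f e by auto
  from is_coproduct_ex1[OF P Y this]
  show "\<exists>!h. h \<in> Hom C P Y \<and> (\<forall>i\<in>I. h \<cdot> \<iota> (e i) = f i)"
    using e by simp
qed

lemma is_generator_eqI:
  assumes G: "is_generator C G" and f: "f \<in> Hom C A B" and g: "g \<in> Hom C A B"
    and eq: "\<And>x. x \<in> Hom C G A \<Longrightarrow> f \<cdot> x = g \<cdot> x"
  shows "f = g"
proof -
  have "inj_on (\<lambda>f. \<lambda>h\<in>Hom C G A. f \<cdot> h) (Hom C A B)"
    using G HomD[OF f] unfolding is_generator_def by blast
  moreover have "(\<lambda>h\<in>Hom C G A. f \<cdot> h) = (\<lambda>h\<in>Hom C G A. g \<cdot> h)"
    using eq by (auto simp: restrict_def)
  ultimately show ?thesis using f g by (simp add: inj_on_def)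
qed

lemma inverse_limit_Hom:
  "is_inverse_limit C A D u L \<rho> \<Longrightarrow> a \<in> A \<Longrightarrow> \<rho> a \<in> Hom C L (D a)"
  by (simp add: is_inverse_limit_def)

lemma inverse_limit_ex1:
  assumes "is_inverse_limit C A D u L \<rho>" "Y \<in> ob C" "\<And>a. a \<in> A \<Longrightarrow> f a \<in> Hom C Y (D a)"
    "\<And>a b. a \<in> A \<Longrightarrow> b \<in> A \<Longrightarrow> a \<le> b \<Longrightarrow> u a b \<cdot> f b = f a"
  shows "\<exists>!h. h \<in> Hom C Y L \<and> (\<forall>a\<in>A. \<rho> a \<cdot> h = f a)"
proof -
  have "(\<forall>a\<in>A. f a \<in> Hom C Y (D a)) \<and> (\<forall>a\<in>A. \<forall>b\<in>A. a \<le> b \<longrightarrow> u a b \<cdot> f b = f a)"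
    using assms(3,4) by simp
  with assms(1)[unfolded is_inverse_limit_def, THEN conjunct2, THEN conjunct2, THEN conjunct2,
      THEN bspec, OF assms(2), THEN spec, of f] show ?thesis by (rule mp)
qed

text \<open>The typing of \<open>u\<close> is a hypothesis because \<open>is_inverse_limit\<close>
  does not contain it; it is used to see by associativity that the composites with \<open>k\<close>
  form a cone.\<close>

lemma inverse_limit_eqI:
  assumes L: "is_inverse_limit C A D u L \<rho>" and h: "h \<in> Hom C Y L" and k: "k \<in> Hom C Y L"
    and u: "\<And>a b. a \<in> A \<Longrightarrow> b \<in> A \<Longrightarrow> a \<le> b \<Longrightarrow> u a b \<in> Hom C (D b) (D a)"
    and eq: "\<And>a. a \<in> A \<Longrightarrow> \<rho> a \<cdot> h = \<rho> a \<cdot> k"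
  shows "h = k"
proof -
  have "\<rho> a \<cdot> k \<in> Hom C Y (D a)" if "a \<in> A" for a
    using inverse_limit_Hom[OF L that] k cmp_Hom by blast
  moreover have "u a b \<cdot> (\<rho> b \<cdot> k) = \<rho> a \<cdot> k" if ab: "a \<in> A" "b \<in> A" "a \<le> b" for a b
    using cmp_assoc[OF k inverse_limit_Hom[OF L ab(2)] u[OF ab]] L ab
    unfolding is_inverse_limit_def by auto
  ultimately have "\<exists>!h. h \<in> Hom C Y L \<and> (\<forall>a\<in>A. \<rho> a \<cdot> h = \<rho> a \<cdot> k)"
    using inverse_limit_ex1[OF L HomD(4)[OF h], of "\<lambda>a. \<rho> a \<cdot> k"] by blast
  then show ?thesis using h k eq by blast
qed

end

context preadditive_category
begin

context
  fixes A B assumes ob: "A \<in> ob C" "B \<in> ob C"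
begin

interpretation comm_group "hom_group C A B"
  using comm_group_Hom ob by blast

lemma zer_Hom: "zer C A B \<in> Hom C A B"
  using one_closed by (simp add: hom_group_def)

lemma add_Hom': "f \<in> Hom C A B \<Longrightarrow> g \<in> Hom C A B \<Longrightarrow> add C f g \<in> Hom C A B"
  using m_closed by (simp add: hom_group_def)

lemma sub_Hom':
  assumes f: "f \<in> Hom C A B" and g: "g \<in> Hom C A B"
  shows "sub C f g \<in> Hom C A B"
  using m_closed[of f, OF _ inv_closed[of g]] f g HomD[OF f] unfolding sub_def
  by (simp add: hom_group_def)

lemma add_zer': "f \<in> Hom C A B \<Longrightarrow> add C f (zer C A B) = f"
  using r_one by (simp add: hom_group_def)

lemma add_commute': "f \<in> Hom C A B \<Longrightarrow> g \<in> Hom C A B \<Longrightarrow> add C f g = add C g f"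
  using m_comm by (simp add: hom_group_def)

lemma add_sub_cancel':
  assumes f: "f \<in> Hom C A B" and g: "g \<in> Hom C A B"
  shows "add C g (sub C f g) = f"
proof -
  let ?G = "hom_group C A B"
  have c: "f \<in> carrier ?G" "g \<in> carrier ?G" using f g by (simp_all add: hom_group_def)
  have "g \<otimes>\<^bsub>?G\<^esub> (f \<otimes>\<^bsub>?G\<^esub> inv\<^bsub>?G\<^esub> g) = f" using c
    by (simp add: m_lcomm r_inv)
  moreover have "f \<otimes>\<^bsub>?G\<^esub> inv\<^bsub>?G\<^esub> g = sub C f g"
    unfolding sub_def using HomD[OF f] by (simp add: hom_group_def)
  ultimately show ?thesis by (simp add: hom_group_def)
qed

lemma add_cancel_left':
  "f \<in> Hom C A B \<Longrightarrow> g \<in> Hom C A B \<Longrightarrow> h \<in> Hom C A B \<Longrightarrow> add C f g = add C f h \<longleftrightarrow> g = h"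
  using Units_l_cancel[of f g h] Units_eq by (simp add: hom_group_def)

end

text \<open>Membership in \<open>Hom C A B\<close> already makes both ends objects, so here and
  below the object hypotheses of the primed group laws disappear.\<close>

lemma add_Hom: "f \<in> Hom C A B \<Longrightarrow> g \<in> Hom C A B \<Longrightarrow> add C f g \<in> Hom C A B"
  using add_Hom' HomD(4,5)[of f A B] by blast

lemma sub_Hom: "f \<in> Hom C A B \<Longrightarrow> g \<in> Hom C A B \<Longrightarrow> sub C f g \<in> Hom C A B"
  using sub_Hom' HomD(4,5)[of f A B] by blast

lemma add_zer: "f \<in> Hom C A B \<Longrightarrow> add C f (zer C A B) = f"
  using add_zer' HomD(4,5)[of f A B] by blast

lemma add_commute: "f \<in> Hom C A B \<Longrightarrow> g \<in> Hom C A B \<Longrightarrow> add C f g = add C g f"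
  using add_commute' HomD(4,5)[of f A B] by blast

lemma add_sub_cancel: "f \<in> Hom C A B \<Longrightarrow> g \<in> Hom C A B \<Longrightarrow> add C g (sub C f g) = f"
  using add_sub_cancel' HomD(4,5)[of f A B] by blast

lemma add_cancel_left:
  "f \<in> Hom C A B \<Longrightarrow> g \<in> Hom C A B \<Longrightarrow> h \<in> Hom C A B \<Longrightarrow> add C f g = add C f h \<longleftrightarrow> g = h"
  using add_cancel_left' HomD(4,5)[of f A B] by blast

text \<open>The form in which every invariance argument ends: from a h = a x + a h it follows that a
  x = 0.\<close>

lemma add_eq_self_iff:
  assumes "f \<in> Hom C A B" "g \<in> Hom C A B"
  shows "f = add C g f \<longleftrightarrow> g = zer C A B"
proof -
  have z: "zer C A B \<in> Hom C A B" using zer_Hom HomD[OF assms(1)] by blast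
  show ?thesis
    using add_cancel_left[OF assms(1) z assms(2)] add_commute[OF assms] add_zer[OF assms(1)]
    by auto
qed

lemma cmp_zer_right:
  assumes "g \<in> Hom C B D" "A \<in> ob C"
  shows "g \<cdot> zer C A B = zer C A D"
proof -
  have z: "zer C A B \<in> Hom C A B" using assms HomD zer_Hom by blast
  have "g \<cdot> zer C A B = add C (g \<cdot> zer C A B) (g \<cdot> zer C A B)"
    using cmp_add_right[OF z z assms(1)] add_zer[OF z] z by simp
  then show ?thesis using add_eq_self_iff cmp_Hom[OF z assms(1)] by metis
qed

lemma cmp_zer_left:
  assumes "f \<in> Hom C A B" "D \<in> ob C"
  shows "zer C B D \<cdot> f = zer C A D"
proof -
  have z: "zer C B D \<in> Hom C B D" using assms HomD zer_Hom by blast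
  have "zer C B D \<cdot> f = add C (zer C B D \<cdot> f) (zer C B D \<cdot> f)"
    using cmp_add_left[OF assms(1) z z] add_zer[OF z] z by simp
  then show ?thesis using add_eq_self_iff cmp_Hom[OF assms(1) z] by metis
qed

lemma cmp_sub_left:
  assumes f: "f \<in> Hom C A B" and g: "g \<in> Hom C B D" and h: "h \<in> Hom C B D"
  shows "sub C g h \<cdot> f = sub C (g \<cdot> f) (h \<cdot> f)"
proof -
  have "add C (h \<cdot> f) (sub C g h \<cdot> f) = g \<cdot> f"
    using cmp_add_left[OF f h sub_Hom[OF g h]] add_sub_cancel[OF g h] by simp
  moreover have "add C (h \<cdot> f) (sub C (g \<cdot> f) (h \<cdot> f)) = g \<cdot> f"
    using add_sub_cancel cmp_Hom f g h by metis
  ultimately show ?thesis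
    using add_cancel_left cmp_Hom[OF f h] cmp_Hom[OF f sub_Hom[OF g h]]
      sub_Hom cmp_Hom[OF f g] by metis
qed

lemma cmp_sub_right:
  assumes f: "f \<in> Hom C A B" and g: "g \<in> Hom C A B" and h: "h \<in> Hom C B D"
  shows "h \<cdot> sub C f g = sub C (h \<cdot> f) (h \<cdot> g)"
proof -
  have "add C (h \<cdot> g) (h \<cdot> sub C f g) = h \<cdot> f"
    using cmp_add_right[OF g sub_Hom[OF f g] h] add_sub_cancel[OF f g] by simp
  moreover have "add C (h \<cdot> g) (sub C (h \<cdot> f) (h \<cdot> g)) = h \<cdot> f"
    using add_sub_cancel cmp_Hom f g h by metis
  ultimately show ?thesis
    using add_cancel_left cmp_Hom[OF g h] cmp_Hom[OF sub_Hom[OF f g] h]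
      sub_Hom cmp_Hom[OF f h] by metis
qed

lemma sub_eq_zer_iff:
  assumes f: "f \<in> Hom C A B" and g: "g \<in> Hom C A B"
  shows "sub C f g = zer C A B \<longleftrightarrow> f = g"
proof -
  have z: "zer C A B \<in> Hom C A B" using zer_Hom HomD[OF f] by blast
  have "add C g (sub C f g) = add C g (zer C A B) \<longleftrightarrow> sub C f g = zer C A B"
    using add_cancel_left[OF g sub_Hom[OF f g] z] .
  then show ?thesis using add_sub_cancel[OF f g] add_zer[OF g] by simp
qed

lemma is_epi_iff:
  assumes f: "f \<in> Hom C A B"
  shows "is_epi C f \<longleftrightarrow> (\<forall>X\<in>ob C. \<forall>g\<in>Hom C B X. g \<cdot> f = zer C A X \<longrightarrow> g = zer C B X)"
proof
  assume "is_epi C f"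
  then show "\<forall>X\<in>ob C. \<forall>g\<in>Hom C B X. g \<cdot> f = zer C A X \<longrightarrow> g = zer C B X"
    using is_epiD f cmp_zer_left zer_Hom HomD by metis
next
  assume *: "\<forall>X\<in>ob C. \<forall>g\<in>Hom C B X. g \<cdot> f = zer C A X \<longrightarrow> g = zer C B X"
  show "is_epi C f" unfolding is_epi_def
  proof (intro conjI ballI impI)
    show "f \<in> arr C" using HomD[OF f] by blast
    fix X g h assume X: "X \<in> ob C" and gh: "g \<in> Hom C (tgt C f) X" "h \<in> Hom C (tgt C f) X"
      and eq: "g \<cdot> f = h \<cdot> f"
    have gh': "g \<in> Hom C B X" "h \<in> Hom C B X" using gh HomD[OF f] by auto
    have "sub C g h \<cdot> f = zer C A X"
      using cmp_sub_left[OF f gh'] eq sub_eq_zer_iff cmp_Hom[OF f gh'(2)] by metis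
    then show "g = h" using * X sub_Hom gh' sub_eq_zer_iff by metis
  qed
qed

section \<open>Kernels and cokernels through their factorization properties\<close>

lemma is_kernelD:
  assumes "is_kernel C f k" "f \<in> Hom C A B"
  shows "k \<in> Hom C (src C k) A" "f \<cdot> k = zer C (src C k) B"
  using assms HomD[OF assms(2)] unfolding is_kernel_def by (auto simp: Hom_def)

lemma is_kernel_lift:
  assumes "is_kernel C f k" "f \<in> Hom C A B" "k \<in> Hom C K A"
    "h \<in> Hom C X A" "f \<cdot> h = zer C X B"
  obtains u where "u \<in> Hom C X K" "k \<cdot> u = h"
  using assms(1,4,5) HomD[OF assms(2)] HomD[OF assms(3)] HomD[OF assms(4)]
  unfolding is_kernel_def by blast

lemma is_cokernelD:
  assumes "is_cokernel C f q" "f \<in> Hom C A B"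
  shows "q \<in> Hom C B (tgt C q)" "q \<cdot> f = zer C A (tgt C q)"
  using assms HomD[OF assms(2)] unfolding is_cokernel_def by (auto simp: Hom_def)

lemma is_cokernel_desc:
  assumes "is_cokernel C f q" "f \<in> Hom C A B" "q \<in> Hom C B Q"
    "h \<in> Hom C B X" "h \<cdot> f = zer C A X"
  obtains u where "u \<in> Hom C Q X" "u \<cdot> q = h"
  using assms(1,4,5) HomD[OF assms(2)] HomD[OF assms(3)] HomD[OF assms(4)]
  unfolding is_cokernel_def by blast

lemma is_cokernel_epi:
  assumes q: "is_cokernel C f q"
  shows "is_epi C q"
proof -
  let ?A = "src C f" and ?B = "tgt C f" and ?Q = "tgt C q"
  have f: "f \<in> Hom C ?A ?B" using q HomI unfolding is_cokernel_def by blast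
  note q' = is_cokernelD[OF q f]
  show ?thesis unfolding is_epi_iff[OF q'(1)]
  proof (intro ballI impI)
    fix X g assume X: "X \<in> ob C" and g: "g \<in> Hom C ?Q X" and eq: "g \<cdot> q = zer C ?B X"
    have z: "zer C ?Q X \<in> Hom C ?Q X" using HomD[OF g] zer_Hom by blast
    have z': "zer C ?B X \<in> Hom C ?B X" using HomD[OF f] X zer_Hom by blast
    have "zer C ?B X \<cdot> f = zer C ?A X" using cmp_zer_left[OF f X] .
    then have "\<exists>!u. u \<in> Hom C ?Q X \<and> u \<cdot> q = zer C ?B X"
      using q X z' unfolding is_cokernel_def by blast
    moreover have "zer C ?Q X \<cdot> q = zer C ?B X" using cmp_zer_left[OF q'(1) X] .
    ultimately show "g = zer C ?Q X" using g z eq by blast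
  qed
qed

lemma is_kernel_mono:
  assumes k: "is_kernel C f k"
  shows "is_mono C k"
  unfolding is_mono_def
proof (intro conjI ballI impI)
  let ?A = "src C f" and ?B = "tgt C f" and ?K = "src C k"
  have f: "f \<in> Hom C ?A ?B" using k HomI unfolding is_kernel_def by blast
  note k' = is_kernelD[OF k f]
  show "k \<in> arr C" using HomD[OF k'(1)] by blast
  fix X g h assume X: "X \<in> ob C" and g: "g \<in> Hom C X ?K" and h: "h \<in> Hom C X ?K"
    and eq: "k \<cdot> g = k \<cdot> h"
  have "f \<cdot> (k \<cdot> g) = zer C X ?B"
    using cmp_assoc[OF g k'(1) f] k'(2) cmp_zer_left[OF g] HomD[OF f] by simp
  then have "\<exists>!u. u \<in> Hom C X ?K \<and> k \<cdot> u = k \<cdot> g"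
    using k X cmp_Hom[OF g k'(1)] unfolding is_kernel_def by blast
  then show "g = h" using g h eq by metis
qed

lemma is_zeroI:
  assumes Z: "Z \<in> ob C" and eq: "idn C Z = zer C Z Z"
  shows "is_zero C Z"
proof -
  have "f = zer C Z X" if "f \<in> Hom C Z X" for f X
    using that eq idn_right[OF that] cmp_zer_right[OF that Z] by simp
  moreover have "f = zer C X Z" if "f \<in> Hom C X Z" for f X
    using that eq idn_left[OF that] cmp_zer_left[OF that Z] by simp
  ultimately show ?thesis unfolding is_zero_def using Z zer_Hom by metis
qed

lemma sub_idn_epi_iff:
  assumes F: "F \<in> Hom C P P"
  shows "is_epi C (sub C (idn C P) F) \<longleftrightarrow>
    (\<forall>X\<in>ob C. \<forall>a\<in>Hom C P X. a = a \<cdot> F \<longrightarrow> a = zer C P X)"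
proof -
  have P: "P \<in> ob C" using HomD[OF F] by blast
  note id = idn_Hom[OF P]
  have "a \<cdot> sub C (idn C P) F = zer C P X \<longleftrightarrow> a = a \<cdot> F" if a: "a \<in> Hom C P X" for a X
    using cmp_sub_right[OF id F a] idn_right[OF a] sub_eq_zer_iff[OF a cmp_Hom[OF F a]] by simp
  then show ?thesis using is_epi_iff[OF sub_Hom[OF id F]] by auto
qed

end

section \<open>Small sets and small products\<close>

lemma small_subset: "small U B \<Longrightarrow> A \<subseteq> B \<Longrightarrow> small U A"
  unfolding small_def using subset_imp_lepoll lesspoll_trans1 by blast

lemma small_inj:
  assumes "small (U :: 'u itself) A"
  obtains e :: "'a \<Rightarrow> 'u" where "inj_on e A" "small U (e ` A)"
proof -
  obtain e :: "'a \<Rightarrow> 'u" where e: "inj_on e A"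
    using assms unfolding small_def lesspoll_def lepoll_def by blast
  have "e ` A \<lesssim> A" by (simp add: image_lepoll)
  then have "small U (e ` A)" using assms lesspoll_trans1 unfolding small_def by blast
  then show ?thesis using that e by blast
qed

lemma small_Pow:
  assumes U: "universe_type (U :: 'u::wellorder itself)" and A: "small U A"
  shows "small U (Pow A)"
proof -
  obtain e :: "'a \<Rightarrow> 'u" where e: "inj_on e A" "small U (e ` A)" using small_inj[OF A] .
  have "small U (Pow (e ` A))" using U e(2) unfolding universe_type_def by blast
  moreover have "Pow A \<lesssim> Pow (e ` A)"
    unfolding lepoll_def using inj_on_image_Pow[OF e(1)] image_Pow_mono[of e A "e ` A"] by blast
  ultimately show ?thesis unfolding small_def using lesspoll_trans1 by blast
qed

context category
begin

lemma small_product_exists: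
  assumes "has_small_products (U :: 'u itself) C" and I: "small U I" and X: "\<And>i. i \<in> I \<Longrightarrow> X i \<in> ob C"
  obtains P \<pi> where "is_product C I X P \<pi>"
proof -
  obtain e :: "'a \<Rightarrow> 'u" where e: "inj_on e I" "small U (e ` I)" using small_inj[OF I] .
  have "\<forall>k\<in>e ` I. X (inv_into I e k) \<in> ob C" using X by (simp add: inv_into_into)
  then obtain P \<pi> where "is_product C (e ` I) (\<lambda>k. X (inv_into I e k)) P \<pi>"
    using assms(1) e(2) unfolding has_small_products_def
    by (elim allE[where x = "e ` I"] allE[where x = "\<lambda>k. X (inv_into I e k)"]) blast
  from is_product_unreindex[OF this e(1)]
  have "is_product C I X P (\<lambda>i. \<pi> (e i))"
    using e(1) unfolding is_product_def by simp
  then show ?thesis using that by blast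
qed

lemma small_copower_exists:
  assumes "has_small_coproducts (U :: 'u itself) C" and I: "small U I" and X: "X \<in> ob C"
  obtains P \<iota> where "is_coproduct C I (\<lambda>_. X) P \<iota>"
proof -
  obtain e :: "'a \<Rightarrow> 'u" where e: "inj_on e I" "small U (e ` I)" using small_inj[OF I] .
  obtain P \<iota> where "is_coproduct C (e ` I) (\<lambda>_. X) P \<iota>"
    using assms(1) e(2) X unfolding has_small_coproducts_def
    by (elim allE[where x = "e ` I"] allE[where x = "\<lambda>_. X"]) blast
  from is_coproduct_unreindex[OF this e(1)] that show ?thesis by blast
qed

text \<open>Exactness for an arbitrary small index set: all three products are reindexed along the
  same injection into \<open>'u\<close>.\<close>

lemma product_short_exact:
  assumes ex: "small_products_exact (U :: 'u itself) C" and I: "small U I"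
    and f: "\<And>i. i \<in> I \<Longrightarrow> f i \<in> Hom C (X i) (Y i)" and g: "\<And>i. i \<in> I \<Longrightarrow> g i \<in> Hom C (Y i) (Z i)"
    and fg: "\<And>i. i \<in> I \<Longrightarrow> short_exact C (f i) (g i)"
    and P: "is_product C I X P \<pi>" and Q: "is_product C I Y Q \<rho>" and R: "is_product C I Z R \<sigma>"
    and f': "f' \<in> Hom C P Q" "\<And>i. i \<in> I \<Longrightarrow> \<rho> i \<cdot> f' = f i \<cdot> \<pi> i"
    and g': "g' \<in> Hom C Q R" "\<And>i. i \<in> I \<Longrightarrow> \<sigma> i \<cdot> g' = g i \<cdot> \<rho> i"
  shows "short_exact C f' g'"
proof -
  obtain e :: "'a \<Rightarrow> 'u" where e: "inj_on e I" "small U (e ` I)" using small_inj[OF I] .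
  let ?r = "inv_into I e"
  note PQR = is_product_reindex[OF P e(1)] is_product_reindex[OF Q e(1)] is_product_reindex[OF R e(1)]
  have r: "k \<in> e ` I \<Longrightarrow> ?r k \<in> I" for k by (rule inv_into_into)
  show ?thesis
    by (rule ex[unfolded small_products_exact_def, rule_format,
          of "e ` I" "\<lambda>k. f (?r k)" "\<lambda>k. X (?r k)" "\<lambda>k. Y (?r k)" "\<lambda>k. g (?r k)" "\<lambda>k. Z (?r k)"
             P "\<lambda>k. \<pi> (?r k)" Q "\<lambda>k. \<rho> (?r k)" R "\<lambda>k. \<sigma> (?r k)"])
      (use PQR e(2) r f g fg f' g' in simp)
qed

text \<open>A substitute for maps out of a projective object: if \<open>G\<close> were projective,
  every map from \<open>G\<close> to \<open>X\<close> would belong to this set.\<close>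

definition liftable :: "'o \<Rightarrow> 'o \<Rightarrow> 'm set" where
  "liftable G X = {d \<in> Hom C G X. \<forall>H p. p \<in> Hom C H X \<and> is_epi C p \<longrightarrow> (\<exists>k\<in>Hom C G H. p \<cdot> k = d)}"

lemma liftable_Hom: "d \<in> liftable G X \<Longrightarrow> d \<in> Hom C G X"
  by (simp add: liftable_def)

lemma liftable_lift:
  assumes "d \<in> liftable G X" "p \<in> Hom C H X" "is_epi C p"
  obtains k where "k \<in> Hom C G H" "p \<cdot> k = d"
  using assms unfolding liftable_def by blast

end

context preadditive_category
begin

text \<open>Needed for the recursion that solves the shift equation, where the difference of two
  liftable maps has to be lifted along a bond.\<close>

lemma liftable_sub:
  assumes "d \<in> liftable G X" "d' \<in> liftable G X"
  shows "sub C d d' \<in> liftable G X"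
proof -
  have "\<exists>k\<in>Hom C G H. p \<cdot> k = sub C d d'" if p: "p \<in> Hom C H X" "is_epi C p" for H p
  proof -
    obtain k where k: "k \<in> Hom C G H" "p \<cdot> k = d" using liftable_lift[OF assms(1) p] .
    obtain k' where k': "k' \<in> Hom C G H" "p \<cdot> k' = d'" using liftable_lift[OF assms(2) p] .
    show ?thesis using cmp_sub_right[OF k(1) k'(1) p(1)] sub_Hom[OF k(1) k'(1)] k k' by auto
  qed
  then show ?thesis unfolding liftable_def
    using sub_Hom[OF assms[THEN liftable_Hom]] by blast
qed

lemma liftable_zer:
  assumes "G \<in> ob C" "X \<in> ob C"
  shows "zer C G X \<in> liftable G X"
  unfolding liftable_def using assms zer_Hom cmp_zer_right HomD(4) by fast

end

section \<open>Abelian categories\<close>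

context abelian_category
begin

text \<open>By normality \<open>m\<close> is the kernel of some \<open>g\<close>. This
  \<open>g\<close> kills \<open>m\<close>, so it factors through \<open>q\<close>; hence whatever
  \<open>q\<close> kills is killed by \<open>g\<close> and factors through \<open>m\<close>.\<close>

lemma kernel_of_cokernel:
  assumes m: "is_mono C m" "m \<in> Hom C A B" and q: "is_cokernel C m q"
  shows "is_kernel C q m"
proof -
  let ?Q = "tgt C q"
  note q' = is_cokernelD[OF q m(2)]
  note m' = HomD[OF m(2)] and q'' = HomD[OF q'(1)]
  obtain g where g: "is_kernel C g m" using mono_normal[OF m(1)] by blast
  let ?Y = "tgt C g"
  have g': "g \<in> Hom C B ?Y" "g \<cdot> m = zer C A ?Y"
    using g m' unfolding is_kernel_def Hom_def by auto
  obtain u where u: "u \<in> Hom C ?Q ?Y" "u \<cdot> q = g" using is_cokernel_desc[OF q m(2) q'(1) g'] .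
  have "\<exists>!v. v \<in> Hom C X A \<and> m \<cdot> v = h" if X: "X \<in> ob C" and h: "h \<in> Hom C X B"
    and z: "q \<cdot> h = zer C X ?Q" for X h
  proof -
    have "g \<cdot> h = zer C X ?Y"
      using cmp_assoc[OF h q'(1) u(1)] z u cmp_zer_right[OF u(1) X] by simp
    then obtain v where v: "v \<in> Hom C X A" "m \<cdot> v = h" using is_kernel_lift[OF g g'(1) m(2) h] by blast
    then show ?thesis using is_monoD[OF m] by blast
  qed
  then show ?thesis unfolding is_kernel_def using m' q'' q'(2) by simp
qed

text \<open>Dual: \<open>f\<close> is a cokernel of some \<open>g\<close>, which factors through
  \<open>k\<close>, so a map killing \<open>k\<close> kills \<open>g\<close>.\<close>

lemma cokernel_of_kernel:
  assumes f: "is_epi C f" "f \<in> Hom C A B" and k: "is_kernel C f k"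
  shows "is_cokernel C k f"
proof -
  let ?K = "src C k"
  note k' = is_kernelD[OF k f(2)]
  note f' = HomD[OF f(2)] and k'' = HomD[OF k'(1)]
  obtain g where g: "is_cokernel C g f" using epi_normal[OF f(1)] by blast
  let ?Y = "src C g"
  have g': "g \<in> Hom C ?Y A" "f \<cdot> g = zer C ?Y B"
    using g f' unfolding is_cokernel_def Hom_def by auto
  obtain u where u: "u \<in> Hom C ?Y ?K" "k \<cdot> u = g" using is_kernel_lift[OF k f(2) k'(1) g'] .
  have "\<exists>!v. v \<in> Hom C B X \<and> v \<cdot> f = h" if X: "X \<in> ob C" and h: "h \<in> Hom C A X"
    and z: "h \<cdot> k = zer C ?K X" for X h
  proof -
    have "h \<cdot> g = zer C ?Y X"
      using cmp_assoc[OF u(1) k'(1) h] z u cmp_zer_left[OF u(1) X] by simp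
    then obtain v where v: "v \<in> Hom C B X" "v \<cdot> f = h"
      using is_cokernel_desc[OF g g'(1) f(2) h] by blast
    then show ?thesis using is_epiD[OF f] by blast
  qed
  then show ?thesis unfolding is_cokernel_def using f' k'' k'(2) by simp
qed

lemma epi_short_exact:
  assumes f: "is_epi C f" "f \<in> Hom C A B"
  obtains K k where "k \<in> Hom C K A" "short_exact C k f"
  using ex_kernel HomD(1)[OF f(2)] is_kernelD[OF _ f(2)] cokernel_of_kernel[OF f]
  unfolding short_exact_def by blast

text \<open>The pullback is the kernel \<open>k\<close> of f - g on the biproduct of H and Y. That
  difference is epi because it restricts to \<open>f\<close> on H. If \<open>a\<close> kills the
  projection to Y, then a p2 = b s for some b; restricting to H gives b f = 0, so b = 0 and a =
  0.\<close>

lemma pullback_epi: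
  assumes f: "is_epi C f" "f \<in> Hom C H X" and g: "g \<in> Hom C Y X"
  obtains E e p where "e \<in> Hom C E Y" "is_epi C e" "p \<in> Hom C E H" "f \<cdot> p = g \<cdot> e"
proof -
  note ob = HomD(4)[OF f(2)] HomD(4)[OF g] HomD(5)[OF g]
  obtain P i\<^sub>1 i\<^sub>2 p\<^sub>1 p\<^sub>2 where "is_biproduct C H Y P i\<^sub>1 i\<^sub>2 p\<^sub>1 p\<^sub>2" using ex_biproduct ob by blast
  then have P: "P \<in> ob C" and i1: "i\<^sub>1 \<in> Hom C H P" and i2: "i\<^sub>2 \<in> Hom C Y P"
    and p1: "p\<^sub>1 \<in> Hom C P H" and p2: "p\<^sub>2 \<in> Hom C P Y"
    and eq: "p\<^sub>1 \<cdot> i\<^sub>1 = idn C H" "p\<^sub>2 \<cdot> i\<^sub>2 = idn C Y" "add C (i\<^sub>1 \<cdot> p\<^sub>1) (i\<^sub>2 \<cdot> p\<^sub>2) = idn C P"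
    unfolding is_biproduct_def by blast+
  \<comment> \<open>This off-diagonal relation follows from the decomposition of the identity:
    composing with p2 gives p2 = p2 i1 p1 + p2.\<close>
  have p21: "p\<^sub>2 \<cdot> i\<^sub>1 = zer C H Y"
  proof -
    have "p\<^sub>2 = add C (p\<^sub>2 \<cdot> (i\<^sub>1 \<cdot> p\<^sub>1)) (p\<^sub>2 \<cdot> (i\<^sub>2 \<cdot> p\<^sub>2))"
      using cmp_add_right[OF cmp_Hom[OF p1 i1] cmp_Hom[OF p2 i2] p2] eq(3) idn_right[OF p2] by simp
    also have "p\<^sub>2 \<cdot> (i\<^sub>2 \<cdot> p\<^sub>2) = p\<^sub>2" using cmp_assoc[OF p2 i2 p2] eq(2) idn_left[OF p2] by simp
    finally have "p\<^sub>2 \<cdot> (i\<^sub>1 \<cdot> p\<^sub>1) = zer C P Y"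
      using add_eq_self_iff[OF p2 cmp_Hom[OF cmp_Hom[OF p1 i1] p2]] by simp
    then have "(p\<^sub>2 \<cdot> i\<^sub>1 \<cdot> p\<^sub>1) \<cdot> i\<^sub>1 = zer C H Y"
      using cmp_assoc[OF p1 i1 p2] cmp_zer_left[OF i1 ob(2)] by simp
    then show ?thesis
      using cmp_assoc[OF i1 p1 cmp_Hom[OF i1 p2]] eq(1) idn_right[OF cmp_Hom[OF i1 p2]] by simp
  qed
  \<comment> \<open>The kernel of this difference consists of the pairs on which \<open>f\<close>
    and \<open>g\<close> agree.\<close>
  define s where "s = sub C (f \<cdot> p\<^sub>1) (g \<cdot> p\<^sub>2)"
  note fp = cmp_Hom[OF p1 f(2)] and gp = cmp_Hom[OF p2 g]
  have s: "s \<in> Hom C P X" unfolding s_def using sub_Hom fp gp by blast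
  have si: "s \<cdot> i\<^sub>1 = f"
  proof -
    have "(f \<cdot> p\<^sub>1) \<cdot> i\<^sub>1 = f" using cmp_assoc[OF i1 p1 f(2)] eq(1) idn_right[OF f(2)] by simp
    moreover have "(g \<cdot> p\<^sub>2) \<cdot> i\<^sub>1 = zer C H X"
      using cmp_assoc[OF i1 p2 g] p21 cmp_zer_right[OF g ob(1)] by simp
    moreover have "sub C f (zer C H X) = f"
      using add_sub_cancel[OF f(2) zer_Hom[OF ob(1,3)]]
        add_commute[OF sub_Hom[OF f(2) zer_Hom[OF ob(1,3)]] zer_Hom[OF ob(1,3)]]
        add_zer[OF sub_Hom[OF f(2) zer_Hom[OF ob(1,3)]]] by simp
    ultimately show ?thesis unfolding s_def using cmp_sub_left[OF i1 fp gp] by simp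
  qed
  have s_epi: "is_epi C s" unfolding is_epi_iff[OF s]
  proof (intro ballI impI)
    fix Z c assume Z: "Z \<in> ob C" and c: "c \<in> Hom C X Z" and z: "c \<cdot> s = zer C P Z"
    have "c \<cdot> f = zer C H Z" using cmp_assoc[OF i1 s c] si z cmp_zer_left[OF i1 Z] by simp
    then show "c = zer C X Z" using f(1) Z c unfolding is_epi_iff[OF f(2)] by blast
  qed
  obtain E k where k: "k \<in> Hom C E P" and se: "short_exact C k s"
    using epi_short_exact[OF s_epi s] .
  then have ks: "is_cokernel C k s" "is_kernel C s k" by (auto simp: short_exact_def)
  have fg: "f \<cdot> (p\<^sub>1 \<cdot> k) = g \<cdot> (p\<^sub>2 \<cdot> k)"
  proof -
    have "sub C ((f \<cdot> p\<^sub>1) \<cdot> k) ((g \<cdot> p\<^sub>2) \<cdot> k) = zer C E X"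
      using cmp_sub_left[OF k fp gp] is_kernelD(2)[OF ks(2) s] HomD[OF k] unfolding s_def by simp
    then show ?thesis
      using sub_eq_zer_iff[OF cmp_Hom[OF k fp] cmp_Hom[OF k gp]]
        cmp_assoc[OF k p1 f(2)] cmp_assoc[OF k p2 g] by simp
  qed
  have "is_epi C (p\<^sub>2 \<cdot> k)" unfolding is_epi_iff[OF cmp_Hom[OF k p2]]
  proof (intro ballI impI)
    fix Z a assume Z: "Z \<in> ob C" and a: "a \<in> Hom C Y Z" and z: "a \<cdot> (p\<^sub>2 \<cdot> k) = zer C E Z"
    note ap = cmp_Hom[OF p2 a]
    have "(a \<cdot> p\<^sub>2) \<cdot> k = zer C E Z" using z cmp_assoc[OF k p2 a] by simp
    then obtain b where b: "b \<in> Hom C X Z" "b \<cdot> s = a \<cdot> p\<^sub>2"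
      using is_cokernel_desc[OF ks(1) k s ap] by blast
    have "b \<cdot> f = (a \<cdot> p\<^sub>2) \<cdot> i\<^sub>1" using cmp_assoc[OF i1 s b(1)] b(2) si by simp
    also have "\<dots> = zer C H Z" using cmp_assoc[OF i1 p2 a] p21 cmp_zer_right[OF a ob(1)] by simp
    finally have "b = zer C X Z" using f(1) Z b(1) unfolding is_epi_iff[OF f(2)] by blast
    then have "a \<cdot> p\<^sub>2 = zer C P Z" using b(2) cmp_zer_left[OF s Z] by simp
    then have "(a \<cdot> p\<^sub>2) \<cdot> i\<^sub>2 = zer C Y Z" using cmp_zer_left[OF i2 Z] by simp
    then show "a = zer C Y Z" using cmp_assoc[OF i2 p2 a] eq(2) idn_right[OF a] by simp
  qed
  then show ?thesis using that cmp_Hom[OF k p2] cmp_Hom[OF k p1] fg by blast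
qed

text \<open>To lift along an epi onto Y, pull it back along \<open>a\<close> to an epi onto X and
  lift \<open>d\<close> along that.\<close>

lemma liftable_cmp:
  assumes d: "d \<in> liftable G X" and a: "a \<in> Hom C X Y"
  shows "a \<cdot> d \<in> liftable G Y"
proof -
  note d' = liftable_Hom[OF d]
  have "\<exists>k\<in>Hom C G H. p \<cdot> k = a \<cdot> d" if p: "p \<in> Hom C H Y" "is_epi C p" for H p
  proof -
    obtain E e r where e: "e \<in> Hom C E X" "is_epi C e" and r: "r \<in> Hom C E H" "p \<cdot> r = a \<cdot> e"
      using pullback_epi[OF p(2,1) a] .
    obtain k where k: "k \<in> Hom C G E" "e \<cdot> k = d" using liftable_lift[OF d e] .
    have "p \<cdot> (r \<cdot> k) = a \<cdot> d"
      using cmp_assoc[OF k(1) r(1) p(1)] cmp_assoc[OF k(1) e(1) a] r(2) k(2) by simp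
    then show ?thesis using cmp_Hom[OF k(1) r(1)] by blast
  qed
  then show ?thesis unfolding liftable_def using cmp_Hom[OF d' a] by blast
qed

text \<open>Exactness is given for short exact sequences, so each epi is completed by its kernel and
  the kernels are multiplied as well.\<close>

lemma product_of_epis:
  assumes prod: "has_small_products (U :: 'u itself) C" and ex: "small_products_exact U C"
    and I: "small U I" and p: "\<And>i. i \<in> I \<Longrightarrow> p i \<in> Hom C (X i) (Y i)" "\<And>i. i \<in> I \<Longrightarrow> is_epi C (p i)"
    and P: "is_product C I X P \<pi>" and Q: "is_product C I Y Q \<rho>"
    and f: "f \<in> Hom C P Q" "\<And>i. i \<in> I \<Longrightarrow> \<rho> i \<cdot> f = p i \<cdot> \<pi> i"
  shows "is_epi C f"
proof -
  have "\<exists>K k. k \<in> Hom C K (X i) \<and> short_exact C k (p i)" if "i \<in> I" for i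
    using epi_short_exact[OF p(2,1)[OF that]] by blast
  then obtain K k where k: "\<And>i. i \<in> I \<Longrightarrow> k i \<in> Hom C (K i) (X i)"
    "\<And>i. i \<in> I \<Longrightarrow> short_exact C (k i) (p i)" by metis
  obtain R \<sigma> where R: "is_product C I K R \<sigma>"
    using small_product_exists[OF prod I] HomD(4)[OF k(1)] by blast
  have "R \<in> ob C" using R by (simp add: is_product_def)
  then obtain j where j: "j \<in> Hom C R P" "\<And>i. i \<in> I \<Longrightarrow> \<pi> i \<cdot> j = k i \<cdot> \<sigma> i"
    using is_product_lift[OF P, of R "\<lambda>i. k i \<cdot> \<sigma> i"] k(1) is_product_Hom[OF R] cmp_Hom by metis
  have "short_exact C j f"
    by (rule product_short_exact[OF ex I k(1) p(1) k(2) R P Q j f])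
  then show ?thesis unfolding short_exact_def using is_cokernel_epi by blast
qed

end

section \<open>Sequences with epimorphic bonds\<close>

locale exact_products_category = abelian_category C for C :: "('o, 'm) cat" (structure) +
  fixes U :: "'u::wellorder itself" and G :: 'o
  assumes universe: "universe_type U"
    and loc_small: "locally_small U C"
    and gen: "is_generator C G"
    and coproducts: "has_small_coproducts U C"
    and products: "has_small_products U C"
    and products_exact: "small_products_exact U C"
begin

lemma G_ob: "G \<in> ob C"
  using gen by (simp add: is_generator_def)

lemma small_Hom: "A \<in> ob C \<Longrightarrow> B \<in> ob C \<Longrightarrow> small U (Hom C A B)"
  using loc_small by (simp add: locally_small_def)

lemma small_nat: "small U (I :: nat set)"
  using universe small_subset[OF _ subset_UNIV] by (auto simp: universe_type_def)

(* The product over the possible sets {p k | k : G -> H} \<subseteq> End(G), for p : H -> G epi, of one epi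
   each is an epi; pulled back along the diagonal of G it dominates every epi onto G. *)
lemma liftable_generator:
  assumes a: "a \<in> Hom C G Y" and z: "\<And>d. d \<in> liftable G G \<Longrightarrow> a \<cdot> d = zer C G Y"
  shows "a = zer C G Y"
proof -
  define \<A> where "\<A> = {(\<lambda>k. p \<cdot> k) ` Hom C G H | H p. p \<in> Hom C H G \<and> is_epi C p}"
  have "\<A> \<subseteq> Pow (Hom C G G)" unfolding \<A>_def using cmp_Hom by blast
  then have small: "small U \<A>"
    using small_subset[OF small_Pow[OF universe small_Hom[OF G_ob G_ob]]] by blast
  have "\<exists>H p. p \<in> Hom C H G \<and> is_epi C p \<and> A = (\<lambda>k. p \<cdot> k) ` Hom C G H" if "A \<in> \<A>" for A
    using that unfolding \<A>_def by blast
  then obtain H p where p: "\<And>A. A \<in> \<A> \<Longrightarrow> p A \<in> Hom C (H A) G"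
    "\<And>A. A \<in> \<A> \<Longrightarrow> is_epi C (p A)" "\<And>A. A \<in> \<A> \<Longrightarrow> A = (\<lambda>k. p A \<cdot> k) ` Hom C G (H A)"
    by metis
  obtain P \<pi> where P: "is_product C \<A> H P \<pi>"
    using small_product_exists[OF products small] HomD(4)[OF p(1)] by blast
  obtain Q \<rho> where Q: "is_product C \<A> (\<lambda>_. G) Q \<rho>"
    using small_product_exists[OF products small, of "\<lambda>_. G"] G_ob by blast
  have Pob: "P \<in> ob C" using P by (simp add: is_product_def)
  have "p A \<cdot> \<pi> A \<in> Hom C P G" if "A \<in> \<A>" for A
    using p(1) is_product_Hom[OF P] cmp_Hom that by blast
  then obtain f where f: "f \<in> Hom C P Q" "\<And>A. A \<in> \<A> \<Longrightarrow> \<rho> A \<cdot> f = p A \<cdot> \<pi> A"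
    using is_product_lift[OF Q Pob, of "\<lambda>A. p A \<cdot> \<pi> A"] by blast
  have f_epi: "is_epi C f" by (rule product_of_epis[OF products products_exact small p(1,2) P Q f])
  obtain \<delta> where \<delta>: "\<delta> \<in> Hom C G Q" "\<And>A. A \<in> \<A> \<Longrightarrow> \<rho> A \<cdot> \<delta> = idn C G"
    using is_product_lift[OF Q G_ob, of "\<lambda>_. idn C G"] idn_Hom[OF G_ob] by blast
  obtain E e r where e: "e \<in> Hom C E G" "is_epi C e" and r: "r \<in> Hom C E P" "f \<cdot> r = \<delta> \<cdot> e"
    using pullback_epi[OF f_epi f(1) \<delta>(1)] .
  have lift: "e \<cdot> g \<in> liftable G G" if g: "g \<in> Hom C G E" for g
  proof -
    have "\<exists>k\<in>Hom C G H'. q \<cdot> k = e \<cdot> g" if q: "q \<in> Hom C H' G" "is_epi C q" for H' q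
    proof -
      \<comment> \<open>\<open>q\<close> need not be the representative \<open>p A\<close>, but both
        produce the same set \<open>A\<close> of composites with maps out of \<open>G\<close>. Hence
        a factorization of e g through \<open>p A\<close> puts e g into \<open>A\<close> and so
        yields one through \<open>q\<close>.\<close>
      define A where "A = (\<lambda>k. q \<cdot> k) ` Hom C G H'"
      have A: "A \<in> \<A>" unfolding A_def \<A>_def using q by blast
      note \<rho> = is_product_Hom[OF Q A] and \<pi> = is_product_Hom[OF P A]
      have "e = \<rho> A \<cdot> \<delta> \<cdot> e" using \<delta>(2)[OF A] idn_left[OF e(1)] by simp
      also have "\<dots> = \<rho> A \<cdot> f \<cdot> r"
        using r(2) cmp_assoc[OF e(1) \<delta>(1) \<rho>] cmp_assoc[OF r(1) f(1) \<rho>] by simp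
      also have "\<dots> = p A \<cdot> (\<pi> A \<cdot> r)" using f(2)[OF A] cmp_assoc[OF r(1) \<pi> p(1)[OF A]] by simp
      finally have "e \<cdot> g = p A \<cdot> (\<pi> A \<cdot> r \<cdot> g)"
        using cmp_assoc[OF g cmp_Hom[OF r(1) \<pi>] p(1)[OF A]] by simp
      then have "e \<cdot> g \<in> A" using p(3)[OF A] cmp_Hom[OF g cmp_Hom[OF r(1) \<pi>]] by blast
      then show ?thesis unfolding A_def by force
    qed
    then show ?thesis unfolding liftable_def using cmp_Hom[OF g e(1)] by blast
  qed
  note Y = HomD(5)[OF a]
  note E = HomD(4)[OF e(1)]
  \<comment> \<open>All composites e g are liftable, and the maps g out of the generator are jointly
    epi.\<close>
  have "a \<cdot> e = zer C E Y"
  proof (rule is_generator_eqI[OF gen cmp_Hom[OF e(1) a] zer_Hom[OF E Y]])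
    fix g assume g: "g \<in> Hom C G E"
    show "a \<cdot> e \<cdot> g = zer C E Y \<cdot> g"
      using cmp_assoc[OF g e(1) a] z[OF lift[OF g]] cmp_zer_left[OF g Y] by simp
  qed
  then show ?thesis using e(2) Y a unfolding is_epi_iff[OF e(1)] by blast
qed

text \<open>The case X = \<open>G\<close> suffices: test \<open>a\<close> on maps x out of the
  generator, then test a x on liftable endomorphisms d of \<open>G\<close>; the composites x d are
  again liftable.\<close>

lemma liftable_jointly_epi:
  assumes a: "a \<in> Hom C X Y" and z: "\<And>d. d \<in> liftable G X \<Longrightarrow> a \<cdot> d = zer C G Y"
  shows "a = zer C X Y"
proof (rule is_generator_eqI[OF gen a zer_Hom[OF HomD(4,5)[OF a]]])
  fix x assume x: "x \<in> Hom C G X"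
  have "a \<cdot> x = zer C G Y"
  proof (rule liftable_generator[OF cmp_Hom[OF x a]])
    fix d assume d: "d \<in> liftable G G"
    show "a \<cdot> x \<cdot> d = zer C G Y"
      using cmp_assoc[OF liftable_Hom[OF d] x a] z[OF liftable_cmp[OF d x]] by simp
  qed
  then show "a \<cdot> x = zer C X Y \<cdot> x" using cmp_zer_left[OF x HomD(5)[OF a]] by simp
qed

(* The maps in liftable G H assemble to an epi e from a copower of G onto H, and an element of
   liftable G X lifts along the epi f e. *)
lemma liftable_surj:
  assumes f: "is_epi C f" "f \<in> Hom C H X" and d: "d \<in> liftable G X"
  obtains d' where "d' \<in> liftable G H" "f \<cdot> d' = d"
proof -
  note H = HomD(4)[OF f(2)]
  have "small U (liftable G H)"
    by (rule small_subset[OF small_Hom[OF G_ob H]]) (use liftable_Hom in blast)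
  then obtain W \<iota> where W: "is_coproduct C (liftable G H) (\<lambda>_. G) W \<iota>"
    using small_copower_exists[OF coproducts _ G_ob] by blast
  obtain e where e: "e \<in> Hom C W H" "\<And>n. n \<in> liftable G H \<Longrightarrow> e \<cdot> \<iota> n = n"
    using is_coproduct_desc[OF W H, of "\<lambda>n. n"] liftable_Hom by blast
  have e_epi: "is_epi C e" unfolding is_epi_iff[OF e(1)]
  proof (intro ballI impI)
    fix Z a assume Z: "Z \<in> ob C" and a: "a \<in> Hom C H Z" and z: "a \<cdot> e = zer C W Z"
    show "a = zer C H Z"
    proof (rule liftable_jointly_epi[OF a])
      fix n assume n: "n \<in> liftable G H"
      note \<iota> = is_coproduct_Hom[OF W n]
      show "a \<cdot> n = zer C G Z"
        using cmp_assoc[OF \<iota> e(1) a] e(2)[OF n] z cmp_zer_left[OF \<iota> Z] by simp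
    qed
  qed
  obtain t where t: "t \<in> Hom C G W" "f \<cdot> e \<cdot> t = d"
    using liftable_lift[OF d cmp_Hom[OF e(1) f(2)] is_epi_cmp[OF e_epi e(1) f]] .
  \<comment> \<open>The map \<open>t\<close> is an arbitrary lift; liftability of e t comes from
    \<open>e\<close>. Each summand n of \<open>e\<close> lifts along \<open>p\<close>, and on the
    copower these lifts glue to a factorization of \<open>e\<close> through
    \<open>p\<close>.\<close>
  have "\<exists>k\<in>Hom C G K. p \<cdot> k = e \<cdot> t" if p: "p \<in> Hom C K H" "is_epi C p" for K p
  proof -
    have "\<exists>k. k \<in> Hom C G K \<and> p \<cdot> k = n" if "n \<in> liftable G H" for n
      using liftable_lift[OF that p] by blast
    then obtain k where k: "\<And>n. n \<in> liftable G H \<Longrightarrow> k n \<in> Hom C G K"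
      "\<And>n. n \<in> liftable G H \<Longrightarrow> p \<cdot> k n = n" by metis
    obtain e' where e': "e' \<in> Hom C W K" "\<And>n. n \<in> liftable G H \<Longrightarrow> e' \<cdot> \<iota> n = k n"
      using is_coproduct_desc[OF W HomD(4)[OF p(1)], of k] k(1) by blast
    have "p \<cdot> e' = e"
    proof (rule is_coproduct_eqI[OF W cmp_Hom[OF e'(1) p(1)] e(1)])
      fix n assume n: "n \<in> liftable G H"
      show "p \<cdot> e' \<cdot> \<iota> n = e \<cdot> \<iota> n"
        using cmp_assoc[OF is_coproduct_Hom[OF W n] e'(1) p(1)] e'(2)[OF n] k(2)[OF n] e(2)[OF n]
        by simp
    qed
    then have "p \<cdot> (e' \<cdot> t) = e \<cdot> t" using cmp_assoc[OF t(1) e'(1) p(1)] by simp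
    then show ?thesis using cmp_Hom[OF t(1) e'(1)] by blast
  qed
  then have "e \<cdot> t \<in> liftable G H" unfolding liftable_def using cmp_Hom[OF t(1) e(1)] by blast
  moreover have "f \<cdot> (e \<cdot> t) = d" using cmp_assoc[OF t(1) e(1) f(2)] t(2) by simp
  ultimately show ?thesis using that by blast
qed

text \<open>For liftable x, a solution of the system assembles to h with h = x + F h. Applying the
  invariant map gives a h = a x + a h, so \<open>a\<close> kills every liftable map.\<close>

lemma epi_bonds_invariant_zero:
  assumes b: "\<And>i. b i \<in> Hom C (S (Suc i)) (S i)" "\<And>i. is_epi C (b i)"
    and P: "is_product C UNIV S P \<pi>"
    and F: "F \<in> Hom C P P" "\<And>i. \<pi> i \<cdot> F = b i \<cdot> \<pi> (Suc i)"
    and a: "a \<in> Hom C P Y" "a = a \<cdot> F"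
  shows "a = zer C P Y"
proof (rule liftable_jointly_epi[OF a(1)])
  fix x assume x: "x \<in> liftable G P"
  note x' = liftable_Hom[OF x] and \<pi> = is_product_Hom[OF P UNIV_I]
  \<comment> \<open>The next entry is a liftable preimage under \<open>b i\<close> of the difference
    of y and the i-th component of x.\<close>
  have step: "\<exists>y'. y' \<in> liftable G (S (Suc i)) \<and> y = add C (\<pi> i \<cdot> x) (b i \<cdot> y')"
    if y: "y \<in> liftable G (S i)" for i y
  proof -
    note \<pi>x = liftable_cmp[OF x \<pi>[of i]]
    obtain y' where "y' \<in> liftable G (S (Suc i))" "b i \<cdot> y' = sub C y (\<pi> i \<cdot> x)"
      using liftable_surj[OF b(2,1) liftable_sub[OF y \<pi>x]] .
    then show ?thesis using add_sub_cancel[OF liftable_Hom[OF y] liftable_Hom[OF \<pi>x]] by auto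
  qed
  have "\<exists>y. \<forall>i. y i \<in> liftable G (S i) \<and> y i = add C (\<pi> i \<cdot> x) (b i \<cdot> y (Suc i))"
  proof (rule dependent_nat_choice)
    \<comment> \<open>The recursion runs upwards from place 0, where the value is free; zero is
      available.\<close>
    show "\<exists>y. y \<in> liftable G (S 0)" using liftable_zer[OF G_ob HomD(5)[OF \<pi>]] by blast
  qed (rule step)
  then obtain y where
    y': "\<forall>i. y i \<in> liftable G (S i) \<and> y i = add C (\<pi> i \<cdot> x) (b i \<cdot> y (Suc i))" ..
  have y: "y i \<in> liftable G (S i)" "y i = add C (\<pi> i \<cdot> x) (b i \<cdot> y (Suc i))" for i
    using y'[THEN spec, of i] by (rule conjunct1, rule conjunct2)
  obtain h where h': "h \<in> Hom C G P \<and> (\<forall>i\<in>UNIV. \<pi> i \<cdot> h = y i)"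
    using ex1_implies_ex[OF is_product_ex1[OF P G_ob liftable_Hom[OF y(1)]]] ..
  then have h: "h \<in> Hom C G P" "\<pi> i \<cdot> h = y i" for i by simp_all
  have "h = add C x (F \<cdot> h)"
  proof (rule is_product_eqI[OF P h(1) add_Hom[OF x' cmp_Hom[OF h(1) F(1)]]])
    fix i
    have "\<pi> i \<cdot> (F \<cdot> h) = b i \<cdot> y (Suc i)"
      using cmp_assoc[OF h(1) F(1) \<pi>[of i]] F(2)[of i] cmp_assoc[OF h(1) \<pi>[of "Suc i"] b(1)[of i]]
        h(2)[of "Suc i"] by simp
    then show "\<pi> i \<cdot> h = \<pi> i \<cdot> add C x (F \<cdot> h)"
      using cmp_add_right[OF x' cmp_Hom[OF h(1) F(1)] \<pi>[of i]] h(2)[of i] y(2)[of i] by simp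
  qed
  then have "a \<cdot> h = add C (a \<cdot> x) (a \<cdot> h)"
    using cmp_add_right[OF x' cmp_Hom[OF h(1) F(1)] a(1)] cmp_assoc[OF h(1) F(1) a(1)] a(2) by simp
  then show "a \<cdot> x = zer C G Y"
    using add_eq_self_iff[OF cmp_Hom[OF h(1) a(1)] cmp_Hom[OF x' a(1)]] by simp
qed

end

section \<open>Limits and cokernels of inverse sequences are levelwise\<close>

lemma seq_cat_simps [simp]:
  "src (seq_cat C) = msrc" "tgt (seq_cat C) = mtgt"
  "level (idn (seq_cat C) S) i = idn C (obj S i)"
  "level (\<psi> \<cdot>\<^bsub>seq_cat C\<^esub> \<phi>) i = level \<psi> i \<cdot>\<^bsub>C\<^esub> level \<phi> i"
  "level (zer (seq_cat C) S T) i = zer C (obj S i) (obj T i)"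
  by (simp_all add: seq_cat_def Let_def)

lemma seq_ob_iff:
  "S \<in> ob (seq_cat C) \<longleftrightarrow> (\<forall>i. obj S i \<in> ob C \<and> bond S i \<in> Hom C (obj S (Suc i)) (obj S i))"
  by (simp add: seq_cat_def Let_def)

lemma seq_Hom_iff:
  "\<phi> \<in> Hom (seq_cat C) S T \<longleftrightarrow> S \<in> ob (seq_cat C) \<and> T \<in> ob (seq_cat C) \<and> msrc \<phi> = S \<and> mtgt \<phi> = T \<and>
     (\<forall>i. level \<phi> i \<in> Hom C (obj S i) (obj T i) \<and>
          level \<phi> i \<cdot>\<^bsub>C\<^esub> bond S i = bond T i \<cdot>\<^bsub>C\<^esub> level \<phi> (Suc i))"
  by (auto simp: seq_cat_def Let_def Hom_def)

lemma seq_HomD: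
  assumes "\<phi> \<in> Hom (seq_cat C) S T"
  shows "S \<in> ob (seq_cat C)" "T \<in> ob (seq_cat C)" "\<And>i. level \<phi> i \<in> Hom C (obj S i) (obj T i)"
    "\<And>i. level \<phi> i \<cdot>\<^bsub>C\<^esub> bond S i = bond T i \<cdot>\<^bsub>C\<^esub> level \<phi> (Suc i)"
  using assms unfolding seq_Hom_iff by blast+

lemma seq_map_eqI:
  assumes "\<phi> \<in> Hom (seq_cat C) S T" "\<psi> \<in> Hom (seq_cat C) S T" "\<And>i. level \<phi> i = level \<psi> i"
  shows "\<phi> = \<psi>"
  using assms by (intro invseq_map.equality) (auto simp: seq_Hom_iff)

context category
begin

text \<open>Makes the facts of the locale \<open>category\<close> about epis and inverse limits
  available for \<open>seq_cat C\<close>.\<close>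

lemma seq_category: "category (seq_cat C)"
proof
  fix A B D E f g h
  note H = seq_HomD
  show "f \<in> arr (seq_cat C) \<Longrightarrow> src (seq_cat C) f \<in> ob (seq_cat C)"
    "f \<in> arr (seq_cat C) \<Longrightarrow> tgt (seq_cat C) f \<in> ob (seq_cat C)"
    by (auto simp: seq_cat_def Let_def)
  show id: "A \<in> ob (seq_cat C) \<Longrightarrow> idn (seq_cat C) A \<in> Hom (seq_cat C) A A" for A
  proof -
    assume A: "A \<in> ob (seq_cat C)"
    have o: "obj A i \<in> ob C" and b: "bond A i \<in> Hom C (obj A (Suc i)) (obj A i)" for i
      using A by (simp_all add: seq_ob_iff)
    have "msrc (idn (seq_cat C) A) = A" "mtgt (idn (seq_cat C) A) = A"
      by (simp_all add: seq_cat_def Let_def)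
    then show ?thesis unfolding seq_Hom_iff using A
      by (simp add: idn_Hom[OF o] idn_left[OF b] idn_right[OF b])
  qed
  show cmp: "f \<in> Hom (seq_cat C) A B \<Longrightarrow> g \<in> Hom (seq_cat C) B D \<Longrightarrow>
    g \<cdot>\<^bsub>seq_cat C\<^esub> f \<in> Hom (seq_cat C) A D" for f g A B D
  proof -
    assume f: "f \<in> Hom (seq_cat C) A B" and g: "g \<in> Hom (seq_cat C) B D"
    have bA: "bond A i \<in> Hom C (obj A (Suc i)) (obj A i)"
      and bB: "bond B i \<in> Hom C (obj B (Suc i)) (obj B i)"
      and bD: "bond D i \<in> Hom C (obj D (Suc i)) (obj D i)" for i
      using H(1)[OF f] H(2)[OF f] H(2)[OF g] by (simp_all add: seq_ob_iff)
    have "(level g i \<cdot> level f i) \<cdot> bond A i = bond D i \<cdot> (level g (Suc i) \<cdot> level f (Suc i))" for i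
      using cmp_assoc[OF bA H(3)[OF f] H(3)[OF g], of i] H(4)[OF f, of i] H(4)[OF g, of i]
        cmp_assoc[OF H(3)[OF f] bB H(3)[OF g], of i] cmp_assoc[OF H(3)[OF f] H(3)[OF g] bD, of i]
      by simp
    moreover have "level g i \<cdot> level f i \<in> Hom C (obj A i) (obj D i)" for i
      using cmp_Hom H(3) f g by blast
    moreover have "msrc (g \<cdot>\<^bsub>seq_cat C\<^esub> f) = A" "mtgt (g \<cdot>\<^bsub>seq_cat C\<^esub> f) = D"
      using f g by (simp_all add: seq_Hom_iff) (simp_all add: seq_cat_def Let_def)
    ultimately show ?thesis using H(1)[OF f] H(2)[OF g] unfolding seq_Hom_iff by simp
  qed
  show "idn (seq_cat C) B \<cdot>\<^bsub>seq_cat C\<^esub> f = f" if f: "f \<in> Hom (seq_cat C) A B"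
    by (rule seq_map_eqI[OF cmp[OF f id[OF H(2)[OF f]]] f]) (simp add: idn_left[OF H(3)[OF f]])
  show "f \<cdot>\<^bsub>seq_cat C\<^esub> idn (seq_cat C) A = f" if f: "f \<in> Hom (seq_cat C) A B"
    by (rule seq_map_eqI[OF cmp[OF id[OF H(1)[OF f]] f] f]) (simp add: idn_right[OF H(3)[OF f]])
  show "h \<cdot>\<^bsub>seq_cat C\<^esub> g \<cdot>\<^bsub>seq_cat C\<^esub> f = h \<cdot>\<^bsub>seq_cat C\<^esub> (g \<cdot>\<^bsub>seq_cat C\<^esub> f)"
    if f: "f \<in> Hom (seq_cat C) A B" and g: "g \<in> Hom (seq_cat C) B D" and h: "h \<in> Hom (seq_cat C) D E"
    by (rule seq_map_eqI[OF cmp[OF f cmp[OF g h]] cmp[OF cmp[OF f g] h]])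
      (simp add: cmp_assoc[OF H(3)[OF f] H(3)[OF g] H(3)[OF h]])
qed

lemmas seq_cmp_Hom = category.cmp_Hom[OF seq_category]

text \<open>Taking the component at \<open>i\<close> is a bijection from the maps S -> R onto the
  maps from the i-th object of S to \<open>X\<close>. Such an \<open>R\<close> turns a test map at
  one place into a test map of inverse sequences, as needed for epis and cokernels.\<close>

definition is_coinduced :: "nat \<Rightarrow> 'o \<Rightarrow> ('o, 'm) invseq \<Rightarrow> bool" where
  "is_coinduced i X R \<longleftrightarrow> R \<in> ob (seq_cat C) \<and> obj R i = X \<and>
    (\<forall>S g. S \<in> ob (seq_cat C) \<longrightarrow> g \<in> Hom C (obj S i) X \<longrightarrow>
       (\<exists>\<phi>. \<phi> \<in> Hom (seq_cat C) S R \<and> level \<phi> i = g)) \<and>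
    (\<forall>S \<phi> \<psi>. \<phi> \<in> Hom (seq_cat C) S R \<longrightarrow> \<psi> \<in> Hom (seq_cat C) S R \<longrightarrow>
       level \<phi> i = level \<psi> i \<longrightarrow> \<phi> = \<psi>)"

text \<open>The dual property, for maps out of \<open>R\<close>; it serves to test limits.\<close>

definition is_induced :: "nat \<Rightarrow> 'o \<Rightarrow> ('o, 'm) invseq \<Rightarrow> bool" where
  "is_induced i X R \<longleftrightarrow> R \<in> ob (seq_cat C) \<and> obj R i = X \<and>
    (\<forall>S g. S \<in> ob (seq_cat C) \<longrightarrow> g \<in> Hom C X (obj S i) \<longrightarrow>
       (\<exists>\<phi>. \<phi> \<in> Hom (seq_cat C) R S \<and> level \<phi> i = g)) \<and>
    (\<forall>S \<phi> \<psi>. \<phi> \<in> Hom (seq_cat C) R S \<longrightarrow> \<psi> \<in> Hom (seq_cat C) R S \<longrightarrow>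
       level \<phi> i = level \<psi> i \<longrightarrow> \<phi> = \<psi>)"

lemma is_coinducedD:
  assumes "is_coinduced i X R"
  shows "R \<in> ob (seq_cat C)" "obj R i = X"
    "S \<in> ob (seq_cat C) \<Longrightarrow> g \<in> Hom C (obj S i) X \<Longrightarrow>
       \<exists>\<phi>. \<phi> \<in> Hom (seq_cat C) S R \<and> level \<phi> i = g"
    "\<phi> \<in> Hom (seq_cat C) S R \<Longrightarrow> \<psi> \<in> Hom (seq_cat C) S R \<Longrightarrow>
       level \<phi> i = level \<psi> i \<Longrightarrow> \<phi> = \<psi>"
  using assms unfolding is_coinduced_def by simp_all

lemma is_inducedD:
  assumes "is_induced i X R"
  shows "R \<in> ob (seq_cat C)" "obj R i = X"
    "S \<in> ob (seq_cat C) \<Longrightarrow> g \<in> Hom C X (obj S i) \<Longrightarrow>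
       \<exists>\<phi>. \<phi> \<in> Hom (seq_cat C) R S \<and> level \<phi> i = g"
    "\<phi> \<in> Hom (seq_cat C) R S \<Longrightarrow> \<psi> \<in> Hom (seq_cat C) R S \<Longrightarrow>
       level \<phi> i = level \<psi> i \<Longrightarrow> \<phi> = \<psi>"
  using assms unfolding is_induced_def by simp_all

end

context preadditive_category
begin

lemma seq_zer_Hom:
  assumes S: "S \<in> ob (seq_cat C)" and T: "T \<in> ob (seq_cat C)"
  shows "zer (seq_cat C) S T \<in> Hom (seq_cat C) S T"
proof -
  have ob: "obj S i \<in> ob C" "obj T i \<in> ob C"
    and b: "bond S i \<in> Hom C (obj S (Suc i)) (obj S i)" "bond T i \<in> Hom C (obj T (Suc i)) (obj T i)" for i
    using S T by (simp_all add: seq_ob_iff)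
  have "msrc (zer (seq_cat C) S T) = S" "mtgt (zer (seq_cat C) S T) = T"
    by (simp_all add: seq_cat_def Let_def)
  then show ?thesis unfolding seq_Hom_iff using S T
    by (simp add: zer_Hom[OF ob] cmp_zer_left[OF b(1) ob(2)] cmp_zer_right[OF b(2) ob(1)])
qed

lemma zero_target_unique:
  assumes "is_zero C Z" "f \<in> Hom C A Z" "g \<in> Hom C A Z"
  shows "f = g"
  using assms HomD(4)[OF assms(2)] unfolding is_zero_def by blast

lemma zero_source_unique:
  assumes "is_zero C Z" "f \<in> Hom C Z A" "g \<in> Hom C Z A"
  shows "f = g"
  using assms HomD(5)[OF assms(2)] unfolding is_zero_def by blast

end

context abelian_category
begin

(* Value at X of the right adjoint to evaluation at i: X at the places j \<ge> i and zero below. *)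
lemma seq_coinduced:
  assumes X: "X \<in> ob C"
  shows "\<exists>R. is_coinduced i X R"
proof -
  obtain Z where Z: "is_zero C Z" using ex_zero by blast
  then have Zob: "Z \<in> ob C" by (simp add: is_zero_def)
  define R where "R = \<lparr>obj = (\<lambda>j. if j < i then Z else X),
    bond = (\<lambda>j. if j < i then zer C (if Suc j < i then Z else X) Z else idn C X)\<rparr>"
  have Rob: "R \<in> ob (seq_cat C)"
    unfolding seq_ob_iff R_def using X Zob idn_Hom zer_Hom by auto
  have ex: "\<exists>\<phi>. \<phi> \<in> Hom (seq_cat C) S R \<and> level \<phi> i = g"
    if S: "S \<in> ob (seq_cat C)" and g: "g \<in> Hom C (obj S i) X" for S g
  proof -
    have So: "obj S j \<in> ob C" and Sb: "bond S j \<in> Hom C (obj S (Suc j)) (obj S j)" for j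
      using S by (simp_all add: seq_ob_iff)
    \<comment> \<open>The component at place i + k: \<open>g\<close> preceded by the k bonds that
      lead down from there to place i.\<close>
    define v where "v = rec_nat g (\<lambda>k r. r \<cdot> bond S (i + k))"
    have v: "v k \<in> Hom C (obj S (i + k)) X" for k
    proof (induction k)
      case (Suc k) then show ?case using cmp_Hom[OF Sb] unfolding v_def by simp
    qed (simp add: v_def g)
    define \<phi> where "\<phi> = \<lparr>msrc = S, mtgt = R, level = (\<lambda>j. if j < i then zer C (obj S j) Z else v (j - i))\<rparr>"
    have lv: "level \<phi> j \<in> Hom C (obj S j) (obj R j)" for j
      using v[of "j - i"] zer_Hom[OF So Zob] unfolding \<phi>_def R_def by (cases "j < i") simp_all
    have "level \<phi> j \<cdot> bond S j = bond R j \<cdot> level \<phi> (Suc j)" for j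
    proof (cases "j < i")
      case True
      then have "bond R j \<cdot> level \<phi> (Suc j) = zer C (obj S (Suc j)) Z"
        using cmp_zer_left[OF lv[of "Suc j"] Zob] by (simp add: R_def)
      then show ?thesis using True cmp_zer_left[OF Sb Zob] by (simp add: \<phi>_def)
    next
      case False
      then obtain k where k: "j = i + k" using le_Suc_ex by (metis not_less)
      have "Suc j - i = Suc k" using k by simp
      then have "level \<phi> (Suc j) = v (Suc k)" using k by (simp add: \<phi>_def)
      then show ?thesis using k idn_left[OF v[of "Suc k"]] by (simp add: \<phi>_def R_def v_def)
    qed
    then have "\<phi> \<in> Hom (seq_cat C) S R"
      unfolding seq_Hom_iff using lv S Rob by (simp add: \<phi>_def)
    moreover have "level \<phi> i = g" by (simp add: \<phi>_def v_def)
    ultimately show ?thesis by blast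
  qed
  have un: "\<phi> = \<psi>" if \<phi>: "\<phi> \<in> Hom (seq_cat C) S R" and \<psi>: "\<psi> \<in> Hom (seq_cat C) S R"
    and eq: "level \<phi> i = level \<psi> i" for S \<phi> \<psi>
  proof (rule seq_map_eqI[OF \<phi> \<psi>])
    fix j show "level \<phi> j = level \<psi> j"
    proof (cases "j < i")
      case True
      then show ?thesis
        using zero_target_unique[OF Z] seq_HomD(3)[OF \<phi>, of j] seq_HomD(3)[OF \<psi>, of j]
        by (simp add: R_def)
    next
      case False
      then have "i \<le> j" by simp
      then show ?thesis
      proof (induction j rule: dec_induct)
        case (step j)
        have "level \<chi> (Suc j) = level \<chi> j \<cdot> bond S j" if \<chi>: "\<chi> \<in> Hom (seq_cat C) S R" for \<chi>
          using seq_HomD(4)[OF \<chi>, of j] idn_left seq_HomD(3)[OF \<chi>, of "Suc j"] step.hyps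
          by (simp add: R_def)
        then show ?case using \<phi> \<psi> step.IH by simp
      qed (rule eq)
    qed
  qed
  have "obj R i = X" by (simp add: R_def)
  with Rob ex un show ?thesis unfolding is_coinduced_def by (intro exI[of _ R] conjI allI impI)
qed

(* Value at X of the left adjoint to evaluation at i: X at the places j \<le> i and zero above. *)
lemma seq_induced:
  assumes X: "X \<in> ob C"
  shows "\<exists>R. is_induced i X R"
proof -
  obtain Z where Z: "is_zero C Z" using ex_zero by blast
  then have Zob: "Z \<in> ob C" by (simp add: is_zero_def)
  define R where "R = \<lparr>obj = (\<lambda>j. if j \<le> i then X else Z),
    bond = (\<lambda>j. if j < i then idn C X else zer C Z (if j \<le> i then X else Z))\<rparr>"
  have Rob: "R \<in> ob (seq_cat C)"
    unfolding seq_ob_iff R_def using X Zob idn_Hom zer_Hom by auto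
  have ex: "\<exists>\<phi>. \<phi> \<in> Hom (seq_cat C) R S \<and> level \<phi> i = g"
    if S: "S \<in> ob (seq_cat C)" and g: "g \<in> Hom C X (obj S i)" for S g
  proof -
    have So: "obj S j \<in> ob C" and Sb: "bond S j \<in> Hom C (obj S (Suc j)) (obj S j)" for j
      using S by (simp_all add: seq_ob_iff)
    \<comment> \<open>The component at place i - k: \<open>g\<close> pushed down along k bonds. It
      is meaningful for k at most i only, since subtraction is truncated.\<close>
    define v where "v = rec_nat g (\<lambda>k r. bond S (i - Suc k) \<cdot> r)"
    have v: "k \<le> i \<Longrightarrow> v k \<in> Hom C X (obj S (i - k))" for k
    proof (induction k)
      case (Suc k)
      then have "Suc (i - Suc k) = i - k" by simp
      with Suc show ?case using cmp_Hom[OF _ Sb[of "i - Suc k"], of "v k" X] unfolding v_def by simp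
    qed (simp add: v_def g)
    define \<phi> where "\<phi> = \<lparr>msrc = R, mtgt = S, level = (\<lambda>j. if j \<le> i then v (i - j) else zer C Z (obj S j))\<rparr>"
    have lv: "level \<phi> j \<in> Hom C (obj R j) (obj S j)" for j
      using v[of "i - j"] zer_Hom[OF Zob So] unfolding \<phi>_def R_def by (cases "j \<le> i") simp_all
    have "level \<phi> j \<cdot> bond R j = bond S j \<cdot> level \<phi> (Suc j)" for j
    proof (cases "j < i")
      case True
      then have *: "i - j = Suc (i - Suc j)" "i - Suc (i - Suc j) = j" by simp_all
      have "level \<phi> j = bond S j \<cdot> level \<phi> (Suc j)"
        using True * by (simp add: \<phi>_def v_def)
      moreover have "level \<phi> j \<cdot> bond R j = level \<phi> j"
        using True idn_right lv[of j] by (simp add: R_def)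
      ultimately show ?thesis by simp
    next
      case False
      then have "level \<phi> j \<cdot> bond R j = zer C Z (obj S j)"
        using cmp_zer_right[OF lv[of j] Zob] by (simp add: R_def split: if_splits)
      then show ?thesis using False cmp_zer_right[OF Sb Zob] by (simp add: \<phi>_def)
    qed
    then have "\<phi> \<in> Hom (seq_cat C) R S"
      unfolding seq_Hom_iff using lv S Rob by (simp add: \<phi>_def)
    moreover have "level \<phi> i = g" by (simp add: \<phi>_def v_def)
    ultimately show ?thesis by blast
  qed
  have un: "\<phi> = \<psi>" if \<phi>: "\<phi> \<in> Hom (seq_cat C) R S" and \<psi>: "\<psi> \<in> Hom (seq_cat C) R S"
    and eq: "level \<phi> i = level \<psi> i" for S \<phi> \<psi>
  proof (rule seq_map_eqI[OF \<phi> \<psi>])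
    fix j show "level \<phi> j = level \<psi> j"
    proof (cases "j \<le> i")
      case False
      then show ?thesis
        using zero_source_unique[OF Z] seq_HomD(3)[OF \<phi>, of j] seq_HomD(3)[OF \<psi>, of j]
        by (simp add: R_def)
    next
      case True
      then show ?thesis
      proof (induction j rule: inc_induct)
        case (step j)
        have "level \<chi> j = bond S j \<cdot> level \<chi> (Suc j)" if \<chi>: "\<chi> \<in> Hom (seq_cat C) R S" for \<chi>
          using seq_HomD(4)[OF \<chi>, of j] idn_right seq_HomD(3)[OF \<chi>, of j] step.hyps
          by (simp add: R_def)
        then show ?case using \<phi> \<psi> step.IH by simp
      qed (rule eq)
    qed
  qed
  have "obj R i = X" by (simp add: R_def)
  with Rob ex un show ?thesis unfolding is_induced_def by (intro exI[of _ R] conjI allI impI)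
qed

text \<open>Evaluation at i has a right adjoint, hence preserves epis: two maps to be distinguished
  at place i extend to maps from L into a coinduced sequence.\<close>

lemma level_epi:
  assumes h: "is_epi (seq_cat C) h" "h \<in> Hom (seq_cat C) S L"
  shows "is_epi C (level h i)"
  unfolding is_epi_def
proof (intro conjI ballI impI)
  note hi = HomD[OF seq_HomD(3)[OF h(2), of i]]
  show "level h i \<in> arr C" by (rule hi)
  fix X g k assume X: "X \<in> ob C" and g: "g \<in> Hom C (tgt C (level h i)) X"
    and k: "k \<in> Hom C (tgt C (level h i)) X" and eq: "g \<cdot> level h i = k \<cdot> level h i"
  obtain R where "is_coinduced i X R" using seq_coinduced[OF X] ..
  note R = is_coinducedD[OF this]
  note L = seq_HomD(2)[OF h(2)]
  obtain \<phi> where \<phi>: "\<phi> \<in> Hom (seq_cat C) L R" "level \<phi> i = g" using R(3)[OF L] g hi by auto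
  obtain \<psi> where \<psi>: "\<psi> \<in> Hom (seq_cat C) L R" "level \<psi> i = k" using R(3)[OF L] k hi by auto
  have "\<phi> \<cdot>\<^bsub>seq_cat C\<^esub> h = \<psi> \<cdot>\<^bsub>seq_cat C\<^esub> h"
    by (rule R(4)[OF seq_cmp_Hom[OF h(2) \<phi>(1)] seq_cmp_Hom[OF h(2) \<psi>(1)]]) (simp add: \<phi>(2) \<psi>(2) eq)
  then have "\<phi> = \<psi>" by (rule category.is_epiD[OF seq_category h \<phi>(1) \<psi>(1)])
  then show "g = k" using \<phi>(2) \<psi>(2) by simp
qed

text \<open>Same reason: evaluation is a left adjoint. Both factorization and uniqueness are
  transported along the bijection with maps into a coinduced sequence.\<close>

lemma level_cokernel:
  assumes c: "is_cokernel (seq_cat C) \<phi> p" and \<phi>: "\<phi> \<in> Hom (seq_cat C) A B"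
    and p: "p \<in> Hom (seq_cat C) B Q"
  shows "is_cokernel C (level \<phi> i) (level p i)"
proof -
  note \<phi>i = seq_HomD(3)[OF \<phi>, of i] and pi = seq_HomD(3)[OF p, of i]
  have msrc: "msrc \<phi> = A" "mtgt \<phi> = B" "msrc p = B" "mtgt p = Q"
    using \<phi> p by (simp_all add: seq_Hom_iff)
  have "p \<cdot>\<^bsub>seq_cat C\<^esub> \<phi> = zer (seq_cat C) A Q"
    using c by (simp add: is_cokernel_def msrc)
  then have z: "level p i \<cdot> level \<phi> i = zer C (obj A i) (obj Q i)"
    using seq_cat_simps(4)[of C p \<phi> i] by simp
  have "\<exists>!u. u \<in> Hom C (obj Q i) X \<and> u \<cdot> level p i = h"
    if X: "X \<in> ob C" and h: "h \<in> Hom C (obj B i) X" and hz: "h \<cdot> level \<phi> i = zer C (obj A i) X" for X h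
  proof -
    obtain R where "is_coinduced i X R" using seq_coinduced[OF X] ..
    note R = is_coinducedD[OF this]
    obtain H where H: "H \<in> Hom (seq_cat C) B R" "level H i = h" using R(3)[OF seq_HomD(2)[OF \<phi>] h] by blast
    have "H \<cdot>\<^bsub>seq_cat C\<^esub> \<phi> = zer (seq_cat C) A R"
      by (rule R(4)[OF seq_cmp_Hom[OF \<phi> H(1)] seq_zer_Hom[OF seq_HomD(1)[OF \<phi>] R(1)]])
        (simp add: H(2) hz R(2))
    then have ex1: "\<exists>!u. u \<in> Hom (seq_cat C) Q R \<and> u \<cdot>\<^bsub>seq_cat C\<^esub> p = H"
      using c R(1) H(1) by (simp add: is_cokernel_def msrc)
    then obtain u where u: "u \<in> Hom (seq_cat C) Q R" "u \<cdot>\<^bsub>seq_cat C\<^esub> p = H" by blast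
    have "level u i \<cdot> level p i = h" using u(2) H(2) seq_cat_simps(4)[of C u p i] by simp
    moreover have "w = level u i" if w: "w \<in> Hom C (obj Q i) X" "w \<cdot> level p i = h" for w
    proof -
      obtain W where W: "W \<in> Hom (seq_cat C) Q R" "level W i = w" using R(3)[OF seq_HomD(2)[OF p] w(1)] by blast
      have "W \<cdot>\<^bsub>seq_cat C\<^esub> p = H"
        by (rule R(4)[OF seq_cmp_Hom[OF p W(1)] H(1)]) (simp add: W(2) w(2) H(2))
      then have "W = u" using ex1 W(1) u by blast
      then show ?thesis using W(2) by simp
    qed
    ultimately show ?thesis using seq_HomD(3)[OF u(1), of i] R(2) by metis
  qed
  then show ?thesis unfolding is_cokernel_def using HomD[OF \<phi>i] HomD[OF pi] z by simp
qed

text \<open>Evaluation at i is also a right adjoint: a cone at place i with vertex Y extends to a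
  cone whose vertex is the sequence induced from Y.\<close>

lemma level_limit:
  assumes L: "is_inverse_limit (seq_cat C) A D u L \<rho>"
    and u: "\<And>a b. a \<in> A \<Longrightarrow> b \<in> A \<Longrightarrow> a \<le> b \<Longrightarrow> u a b \<in> Hom (seq_cat C) (D b) (D a)"
    and D: "\<And>a. a \<in> A \<Longrightarrow> D a \<in> ob (seq_cat C)"
  shows "is_inverse_limit C A (\<lambda>a. obj (D a) i) (\<lambda>a b. level (u a b) i) (obj L i) (\<lambda>a. level (\<rho> a) i)"
proof -
  have Lob: "L \<in> ob (seq_cat C)" using L by (simp add: is_inverse_limit_def)
  have \<rho>: "\<rho> a \<in> Hom (seq_cat C) L (D a)" if "a \<in> A" for a
    using L that by (simp add: is_inverse_limit_def)
  have comp: "level (u a b) i \<cdot> level (\<rho> b) i = level (\<rho> a) i" if "a \<in> A" "b \<in> A" "a \<le> b" for a b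
  proof -
    have "u a b \<cdot>\<^bsub>seq_cat C\<^esub> \<rho> b = \<rho> a" using L that by (simp add: is_inverse_limit_def)
    then show ?thesis using seq_cat_simps(4)[of C "u a b" "\<rho> b" i] by simp
  qed
  have "\<exists>!h. h \<in> Hom C Y (obj L i) \<and> (\<forall>a\<in>A. level (\<rho> a) i \<cdot> h = f a)"
    if Y: "Y \<in> ob C" and f: "\<And>a. a \<in> A \<Longrightarrow> f a \<in> Hom C Y (obj (D a) i)"
      and fc: "\<And>a b. a \<in> A \<Longrightarrow> b \<in> A \<Longrightarrow> a \<le> b \<Longrightarrow> level (u a b) i \<cdot> f b = f a" for Y f
  proof -
    obtain R where "is_induced i Y R" using seq_induced[OF Y] ..
    note R = is_inducedD[OF this]
    have "\<forall>a\<in>A. \<exists>\<phi>. \<phi> \<in> Hom (seq_cat C) R (D a) \<and> level \<phi> i = f a"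
      using R(3) D f by blast
    from bchoice[OF this] obtain F
      where F': "\<forall>a\<in>A. F a \<in> Hom (seq_cat C) R (D a) \<and> level (F a) i = f a" ..
    then have F: "F a \<in> Hom (seq_cat C) R (D a)" "level (F a) i = f a" if "a \<in> A" for a
      using that by simp_all
    have Fc: "u a b \<cdot>\<^bsub>seq_cat C\<^esub> F b = F a" if ab: "a \<in> A" "b \<in> A" "a \<le> b" for a b
      by (rule R(4)[OF seq_cmp_Hom[OF F(1)[OF ab(2)] u[OF ab]] F(1)[OF ab(1)]])
        (simp add: F(2) ab fc)
    have ex1: "\<exists>!h. h \<in> Hom (seq_cat C) R L \<and> (\<forall>a\<in>A. \<rho> a \<cdot>\<^bsub>seq_cat C\<^esub> h = F a)"
      by (rule category.inverse_limit_ex1[OF seq_category L R(1) F(1) Fc])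
    then obtain h where h: "h \<in> Hom (seq_cat C) R L" "\<forall>a\<in>A. \<rho> a \<cdot>\<^bsub>seq_cat C\<^esub> h = F a" by blast
    have hf: "level (\<rho> a) i \<cdot> level h i = f a" if "a \<in> A" for a
      using h(2) that F(2)[OF that] seq_cat_simps(4)[of C "\<rho> a" h i] by simp
    have hk: "k = level h i"
      if k: "k \<in> Hom C Y (obj L i)" "\<forall>a\<in>A. level (\<rho> a) i \<cdot> k = f a" for k
    proof -
      obtain K where K: "K \<in> Hom (seq_cat C) R L" "level K i = k" using R(3)[OF Lob k(1)] by blast
      have "\<rho> a \<cdot>\<^bsub>seq_cat C\<^esub> K = F a" if a: "a \<in> A" for a
        by (rule R(4)[OF seq_cmp_Hom[OF K(1) \<rho>[OF a]] F(1)[OF a]]) (simp add: K(2) k(2) F(2) a)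
      then have "K = h" using ex1 K(1) h by blast
      then show ?thesis using K(2) by simp
    qed
    show ?thesis
    proof (rule ex1I)
      show "level h i \<in> Hom C Y (obj L i) \<and> (\<forall>a\<in>A. level (\<rho> a) i \<cdot> level h i = f a)"
        using seq_HomD(3)[OF h(1), of i] R(2) hf by simp
    qed (use hk in simp)
  qed
  moreover have "obj L i \<in> ob C" using Lob by (simp add: seq_ob_iff)
  ultimately show ?thesis unfolding is_inverse_limit_def
    using comp seq_HomD(3)[OF \<rho>] by simp
qed

end

section \<open>Small ordinals\<close>

text \<open>A greatest element would make the type one point larger than a strictly smaller initial
  segment. An infinite set absorbs a point, and a finite type is excluded because \<open>nat\<close>
  is small.\<close>

lemma universe_no_max:
  assumes U: "universe_type (U :: 'u::wellorder itself)"
  shows "\<exists>\<beta>. \<alpha> < (\<beta>::'u)"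
proof (rule ccontr)
  assume "\<nexists>\<beta>. \<alpha> < \<beta>"
  then have eq: "UNIV = insert \<alpha> {..<\<alpha>}" by (auto simp: not_less order_le_less)
  have less: "{..<\<alpha>} \<prec> (UNIV :: 'u set)" and nat: "(UNIV :: nat set) \<prec> (UNIV :: 'u set)"
    using U by (auto simp: universe_type_def small_def)
  show False
  proof (cases "finite {..<\<alpha>}")
    case True
    then have "finite (UNIV :: 'u set)" using eq by (metis finite_insert)
    then show False using infinite_le_lepoll[of "UNIV :: 'u set"] nat lesspoll_def by blast
  next
    case False
    then show False using less eq infinite_insert_eqpoll eqpoll_sym lesspoll_def by metis
  qed
qed

lemma zero_ord_le: "zero_ord \<le> (\<alpha> :: 'u::wellorder)"
  unfolding zero_ord_def by (rule Least_le) simp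

lemma succ_ord_greater:
  assumes "universe_type (U :: 'u::wellorder itself)"
  shows "\<alpha> < succ_ord (\<alpha> :: 'u)"
  unfolding succ_ord_def using universe_no_max[OF assms] by (rule LeastI_ex)

lemma succ_ord_le: "\<alpha> < \<beta> \<Longrightarrow> succ_ord \<alpha> \<le> (\<beta> :: 'u::wellorder)"
  unfolding succ_ord_def by (rule Least_le)

lemma ord_cases [consumes 1, case_names zero succ limit]:
  assumes U: "universe_type (U :: 'u::wellorder itself)"
  obtains "(\<beta> :: 'u) = zero_ord" | \<alpha> where "\<alpha> < \<beta>" "\<beta> = succ_ord \<alpha>" | "limit_ord \<beta>"
proof (cases "\<beta> = zero_ord \<or> limit_ord \<beta>")
  case False
  then have "zero_ord < \<beta>" using zero_ord_le[of \<beta>] by (auto simp: order_le_less)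
  then obtain \<alpha> where \<alpha>: "\<alpha> < \<beta>" "\<forall>\<gamma>. \<alpha> < \<gamma> \<longrightarrow> \<beta> \<le> \<gamma>"
    using False unfolding limit_ord_def by (meson not_less)
  then have "\<beta> = succ_ord \<alpha>" using succ_ord_greater[OF U, of \<alpha>] succ_ord_le[of \<alpha> \<beta>] by fastforce
  then show ?thesis using that(2) \<alpha> by blast
qed (use that(1,3) in blast)

text \<open>Otherwise every element is a finite iterate of the successor on zero and the type is
  countable, while \<open>nat\<close> is small. The lemma matters because completeness at some limit
  ordinal is what provides an image tower.\<close>

lemma limit_ord_exists:
  assumes U: "universe_type (U :: 'u::wellorder itself)"
  shows "\<exists>\<kappa>::'u. limit_ord \<kappa>"
proof (rule ccontr)
  assume no: "\<nexists>\<kappa>::'u. limit_ord \<kappa>"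
  define e :: "nat \<Rightarrow> 'u" where "e = rec_nat zero_ord (\<lambda>_. succ_ord)"
  have "\<beta> \<in> range e" for \<beta> :: 'u
  proof (induction \<beta> rule: less_induct)
    case (less \<beta>)
    from U show ?case
    proof (cases rule: ord_cases[where \<beta> = \<beta>])
      case zero
      then have "\<beta> = e 0" by (simp add: e_def)
      then show ?thesis by blast
    next
      case (succ \<alpha>)
      then obtain n where "\<alpha> = e n" using less by blast
      then have "\<beta> = e (Suc n)" using succ by (simp add: e_def)
      then show ?thesis by blast
    qed (use no in blast)
  qed
  then have "(UNIV :: 'u set) \<lesssim> (UNIV :: nat set)" by (metis UNIV_eq_I image_lepoll)
  moreover have "(UNIV :: nat set) \<prec> (UNIV :: 'u set)"
    using U by (simp add: universe_type_def small_def)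
  ultimately show False using lesspoll_trans2 by blast
qed

section \<open>The shift equation\<close>

context category
begin

text \<open>The equation (1 - F) y = x, read componentwise for families of maps out of
  \<open>X\<close>.\<close>

definition is_solution :: "(nat \<Rightarrow> 'o) \<Rightarrow> (nat \<Rightarrow> 'm) \<Rightarrow> 'o \<Rightarrow> (nat \<Rightarrow> 'm) \<Rightarrow> (nat \<Rightarrow> 'm) \<Rightarrow> bool" where
  "is_solution Q b X x y \<longleftrightarrow> (\<forall>i. y i \<in> Hom C X (Q i) \<and> y i = add C (x i) (b i \<cdot> y (Suc i)))"

text \<open>For bonds \<open>b i\<close> from \<open>Q (Suc i)\<close> to \<open>Q i\<close> and an
  existing product of the \<open>Q i\<close>, this says by Yoneda that 1 - F is invertible on the
  product. Speaking of families lets the property pass through limits taken place by place.\<close>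

definition uniquely_solvable :: "(nat \<Rightarrow> 'o) \<Rightarrow> (nat \<Rightarrow> 'm) \<Rightarrow> bool" where
  "uniquely_solvable Q b \<longleftrightarrow> (\<forall>X\<in>ob C. \<forall>x. (\<forall>i. x i \<in> Hom C X (Q i)) \<longrightarrow>
     (\<exists>!y. is_solution Q b X x y))"
text \<open>The subobjects enter as a bare family \<open>m\<close> without bonds, so that kernels
  chosen separately at each place can be used.\<close>

definition is_quotient_seq ::
    "('o, 'm) invseq \<Rightarrow> (nat \<Rightarrow> 'm) \<Rightarrow> (nat \<Rightarrow> 'o) \<Rightarrow> (nat \<Rightarrow> 'm) \<Rightarrow> (nat \<Rightarrow> 'm) \<Rightarrow> bool" where
  "is_quotient_seq S m Q b q \<longleftrightarrow> (\<forall>i. is_cokernel C (m i) (q i) \<and> q i \<in> Hom C (obj S i) (Q i) \<and>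
     b i \<in> Hom C (Q (Suc i)) (Q i) \<and> b i \<cdot> q (Suc i) = q i \<cdot> bond S i)"

lemma is_quotient_seqD:
  assumes "is_quotient_seq S m Q b q"
  shows "is_cokernel C (m i) (q i)" "q i \<in> Hom C (obj S i) (Q i)"
    "b i \<in> Hom C (Q (Suc i)) (Q i)" "b i \<cdot> q (Suc i) = q i \<cdot> bond S i"
  using assms unfolding is_quotient_seq_def by simp_all

end

context preadditive_category
begin

section \<open>Transport of unique solvability along shifts, limits and quotients\<close>

lemma is_solution_map:
  assumes y: "is_solution Q b X x y"
    and x: "\<And>i. x i \<in> Hom C X (Q i)" and b: "\<And>i. b i \<in> Hom C (Q (Suc i)) (Q i)"
    and u: "\<And>i. u i \<in> Hom C (Q i) (Q' i)" and b': "\<And>i. b' i \<in> Hom C (Q' (Suc i)) (Q' i)"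
    and ub: "\<And>i. u i \<cdot> b i = b' i \<cdot> u (Suc i)"
  shows "is_solution Q' b' X (\<lambda>i. u i \<cdot> x i) (\<lambda>i. u i \<cdot> y i)"
  unfolding is_solution_def
proof (intro allI conjI)
  fix i
  have yi: "y i \<in> Hom C X (Q i)" "y i = add C (x i) (b i \<cdot> y (Suc i))" for i
    using y[unfolded is_solution_def, THEN spec, of i] by (rule conjunct1, rule conjunct2)
  show "u i \<cdot> y i \<in> Hom C X (Q' i)" using cmp_Hom[OF yi(1) u] .
  have "u i \<cdot> y i = add C (u i \<cdot> x i) (u i \<cdot> (b i \<cdot> y (Suc i)))"
    using cmp_add_right[OF x[of i] cmp_Hom[OF yi(1)[of "Suc i"] b] u] yi(2)[of i] by simp
  also have "u i \<cdot> (b i \<cdot> y (Suc i)) = b' i \<cdot> (u (Suc i) \<cdot> y (Suc i))"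
    using cmp_assoc[OF yi(1)[of "Suc i"] b u] cmp_assoc[OF yi(1)[of "Suc i"] u b'] ub[of i] by simp
  finally show "u i \<cdot> y i = add C (u i \<cdot> x i) (b' i \<cdot> (u (Suc i) \<cdot> y (Suc i)))" .
qed

(* u and g are mutually inverse up to a shift of the index, and a solution over Q' is recovered
   from its image under u as x + g y. *)
lemma uniquely_solvable_shift:
  assumes Q: "uniquely_solvable Q b"
    and b: "\<And>i. b i \<in> Hom C (Q (Suc i)) (Q i)" and b': "\<And>i. b' i \<in> Hom C (Q' (Suc i)) (Q' i)"
    and u: "\<And>i. u i \<in> Hom C (Q' i) (Q i)" and g: "\<And>i. g i \<in> Hom C (Q (Suc i)) (Q' i)"
    and ug: "\<And>i. u i \<cdot> g i = b i" and gu: "\<And>i. g i \<cdot> u (Suc i) = b' i"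
  shows "uniquely_solvable Q' b'"
  unfolding uniquely_solvable_def
proof (intro ballI allI impI)
  fix X x assume X: "X \<in> ob C" and "\<forall>i. x i \<in> Hom C X (Q' i)"
  then have x: "x i \<in> Hom C X (Q' i)" for i by simp
  note ux = cmp_Hom[OF x u]
  have ub: "u i \<cdot> b' i = b i \<cdot> u (Suc i)" for i
    using cmp_assoc[OF u[of "Suc i"] g u[of i]] ug gu by simp
  have gub: "g i \<cdot> (u (Suc i) \<cdot> z) = b' i \<cdot> z" if "z \<in> Hom C X (Q' (Suc i))" for i z
    using cmp_assoc[OF that u g] gu by simp
  have ex1: "\<exists>!y. is_solution Q b X (\<lambda>i. u i \<cdot> x i) y"
    using Q[unfolded uniquely_solvable_def, THEN bspec, OF X, THEN spec, THEN mp,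
        of "\<lambda>i. u i \<cdot> x i"] ux by simp
  then obtain y where y: "is_solution Q b X (\<lambda>i. u i \<cdot> x i) y" by (elim ex1E)
  have yi: "y i \<in> Hom C X (Q i)" "y i = add C (u i \<cdot> x i) (b i \<cdot> y (Suc i))" for i
    using y[unfolded is_solution_def, THEN spec, of i] by (rule conjunct1, rule conjunct2)
  define z where "z i = add C (x i) (g i \<cdot> y (Suc i))" for i
  have gy: "g i \<cdot> y (Suc i) \<in> Hom C X (Q' i)" for i using cmp_Hom[OF yi(1) g] .
  have z: "z i \<in> Hom C X (Q' i)" for i unfolding z_def using add_Hom[OF x gy] .
  have uz: "u i \<cdot> z i = y i" for i
    using cmp_add_right[OF x gy u, of i] cmp_assoc[OF yi(1)[of "Suc i"] g u] ug[of i] yi(2)[of i]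
    unfolding z_def by simp
  have "z i = add C (x i) (b' i \<cdot> z (Suc i))" for i
    using gub[OF z[of "Suc i"]] uz[of "Suc i"] z_def[of i] by simp
  then have "is_solution Q' b' X x z" unfolding is_solution_def using z by blast
  moreover have "w = z" if w: "is_solution Q' b' X x w" for w
  proof
    fix i
    have wi: "w i \<in> Hom C X (Q' i)" "w i = add C (x i) (b' i \<cdot> w (Suc i))" for i
      using w[unfolded is_solution_def, THEN spec, of i] by (rule conjunct1, rule conjunct2)
    have "(\<lambda>i. u i \<cdot> w i) = y"
      using ex1 is_solution_map[OF w x b' u b ub] y by (metis (no_types, lifting))
    then have "u (Suc i) \<cdot> w (Suc i) = y (Suc i)" by (rule fun_cong)
    then show "w i = z i" using wi(2)[of i] gub[OF wi(1)[of "Suc i"]] unfolding z_def by simp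
  qed
  ultimately show "\<exists>!y. is_solution Q' b' X x y" by (rule ex1I)
qed

text \<open>The transition maps send solutions to solutions, so uniqueness forces the solutions over
  the stages to be compatible; they then define a family into the limit. Equations and uniqueness
  are checked after projection to each stage.\<close>

lemma uniquely_solvable_limit:
  assumes L: "\<And>i. is_inverse_limit C A (\<lambda>a. D a i) (\<lambda>a b. u a b i) (L i) (\<lambda>a. \<rho> a i)"
    and u: "\<And>a b i. a \<in> A \<Longrightarrow> b \<in> A \<Longrightarrow> a \<le> b \<Longrightarrow> u a b i \<in> Hom C (D b i) (D a i)"
    and g: "\<And>a i. a \<in> A \<Longrightarrow> g a i \<in> Hom C (D a (Suc i)) (D a i)"
    and ug: "\<And>a b i. a \<in> A \<Longrightarrow> b \<in> A \<Longrightarrow> a \<le> b \<Longrightarrow> u a b i \<cdot> g b i = g a i \<cdot> u a b (Suc i)"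
    and l: "\<And>i. l i \<in> Hom C (L (Suc i)) (L i)"
    and \<rho>l: "\<And>a i. a \<in> A \<Longrightarrow> \<rho> a i \<cdot> l i = g a i \<cdot> \<rho> a (Suc i)"
    and D: "\<And>a. a \<in> A \<Longrightarrow> uniquely_solvable (D a) (g a)"
  shows "uniquely_solvable L l"
  unfolding uniquely_solvable_def
proof (intro ballI allI impI)
  fix X x assume X: "X \<in> ob C" and "\<forall>i. x i \<in> Hom C X (L i)"
  then have x: "x i \<in> Hom C X (L i)" for i by simp
  have \<rho>: "\<rho> a i \<in> Hom C (L i) (D a i)" if "a \<in> A" for a i
    using inverse_limit_Hom[OF L that] .
  have ex1: "\<exists>!y. is_solution (D a) (g a) X (\<lambda>i. \<rho> a i \<cdot> x i) y" if a: "a \<in> A" for a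
    using D[OF a, unfolded uniquely_solvable_def, THEN bspec, OF X, THEN spec, THEN mp,
        of "\<lambda>i. \<rho> a i \<cdot> x i"] cmp_Hom[OF x \<rho>[OF a]] by simp
  then have "\<forall>a\<in>A. \<exists>y. is_solution (D a) (g a) X (\<lambda>i. \<rho> a i \<cdot> x i) y" by blast
  from bchoice[OF this] obtain y
    where y': "\<forall>a\<in>A. is_solution (D a) (g a) X (\<lambda>i. \<rho> a i \<cdot> x i) (y a)" ..
  then have y: "is_solution (D a) (g a) X (\<lambda>i. \<rho> a i \<cdot> x i) (y a)" if "a \<in> A" for a
    using that by blast
  have yi: "y a i \<in> Hom C X (D a i)" "y a i = add C (\<rho> a i \<cdot> x i) (g a i \<cdot> y a (Suc i))" if "a \<in> A" for a i
    using y[OF that, unfolded is_solution_def, THEN spec, of i] by (rule conjunct1, rule conjunct2)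
  have uy: "u a b i \<cdot> y b i = y a i" if ab: "a \<in> A" "b \<in> A" "a \<le> b" for a b i
  proof -
    have "u a b j \<cdot> (\<rho> b j \<cdot> x j) = \<rho> a j \<cdot> x j" for j
    proof -
      have "u a b j \<cdot> \<rho> b j = \<rho> a j" using L[of j] ab unfolding is_inverse_limit_def by blast
      then show ?thesis using cmp_assoc[OF x[of j] \<rho>[OF ab(2)] u[OF ab]] by simp
    qed
    then have "is_solution (D a) (g a) X (\<lambda>i. \<rho> a i \<cdot> x i) (\<lambda>i. u a b i \<cdot> y b i)"
      using is_solution_map[OF y[OF ab(2)] cmp_Hom[OF x \<rho>[OF ab(2)]] g[OF ab(2)] u[OF ab]
          g[OF ab(1)] ug[OF ab]] by simp
    then have "(\<lambda>i. u a b i \<cdot> y b i) = y a"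
      using ex1[OF ab(1)] y[OF ab(1)] by (metis (no_types, lifting))
    then show ?thesis by (rule fun_cong)
  qed
  have eqI: "v = w" if "v \<in> Hom C X (L i)" "w \<in> Hom C X (L i)" "\<And>a. a \<in> A \<Longrightarrow> \<rho> a i \<cdot> v = \<rho> a i \<cdot> w"
    for v w i
    using inverse_limit_eqI[OF L that(1,2) u that(3)] .
  have "\<forall>i. \<exists>z. z \<in> Hom C X (L i) \<and> (\<forall>a\<in>A. \<rho> a i \<cdot> z = y a i)"
    using ex1_implies_ex[OF inverse_limit_ex1[OF L X yi(1) uy]] by simp
  from choice[OF this] obtain z
    where z': "\<forall>i. z i \<in> Hom C X (L i) \<and> (\<forall>a\<in>A. \<rho> a i \<cdot> z i = y a i)" ..
  then have z: "z i \<in> Hom C X (L i)" and \<rho>z: "\<And>a. a \<in> A \<Longrightarrow> \<rho> a i \<cdot> z i = y a i" for i by simp_all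
  have "z i = add C (x i) (l i \<cdot> z (Suc i))" for i
  proof (rule eqI[OF z add_Hom[OF x cmp_Hom[OF z l]]])
    fix a assume a: "a \<in> A"
    have "\<rho> a i \<cdot> (l i \<cdot> z (Suc i)) = g a i \<cdot> y a (Suc i)"
      using cmp_assoc[OF z[of "Suc i"] l \<rho>[OF a]] \<rho>l[OF a]
        cmp_assoc[OF z[of "Suc i"] \<rho>[OF a] g[OF a]] \<rho>z[OF a] by simp
    then show "\<rho> a i \<cdot> z i = \<rho> a i \<cdot> add C (x i) (l i \<cdot> z (Suc i))"
      using cmp_add_right[OF x[of i] cmp_Hom[OF z[of "Suc i"] l] \<rho>[OF a]] \<rho>z[OF a] yi(2)[OF a, of i]
      by simp
  qed
  then have "is_solution L l X x z" unfolding is_solution_def using z by blast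
  moreover have "w = z" if w: "is_solution L l X x w" for w
  proof
    fix i
    have wi: "w i \<in> Hom C X (L i)" for i using w unfolding is_solution_def by blast
    show "w i = z i"
    proof (rule eqI[OF wi z])
      fix a assume a: "a \<in> A"
      have "(\<lambda>i. \<rho> a i \<cdot> w i) = y a"
        using ex1[OF a] is_solution_map[OF w x l \<rho>[OF a] g[OF a] \<rho>l[OF a]] y[OF a]
        by (metis (no_types, lifting))
      then have "\<rho> a i \<cdot> w i = y a i" by (rule fun_cong)
      then show "\<rho> a i \<cdot> w i = \<rho> a i \<cdot> z i" using \<rho>z[OF a] by simp
    qed
  qed
  ultimately show "\<exists>!y. is_solution L l X x y" by (rule ex1I)
qed

(* If J' \<le> J are subobjects of S whose bonds map J into J', then Q = S/J and Q' = S/J' are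
   inverse to each other up to a shift. *)
lemma uniquely_solvable_quotient:
  assumes S: "S \<in> ob (seq_cat C)"
    and Q: "is_quotient_seq S m Q b q" and Q': "is_quotient_seq S m' Q' b' q'"
    and m: "\<And>i. m i \<in> Hom C (J i) (obj S i)" and m': "\<And>i. m' i \<in> Hom C (J' i) (obj S i)"
    and qm': "\<And>i. q i \<cdot> m' i = zer C (J' i) (Q i)"
    and q'm: "\<And>i. q' i \<cdot> bond S i \<cdot> m (Suc i) = zer C (J (Suc i)) (Q' i)"
    and solv: "uniquely_solvable Q b"
  shows "uniquely_solvable Q' b'"
proof -
  note q = is_quotient_seqD[OF Q] and q' = is_quotient_seqD[OF Q']
  have f: "bond S i \<in> Hom C (obj S (Suc i)) (obj S i)" for i using S by (simp add: seq_ob_iff)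
  \<comment> \<open>\<open>qm'\<close> expresses that J' lies in J, which gives the projection u :
    S/J' -> S/J.\<close>
  have "\<forall>i. \<exists>u. u \<in> Hom C (Q' i) (Q i) \<and> u \<cdot> q' i = q i"
    using is_cokernel_desc[OF q'(1) m' q'(2) q(2) qm'] by blast
  from choice[OF this] obtain u where "\<forall>i. u i \<in> Hom C (Q' i) (Q i) \<and> u i \<cdot> q' i = q i" ..
  then have u: "u i \<in> Hom C (Q' i) (Q i)" "u i \<cdot> q' i = q i" for i by simp_all
  \<comment> \<open>\<open>q'm\<close> expresses that the bonds of S carry J into J', so they
    descend to maps from S/J one place higher to S/J'.\<close>
  have "\<forall>i. \<exists>g. g \<in> Hom C (Q (Suc i)) (Q' i) \<and> g \<cdot> q (Suc i) = q' i \<cdot> bond S i"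
    using is_cokernel_desc[OF q(1) m q(2) cmp_Hom[OF f q'(2)] q'm] by blast
  from choice[OF this] obtain g
    where "\<forall>i. g i \<in> Hom C (Q (Suc i)) (Q' i) \<and> g i \<cdot> q (Suc i) = q' i \<cdot> bond S i" ..
  then have g: "g i \<in> Hom C (Q (Suc i)) (Q' i)" "g i \<cdot> q (Suc i) = q' i \<cdot> bond S i" for i by simp_all
  show ?thesis
  proof (rule uniquely_solvable_shift[OF solv q(3) q'(3) u(1) g(1)])
    fix i
    show "u i \<cdot> g i = b i"
    proof (rule is_epiD[OF is_cokernel_epi[OF q(1)] q(2) cmp_Hom[OF g(1) u(1)] q(3)])
      show "u i \<cdot> g i \<cdot> q (Suc i) = b i \<cdot> q (Suc i)"
        using cmp_assoc[OF q(2) g(1) u(1)] g(2) cmp_assoc[OF f q'(2) u(1)] u(2) q(4) by simp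
    qed
    show "g i \<cdot> u (Suc i) = b' i"
    proof (rule is_epiD[OF is_cokernel_epi[OF q'(1)] q'(2) cmp_Hom[OF u(1) g(1)] q'(3)])
      show "g i \<cdot> u (Suc i) \<cdot> q' (Suc i) = b' i \<cdot> q' (Suc i)"
        using cmp_assoc[OF q'(2) u(1) g(1)] u(2) g(2) q'(4) by simp
    qed
  qed
qed

end

context abelian_category
begin

lemma quotient_seq_exists:
  assumes m: "m \<in> Hom (seq_cat C) J S"
  obtains Q b q where "is_quotient_seq S (level m) Q b q"
proof -
  note mi = seq_HomD(3)[OF m]
  have b: "bond J i \<in> Hom C (obj J (Suc i)) (obj J i)" "bond S i \<in> Hom C (obj S (Suc i)) (obj S i)" for i
    using seq_HomD(1,2)[OF m] by (simp_all add: seq_ob_iff)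
  have "\<forall>i. \<exists>q. is_cokernel C (level m i) q" using ex_cokernel HomD(1)[OF mi] by blast
  from choice[OF this] obtain q where q': "\<forall>i. is_cokernel C (level m i) (q i)" ..
  then have q: "is_cokernel C (level m i) (q i)" for i by blast
  define Q where "Q i = tgt C (q i)" for i
  have qi: "q i \<in> Hom C (obj S i) (Q i)" "q i \<cdot> level m i = zer C (obj J i) (Q i)" for i
    using is_cokernelD[OF q mi] unfolding Q_def by auto
  have "\<forall>i. \<exists>c. c \<in> Hom C (Q (Suc i)) (Q i) \<and> c \<cdot> q (Suc i) = q i \<cdot> bond S i"
  proof
    fix i
    have "q i \<cdot> bond S i \<cdot> level m (Suc i) = q i \<cdot> level m i \<cdot> bond J i"
      using cmp_assoc[OF mi b(2) qi(1)] cmp_assoc[OF b(1) mi qi(1)] seq_HomD(4)[OF m, of i] by simp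
    also have "\<dots> = zer C (obj J (Suc i)) (Q i)" using qi(2) cmp_zer_left[OF b(1) HomD(5)[OF qi(1)]] by simp
    finally show "\<exists>c. c \<in> Hom C (Q (Suc i)) (Q i) \<and> c \<cdot> q (Suc i) = q i \<cdot> bond S i"
      using is_cokernel_desc[OF q mi qi(1) cmp_Hom[OF b(2) qi(1)]] by blast
  qed
  from choice[OF this] obtain c
    where "\<forall>i. c i \<in> Hom C (Q (Suc i)) (Q i) \<and> c i \<cdot> q (Suc i) = q i \<cdot> bond S i" ..
  then have "is_quotient_seq S (level m) Q c q" unfolding is_quotient_seq_def using q qi by simp
  then show ?thesis using that by blast
qed

end

section \<open>The image tower\<close>

context category
begin

lemma is_mono_idn: "A \<in> ob C \<Longrightarrow> is_mono C (idn C A)"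
  unfolding is_mono_def using HomD[OF idn_Hom] idn_left by (metis (no_types, lifting))

lemma is_mono_cmp:
  assumes f: "is_mono C f" "f \<in> Hom C A B" and g: "is_mono C g" "g \<in> Hom C B D"
  shows "is_mono C (g \<cdot> f)"
  unfolding is_mono_def
proof (intro conjI ballI impI)
  have gf: "g \<cdot> f \<in> Hom C A D" using cmp_Hom[OF f(2) g(2)] .
  show "g \<cdot> f \<in> arr C" using HomD[OF gf] by blast
  fix X h k assume "h \<in> Hom C X (src C (g \<cdot> f))" and "k \<in> Hom C X (src C (g \<cdot> f))"
    and eq: "g \<cdot> f \<cdot> h = g \<cdot> f \<cdot> k"
  then have h: "h \<in> Hom C X A" and k: "k \<in> Hom C X A" using HomD[OF gf] by simp_all
  have "g \<cdot> (f \<cdot> h) = g \<cdot> (f \<cdot> k)"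
    using eq cmp_assoc[OF h f(2) g(2)] cmp_assoc[OF k f(2) g(2)] by simp
  then show "h = k" using is_monoD[OF g cmp_Hom[OF h f(2)] cmp_Hom[OF k f(2)]] is_monoD[OF f h k] by blast
qed

end

locale image_tower = abelian_category C for C :: "('o, 'm) cat" (structure) +
  fixes U :: "'u::wellorder itself" and S :: "('o, 'm) invseq"
    and J :: "'u \<Rightarrow> ('o, 'm) invseq" and t :: "'u \<Rightarrow> 'u \<Rightarrow> ('o, 'm) invseq_map"
  assumes univ: "universe_type U" and tower: "is_image_tower C S J t"
begin

abbreviation T :: "'u \<Rightarrow> 'u \<Rightarrow> nat \<Rightarrow> 'm" where "T \<alpha> \<beta> \<equiv> level (t \<alpha> \<beta>)"
abbreviation Ob :: "'u \<Rightarrow> nat \<Rightarrow> 'o" where "Ob \<alpha> \<equiv> obj (J \<alpha>)"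

lemma J_ob: "J \<alpha> \<in> ob (seq_cat C)"
  using tower by (simp add: is_image_tower_def)

lemma J_zero: "J zero_ord = S"
  using tower by (simp add: is_image_tower_def)

lemma t_Hom: "\<alpha> \<le> \<beta> \<Longrightarrow> t \<alpha> \<beta> \<in> Hom (seq_cat C) (J \<beta>) (J \<alpha>)"
  using tower by (simp add: is_image_tower_def)

lemma J_bond: "bond (J \<alpha>) i \<in> Hom C (Ob \<alpha> (Suc i)) (Ob \<alpha> i)"
  using J_ob by (simp add: seq_ob_iff)

lemma S_bond: "bond S i \<in> Hom C (obj S (Suc i)) (obj S i)"
  using J_bond[of zero_ord] by (simp add: J_zero)

lemma S_ob: "S \<in> ob (seq_cat C)"
  using J_ob[of zero_ord] by (simp add: J_zero)

lemma T_Hom: "\<alpha> \<le> \<beta> \<Longrightarrow> T \<alpha> \<beta> i \<in> Hom C (Ob \<beta> i) (Ob \<alpha> i)"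
  using seq_HomD(3)[OF t_Hom] .

lemma T_bond: "\<alpha> \<le> \<beta> \<Longrightarrow> T \<alpha> \<beta> i \<cdot> bond (J \<beta>) i = bond (J \<alpha>) i \<cdot> T \<alpha> \<beta> (Suc i)"
  using seq_HomD(4)[OF t_Hom] .

lemma T_idn: "T \<alpha> \<alpha> i = idn C (Ob \<alpha> i)"
  using tower by (simp add: is_image_tower_def)

lemma T_cmp:
  assumes "\<alpha> \<le> \<beta>" "\<beta> \<le> \<gamma>"
  shows "T \<alpha> \<beta> i \<cdot> T \<beta> \<gamma> i = T \<alpha> \<gamma> i"
proof -
  have "t \<alpha> \<beta> \<cdot>\<^bsub>seq_cat C\<^esub> t \<beta> \<gamma> = t \<alpha> \<gamma>"
    using tower assms unfolding is_image_tower_def by blast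
  then show ?thesis using seq_cat_simps(4)[of C "t \<alpha> \<beta>" "t \<beta> \<gamma>" i] by simp
qed

lemma T_image: "is_image C (bond (J \<alpha>) i) (T \<alpha> (succ_ord \<alpha>) i)"
  using tower by (simp add: is_image_tower_def is_image_seq_def)

lemma T_limit:
  assumes "limit_ord \<kappa>"
  shows "is_inverse_limit C {..<\<kappa>} (\<lambda>\<alpha>. Ob \<alpha> i) (\<lambda>\<alpha> \<beta>. T \<alpha> \<beta> i) (Ob \<kappa> i) (\<lambda>\<alpha>. T \<alpha> \<kappa> i)"
proof -
  have "is_inverse_limit (seq_cat C) {..<\<kappa>} J t (J \<kappa>) (\<lambda>\<alpha>. t \<alpha> \<kappa>)"
    using tower assms by (simp add: is_image_tower_def)
  then show ?thesis by (rule level_limit) (simp_all add: t_Hom J_ob)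
qed

lemma T0_Hom: "T zero_ord \<beta> i \<in> Hom C (Ob \<beta> i) (obj S i)"
  using T_Hom[OF zero_ord_le, of \<beta> i] by (simp add: J_zero)

lemma T0_bond: "T zero_ord \<beta> i \<cdot> bond (J \<beta>) i = bond S i \<cdot> T zero_ord \<beta> (Suc i)"
  using T_bond[OF zero_ord_le, of \<beta> i] by (simp add: J_zero)

lemma succ_greater: "\<alpha> \<le> succ_ord (\<alpha> :: 'u)"
  using succ_ord_greater[OF univ, of \<alpha>] by (auto simp: order_le_less)

text \<open>Transfinite induction: image inclusions are kernels, hence monic. At a limit the
  projections to the earlier stages are jointly monic, and each is followed by a map already known
  to be monic.\<close>

lemma T0_mono: "is_mono C (T zero_ord \<beta> i)"
proof (induction \<beta> rule: less_induct)
  case (less \<beta>)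
  from univ show ?case
  proof (cases rule: ord_cases[where \<beta> = \<beta>])
    case zero
    then show ?thesis using is_mono_idn[OF HomD(4)[OF T0_Hom]] by (simp add: T_idn)
  next
    case (succ \<alpha>)
    have "is_mono C (T \<alpha> (succ_ord \<alpha>) i)" using T_image[of \<alpha> i] is_kernel_mono unfolding is_image_def by blast
    from is_mono_cmp[OF this T_Hom[OF succ_greater] less[OF succ(1)] T0_Hom]
    show ?thesis using T_cmp[OF zero_ord_le succ_greater] succ(2) by simp
  next
    case limit
    show ?thesis unfolding is_mono_def
    proof (intro conjI ballI impI)
      show "T zero_ord \<beta> i \<in> arr C" by (rule HomD[OF T0_Hom])
      fix X g h assume "g \<in> Hom C X (src C (T zero_ord \<beta> i))" and "h \<in> Hom C X (src C (T zero_ord \<beta> i))"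
        and eq: "T zero_ord \<beta> i \<cdot> g = T zero_ord \<beta> i \<cdot> h"
      then have g: "g \<in> Hom C X (Ob \<beta> i)" and h: "h \<in> Hom C X (Ob \<beta> i)"
        using HomD[OF T0_Hom[of \<beta> i]] by simp_all
      show "g = h"
      proof (rule inverse_limit_eqI[OF T_limit[OF limit] g h])
        fix \<alpha> assume "\<alpha> \<in> {..<\<beta>}"
        then have \<alpha>: "\<alpha> < \<beta>" by simp
        then have le: "\<alpha> \<le> \<beta>" by (simp add: order_le_less)
        have "T zero_ord \<alpha> i \<cdot> (T \<alpha> \<beta> i \<cdot> k) = T zero_ord \<beta> i \<cdot> k" if "k \<in> Hom C X (Ob \<beta> i)" for k
          using cmp_assoc[OF that T_Hom[OF le] T0_Hom] T_cmp[OF zero_ord_le le] by simp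
        then show "T \<alpha> \<beta> i \<cdot> g = T \<alpha> \<beta> i \<cdot> h"
          using is_monoD[OF less[OF \<alpha>] T0_Hom cmp_Hom[OF g T_Hom[OF le]] cmp_Hom[OF h T_Hom[OF le]]]
            g h eq by simp
      qed (rule T_Hom)
    qed
  qed
qed

lemma T0_monoD:
  "g \<in> Hom C X (Ob \<beta> i) \<Longrightarrow> h \<in> Hom C X (Ob \<beta> i) \<Longrightarrow> T zero_ord \<beta> i \<cdot> g = T zero_ord \<beta> i \<cdot> h \<Longrightarrow> g = h"
  using is_monoD[OF T0_mono T0_Hom] .

text \<open>At a limit ordinal the tower is the intersection of its earlier stages: the
  factorizations of \<open>k\<close> are compatible because the inclusions into S are monic.\<close>

lemma limit_factor:
  assumes \<kappa>: "limit_ord \<kappa>" and X: "X \<in> ob C"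
    and w: "\<And>\<beta>. \<beta> < \<kappa> \<Longrightarrow> \<exists>w. w \<in> Hom C X (Ob \<beta> i) \<and> T zero_ord \<beta> i \<cdot> w = k"
  shows "\<exists>w. w \<in> Hom C X (Ob \<kappa> i) \<and> T zero_ord \<kappa> i \<cdot> w = k"
proof -
  have "\<forall>\<beta>\<in>{..<\<kappa>}. \<exists>w. w \<in> Hom C X (Ob \<beta> i) \<and> T zero_ord \<beta> i \<cdot> w = k" using w by simp
  from bchoice[OF this] obtain w
    where w': "\<forall>\<beta>\<in>{..<\<kappa>}. w \<beta> \<in> Hom C X (Ob \<beta> i) \<and> T zero_ord \<beta> i \<cdot> w \<beta> = k" ..
  then have w: "w \<beta> \<in> Hom C X (Ob \<beta> i)" "T zero_ord \<beta> i \<cdot> w \<beta> = k" if "\<beta> \<in> {..<\<kappa>}" for \<beta>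
    using that by simp_all
  have "T \<alpha> \<beta> i \<cdot> w \<beta> = w \<alpha>" if a: "\<alpha> \<in> {..<\<kappa>}" and b: "\<beta> \<in> {..<\<kappa>}" and le: "\<alpha> \<le> \<beta>" for \<alpha> \<beta>
    by (rule T0_monoD[OF cmp_Hom[OF w(1)[OF b] T_Hom[OF le]] w(1)[OF a]])
      (use cmp_assoc[OF w(1)[OF b] T_Hom[OF le] T0_Hom] T_cmp[OF zero_ord_le le] w(2) a b in simp)
  from ex1_implies_ex[OF inverse_limit_ex1[OF T_limit[OF \<kappa>] X w(1) this]]
  obtain h where h: "h \<in> Hom C X (Ob \<kappa> i) \<and> (\<forall>\<beta>\<in>{..<\<kappa>}. T \<beta> \<kappa> i \<cdot> h = w \<beta>)" ..
  \<comment> \<open>The composite is computed through any stage below \<kappa>; one exists since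
    limit ordinals are nonzero by definition.\<close>
  obtain \<beta> where \<beta>: "\<beta> < \<kappa>" using \<kappa> by (auto simp: limit_ord_def)
  then have le: "\<beta> \<le> \<kappa>" by (simp add: order_le_less)
  have "T zero_ord \<kappa> i \<cdot> h = T zero_ord \<beta> i \<cdot> (T \<beta> \<kappa> i \<cdot> h)"
    using cmp_assoc[OF conjunct1[OF h] T_Hom[OF le] T0_Hom] T_cmp[OF zero_ord_le le] by simp
  also have "\<dots> = k" using h \<beta> w(2) by simp
  finally show ?thesis using h by blast
qed

text \<open>One inclusion of subobjects of S; applied in both directions it identifies two towers
  over the same S. This is required because every instance of completeness comes with its own
  tower.\<close>

lemma compare:
  assumes "image_tower C U S J' t'"
  shows "\<exists>\<phi>. \<phi> \<in> Hom C (Ob \<beta> i) (obj (J' \<beta>) i) \<and> level (t' zero_ord \<beta>) i \<cdot> \<phi> = T zero_ord \<beta> i"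
proof -
  interpret T': image_tower C U S J' t' by fact
  show ?thesis
  proof (induction \<beta> arbitrary: i rule: less_induct)
    case (less \<beta>)
    from univ show ?case
    proof (cases rule: ord_cases[where \<beta> = \<beta>])
      case zero
      have "T zero_ord zero_ord i \<in> Hom C (obj S i) (obj S i)"
        using T0_Hom[of zero_ord i] by (simp add: J_zero)
      then show ?thesis using idn_left[of "T zero_ord zero_ord i"] zero
        by (intro exI[of _ "T zero_ord zero_ord i"]) (simp add: J_zero T'.J_zero T'.T_idn)
    next
      case (succ \<alpha>)
      let ?s = "succ_ord \<alpha>"
      obtain \<phi> where \<phi>: "\<phi> \<in> Hom C (Ob \<alpha> i) (T'.Ob \<alpha> i)" "T'.T zero_ord \<alpha> i \<cdot> \<phi> = T zero_ord \<alpha> i"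
        using less[OF succ(1), of i] by blast
      obtain \<psi> where \<psi>: "\<psi> \<in> Hom C (Ob \<alpha> (Suc i)) (T'.Ob \<alpha> (Suc i))"
        "T'.T zero_ord \<alpha> (Suc i) \<cdot> \<psi> = T zero_ord \<alpha> (Suc i)"
        using less[OF succ(1), of "Suc i"] by blast
      \<comment> \<open>The comparison maps at neighbouring places commute with the bonds, since
        this holds after the monic inclusion into S.\<close>
      have nat: "\<phi> \<cdot> bond (J \<alpha>) i = bond (J' \<alpha>) i \<cdot> \<psi>"
      proof (rule T'.T0_monoD[OF cmp_Hom[OF J_bond \<phi>(1)] cmp_Hom[OF \<psi>(1) T'.J_bond]])
        have "T'.T zero_ord \<alpha> i \<cdot> (\<phi> \<cdot> bond (J \<alpha>) i) = bond S i \<cdot> T zero_ord \<alpha> (Suc i)"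
          using cmp_assoc[OF J_bond \<phi>(1) T'.T0_Hom] \<phi>(2) T0_bond by simp
        also have "\<dots> = T'.T zero_ord \<alpha> i \<cdot> (bond (J' \<alpha>) i \<cdot> \<psi>)"
          using cmp_assoc[OF \<psi>(1) T'.T0_Hom S_bond] \<psi>(2) T'.T0_bond
            cmp_assoc[OF \<psi>(1) T'.J_bond T'.T0_Hom] by simp
        finally show "T'.T zero_ord \<alpha> i \<cdot> (\<phi> \<cdot> bond (J \<alpha>) i) = T'.T zero_ord \<alpha> i \<cdot> (bond (J' \<alpha>) i \<cdot> \<psi>)" .
      qed
      obtain q where q: "is_cokernel C (bond (J \<alpha>) i) q" "is_kernel C q (T \<alpha> ?s i)"
        using T_image[of \<alpha> i] unfolding is_image_def by blast
      obtain q' where q': "is_cokernel C (bond (J' \<alpha>) i) q'" "is_kernel C q' (T'.T \<alpha> ?s i)"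
        using T'.T_image[of \<alpha> i] unfolding is_image_def by blast
      note qH = is_cokernelD[OF q(1) J_bond] and qH' = is_cokernelD[OF q'(1) T'.J_bond]
      note q'\<phi> = cmp_Hom[OF \<phi>(1) qH'(1)]
      note m = T_Hom[OF succ_greater[of \<alpha>], of i] and m' = T'.T_Hom[OF T'.succ_greater[of \<alpha>], of i]
      note Q' = HomD(5)[OF qH'(1)]
      \<comment> \<open>Commuting with the bonds induces a map between their cokernels, and thereby
        a map between the images, which are the kernels of \<open>q\<close> and
        \<open>q'\<close>.\<close>
      have "q' \<cdot> \<phi> \<cdot> bond (J \<alpha>) i = zer C (Ob \<alpha> (Suc i)) (tgt C q')"
        using cmp_assoc[OF J_bond \<phi>(1) qH'(1)] nat cmp_assoc[OF \<psi>(1) T'.J_bond qH'(1)] qH'(2)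
          cmp_zer_left[OF \<psi>(1) Q'] by simp
      then obtain w where w: "w \<in> Hom C (tgt C q) (tgt C q')" "w \<cdot> q = q' \<cdot> \<phi>"
        using is_cokernel_desc[OF q(1) J_bond qH(1) q'\<phi>] by blast
      have qm: "q \<cdot> T \<alpha> ?s i = zer C (Ob ?s i) (tgt C q)"
        using is_kernelD[OF q(2) qH(1)] HomD[OF m] by simp
      have "q' \<cdot> (\<phi> \<cdot> T \<alpha> ?s i) = zer C (Ob ?s i) (tgt C q')"
        using cmp_assoc[OF m \<phi>(1) qH'(1)] w(2) cmp_assoc[OF m qH(1) w(1)] qm
          cmp_zer_right[OF w(1) HomD(4)[OF m]] by simp
      then obtain \<chi> where \<chi>: "\<chi> \<in> Hom C (Ob ?s i) (T'.Ob ?s i)" "T'.T \<alpha> ?s i \<cdot> \<chi> = \<phi> \<cdot> T \<alpha> ?s i"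
        using is_kernel_lift[OF q'(2) qH'(1) m' cmp_Hom[OF m \<phi>(1)]] by blast
      have "T'.T zero_ord ?s i \<cdot> \<chi> = T'.T zero_ord \<alpha> i \<cdot> (\<phi> \<cdot> T \<alpha> ?s i)"
        using cmp_assoc[OF \<chi>(1) m' T'.T0_Hom] \<chi>(2) T'.T_cmp[OF zero_ord_le T'.succ_greater] by simp
      also have "\<dots> = T zero_ord ?s i"
        using cmp_assoc[OF m \<phi>(1) T'.T0_Hom] \<phi>(2) T_cmp[OF zero_ord_le succ_greater] by simp
      finally show ?thesis using \<chi>(1) succ(2) by blast
    next
      case limit
      show ?thesis
      proof (rule T'.limit_factor[OF limit HomD(4)[OF T0_Hom]])
        fix \<alpha> assume \<alpha>: "\<alpha> < \<beta>"
        then have le: "\<alpha> \<le> \<beta>" by (simp add: order_le_less)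
        obtain \<phi> where \<phi>: "\<phi> \<in> Hom C (Ob \<alpha> i) (T'.Ob \<alpha> i)" "T'.T zero_ord \<alpha> i \<cdot> \<phi> = T zero_ord \<alpha> i"
          using less[OF \<alpha>, of i] by blast
        have "T'.T zero_ord \<alpha> i \<cdot> (\<phi> \<cdot> T \<alpha> \<beta> i) = T zero_ord \<beta> i"
          using cmp_assoc[OF T_Hom[OF le] \<phi>(1) T'.T0_Hom] \<phi>(2) T_cmp[OF zero_ord_le le] by simp
        then show "\<exists>w. w \<in> Hom C (Ob \<beta> i) (T'.Ob \<alpha> i) \<and> T'.T zero_ord \<alpha> i \<cdot> w = T zero_ord \<beta> i"
          using cmp_Hom[OF T_Hom[OF le] \<phi>(1)] by blast
      qed
    qed
  qed
qed

section \<open>Unique solvability on the quotients of S by the stages of a tower\<close>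

lemma quotient_zero_solvable:
  assumes "is_quotient_seq S (T zero_ord zero_ord) Q b q"
  shows "uniquely_solvable Q b"
proof -
  note q = is_quotient_seqD[OF assms]
  \<comment> \<open>\<open>q i\<close> is a cokernel of an identity, so it is both epi and zero and
    its target is a zero object. There every equation between parallel maps holds, and each x solves
    its own system.\<close>
  have idn_zer: "idn C (Q i) = zer C (Q i) (Q i)" for i
  proof -
    have S: "obj S i \<in> ob C" using S_ob by (simp add: seq_ob_iff)
    note Q = HomD(5)[OF q(2)[of i]]
    have i0: "T zero_ord zero_ord i = idn C (obj S i)" by (simp add: T_idn J_zero)
    have "q i = zer C (obj S i) (Q i)"
      using is_cokernelD(2)[OF q(1)[of i]] i0 idn_Hom[OF S] idn_right[OF q(2)[of i]] HomD[OF q(2)[of i]] by metis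
    then have "idn C (Q i) \<cdot> q i = zer C (Q i) (Q i) \<cdot> q i"
      using cmp_zer_right[OF idn_Hom[OF Q] S] cmp_zer_left[OF q(2)[of i] Q] by simp
    then show ?thesis
      using is_epiD[OF is_cokernel_epi[OF q(1)] q(2) idn_Hom[OF Q] zer_Hom[OF Q Q]] by blast
  qed
  then have zero: "is_zero C (Q i)" for i using is_zeroI HomD(5)[OF q(2)[of i]] by blast
  show ?thesis unfolding uniquely_solvable_def
  proof (intro ballI allI impI)
    fix X x assume X: "X \<in> ob C" and "\<forall>i. x i \<in> Hom C X (Q i)"
    then have x: "x i \<in> Hom C X (Q i)" for i by simp
    have "x i = add C (x i) (b i \<cdot> x (Suc i))" for i
      using zero_target_unique[OF zero x add_Hom[OF x cmp_Hom[OF x q(3)]]] .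
    then have "is_solution Q b X x x" unfolding is_solution_def using x by blast
    moreover have "y = x" if "is_solution Q b X x y" for y
    proof
      fix i
      show "y i = x i"
        using that zero_target_unique[OF zero _ x, of "y i" i] unfolding is_solution_def by blast
    qed
    ultimately show "\<exists>!y. is_solution Q b X x y" by (rule ex1I)
  qed
qed

text \<open>The quotient criterion applies with J = I^\<alpha>(S) and J' = I(J): by construction of
  the image, the bonds of S carry J into J'.\<close>

lemma quotient_succ_solvable:
  assumes Q: "is_quotient_seq S (T zero_ord \<alpha>) Q b q" and solv: "uniquely_solvable Q b"
    and Q': "is_quotient_seq S (T zero_ord (succ_ord \<alpha>)) Q' b' q'"
  shows "uniquely_solvable Q' b'"
proof (rule uniquely_solvable_quotient[OF S_ob Q Q' T0_Hom T0_Hom _ _ solv])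
  note q = is_quotient_seqD[OF Q] and q' = is_quotient_seqD[OF Q']
  note m = T_Hom[OF succ_greater[of \<alpha>]]
  let ?s = "succ_ord \<alpha>"
  fix i
  have "q i \<cdot> T zero_ord ?s i = (q i \<cdot> T zero_ord \<alpha> i) \<cdot> T \<alpha> ?s i"
    using cmp_assoc[OF m T0_Hom q(2)] T_cmp[OF zero_ord_le succ_greater] by simp
  also have "\<dots> = zer C (Ob ?s i) (Q i)"
    using is_cokernelD(2)[OF q(1)[of i] T0_Hom] HomD[OF q(2)[of i]] cmp_zer_left[OF m] by simp
  finally show "q i \<cdot> T zero_ord ?s i = zer C (Ob ?s i) (Q i)" .
  obtain c where c: "is_cokernel C (bond (J \<alpha>) i) c" "is_kernel C c (T \<alpha> ?s i)"
    using T_image[of \<alpha> i] unfolding is_image_def by blast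
  note cH = is_cokernelD[OF c(1) J_bond]
  \<comment> \<open>The bond of I^\<alpha>(S), corestricted to its image.\<close>
  obtain r where r: "r \<in> Hom C (Ob \<alpha> (Suc i)) (Ob ?s i)" "T \<alpha> ?s i \<cdot> r = bond (J \<alpha>) i"
    using is_kernel_lift[OF c(2) cH(1) m J_bond cH(2)] .
  have "bond S i \<cdot> T zero_ord \<alpha> (Suc i) = T zero_ord ?s i \<cdot> r"
    using T0_bond[of \<alpha> i] r(2) cmp_assoc[OF r(1) m T0_Hom] T_cmp[OF zero_ord_le succ_greater] by simp
  then have "q' i \<cdot> bond S i \<cdot> T zero_ord \<alpha> (Suc i) = (q' i \<cdot> T zero_ord ?s i) \<cdot> r"
    using cmp_assoc[OF T0_Hom S_bond q'(2)] cmp_assoc[OF r(1) T0_Hom q'(2)] by simp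
  also have "\<dots> = zer C (Ob \<alpha> (Suc i)) (Q' i)"
    using is_cokernelD(2)[OF q'(1)[of i] T0_Hom] HomD[OF q'(2)[of i]] cmp_zer_left[OF r(1)] by simp
  finally show "q' i \<cdot> bond S i \<cdot> T zero_ord \<alpha> (Suc i) = zer C (Ob \<alpha> (Suc i)) (Q' i)" .
qed

end

context image_tower
begin

text \<open>Completeness presents the limit L of the quotients as S modulo the kernel of
  \<open>h\<close>, and L is uniquely solvable by induction. That kernel is the intersection of the
  earlier stages, that is, I^\<kappa>(S). The tower inside \<open>is_complete\<close> may differ
  from the present one, so \<open>IH\<close> ranges over all towers.\<close>

lemma quotient_limit_solvable:
  assumes \<kappa>: "limit_ord \<kappa>" and complete: "is_complete C S \<kappa>"
    and IH: "\<And>\<beta> J t Q b q. \<beta> < \<kappa> \<Longrightarrow> image_tower C U S J t \<Longrightarrow>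
      is_quotient_seq S (level (t zero_ord \<beta>)) Q b q \<Longrightarrow> uniquely_solvable Q b"
    and Q: "is_quotient_seq S (T zero_ord \<kappa>) Q b q"
  shows "uniquely_solvable Q b"
proof -
  from complete obtain J' t' Q' p u L \<rho> h where tower': "is_image_tower C S J' t'"
    and p: "\<forall>\<beta><\<kappa>. p \<beta> \<in> Hom (seq_cat C) S (Q' \<beta>) \<and> is_cokernel (seq_cat C) (t' zero_ord \<beta>) (p \<beta>)"
    and u: "\<forall>\<alpha> \<beta>. \<alpha> \<le> \<beta> \<and> \<beta> < \<kappa> \<longrightarrow>
           u \<alpha> \<beta> \<in> Hom (seq_cat C) (Q' \<beta>) (Q' \<alpha>) \<and> u \<alpha> \<beta> \<cdot>\<^bsub>seq_cat C\<^esub> p \<beta> = p \<alpha>"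
    and L: "is_inverse_limit (seq_cat C) {..<\<kappa>} Q' u L \<rho>"
    and h: "h \<in> Hom (seq_cat C) S L" "\<forall>\<beta><\<kappa>. \<rho> \<beta> \<cdot>\<^bsub>seq_cat C\<^esub> h = p \<beta>" "is_epi (seq_cat C) h"
    unfolding is_complete_def by (elim exE conjE) rule
  interpret T': image_tower C U S J' t'
    using univ tower' by unfold_locales
  have p: "p \<beta> \<in> Hom (seq_cat C) S (Q' \<beta>)" "is_cokernel (seq_cat C) (t' zero_ord \<beta>) (p \<beta>)"
    if "\<beta> < \<kappa>" for \<beta>
    using p that by blast+
  have t'0: "t' zero_ord \<beta> \<in> Hom (seq_cat C) (J' \<beta>) S" for \<beta>
    using T'.t_Hom[OF zero_ord_le, of \<beta>] by (simp add: T'.J_zero)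
  have pc: "is_cokernel C (T'.T zero_ord \<beta> i) (level (p \<beta>) i)" if "\<beta> < \<kappa>" for \<beta> i
    using level_cokernel[OF p(2)[OF that] t'0 p(1)[OF that]] .
  have u: "u \<alpha> \<beta> \<in> Hom (seq_cat C) (Q' \<beta>) (Q' \<alpha>)" if "\<alpha> \<in> {..<\<kappa>}" "\<beta> \<in> {..<\<kappa>}" "\<alpha> \<le> \<beta>" for \<alpha> \<beta>
    using u that by simp
  have Q'ob: "Q' \<beta> \<in> ob (seq_cat C)" if "\<beta> \<in> {..<\<kappa>}" for \<beta>
    using seq_HomD(2)[OF p(1)] that by simp
  have \<rho>: "\<rho> \<beta> \<in> Hom (seq_cat C) L (Q' \<beta>)" if "\<beta> \<in> {..<\<kappa>}" for \<beta>
    using L that by (simp add: is_inverse_limit_def)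
  have \<rho>h: "level (\<rho> \<beta>) i \<cdot> level h i = level (p \<beta>) i" if "\<beta> \<in> {..<\<kappa>}" for \<beta> i
    using h(2) that seq_cat_simps(4)[of C "\<rho> \<beta>" h i] by simp
  have Ll: "is_inverse_limit C {..<\<kappa>} (\<lambda>\<beta>. obj (Q' \<beta>) i) (\<lambda>\<alpha> \<beta>. level (u \<alpha> \<beta>) i) (obj L i)
    (\<lambda>\<beta>. level (\<rho> \<beta>) i)" for i
    by (rule level_limit[OF L]) (fact u, fact Q'ob)
  have Lb: "bond L i \<in> Hom C (obj L (Suc i)) (obj L i)" for i
    using seq_HomD(2)[OF h(1)] by (simp add: seq_ob_iff)
  have Q'b: "bond (Q' \<beta>) i \<in> Hom C (obj (Q' \<beta>) (Suc i)) (obj (Q' \<beta>) i)" if "\<beta> \<in> {..<\<kappa>}" for \<beta> i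
    using Q'ob[OF that] by (simp add: seq_ob_iff)
  have solv: "uniquely_solvable (obj L) (bond L)"
  proof (rule uniquely_solvable_limit[where D = "\<lambda>\<beta>. obj (Q' \<beta>)" and g = "\<lambda>\<beta>. bond (Q' \<beta>)"
        and u = "\<lambda>\<alpha> \<beta>. level (u \<alpha> \<beta>)" and \<rho> = "\<lambda>\<beta>. level (\<rho> \<beta>)" and A = "{..<\<kappa>}"])
    fix \<beta> assume b: "\<beta> \<in> {..<\<kappa>}"
    then have \<beta>: "\<beta> < \<kappa>" by simp
    have "is_quotient_seq S (T'.T zero_ord \<beta>) (obj (Q' \<beta>)) (bond (Q' \<beta>)) (level (p \<beta>))"
      unfolding is_quotient_seq_def
      using pc[OF \<beta>] seq_HomD(3,4)[OF p(1)[OF \<beta>]] Q'b[OF b] by simp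
    then show "uniquely_solvable (obj (Q' \<beta>)) (bond (Q' \<beta>))"
      using IH[OF \<beta> T'.image_tower_axioms] by blast
  qed (fact Ll, fact seq_HomD(3)[OF u], fact Q'b, fact seq_HomD(4)[OF u], fact Lb, fact seq_HomD(4)[OF \<rho>])
  note hi = seq_HomD(3)[OF h(1)] and h_epi = level_epi[OF h(3,1)]
  \<comment> \<open>Since \<open>h\<close> is epi at every place, it is the cokernel of these
    separately chosen kernels.\<close>
  have "\<forall>i. \<exists>k. is_kernel C (level h i) k" using ex_kernel HomD(1)[OF hi] by blast
  from choice[OF this] obtain k where "\<forall>i. is_kernel C (level h i) (k i)" ..
  then have k: "is_kernel C (level h i) (k i)" for i by blast
  note kH = is_kernelD[OF k hi]
  have L_quot: "is_quotient_seq S k (obj L) (bond L) (level h)"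
    unfolding is_quotient_seq_def
    using cokernel_of_kernel[OF h_epi hi k] hi Lb seq_HomD(4)[OF h(1)] by simp
  show ?thesis
  \<comment> \<open>Here J is the kernel of \<open>h\<close> and J' is I^\<kappa>(S), equal as
    subobjects. One inclusion gives the first condition; the other, together with the fact that
    I^\<kappa>(S) is closed under the bonds, gives the second.\<close>
  proof (rule uniquely_solvable_quotient[OF S_ob L_quot Q kH(1) T0_Hom _ _ solv])
    note q = is_quotient_seqD[OF Q]
    fix i
    show "level h i \<cdot> T zero_ord \<kappa> i = zer C (Ob \<kappa> i) (obj L i)"
    proof (rule inverse_limit_eqI[OF Ll cmp_Hom[OF T0_Hom hi] zer_Hom[OF HomD(4)[OF T0_Hom] HomD(5)[OF hi]]])
      fix \<beta> assume b: "\<beta> \<in> {..<\<kappa>}"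
      then have \<beta>: "\<beta> < \<kappa>" by simp
      then have le: "\<beta> \<le> \<kappa>" by (simp add: order_le_less)
      note pi = seq_HomD(3)[OF p(1)[OF \<beta>], of i] and \<rho>i = seq_HomD(3)[OF \<rho>[OF b], of i]
      obtain \<phi> where \<phi>: "\<phi> \<in> Hom C (Ob \<beta> i) (T'.Ob \<beta> i)" "T'.T zero_ord \<beta> i \<cdot> \<phi> = T zero_ord \<beta> i"
        using compare[OF T'.image_tower_axioms] by blast
      note \<phi>T = cmp_Hom[OF T_Hom[OF le] \<phi>(1)]
      have "T zero_ord \<kappa> i = T'.T zero_ord \<beta> i \<cdot> (\<phi> \<cdot> T \<beta> \<kappa> i)"
        using T_cmp[OF zero_ord_le le] \<phi>(2) cmp_assoc[OF T_Hom[OF le] \<phi>(1) T'.T0_Hom] by simp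
      then have "level (p \<beta>) i \<cdot> T zero_ord \<kappa> i = zer C (Ob \<kappa> i) (obj (Q' \<beta>) i)"
        using cmp_assoc[OF \<phi>T T'.T0_Hom pi] is_cokernelD(2)[OF pc[OF \<beta>] T'.T0_Hom, of i] HomD[OF pi]
          cmp_zer_left[OF \<phi>T HomD(5)[OF pi]] by simp
      then show "level (\<rho> \<beta>) i \<cdot> (level h i \<cdot> T zero_ord \<kappa> i) =
          level (\<rho> \<beta>) i \<cdot> zer C (Ob \<kappa> i) (obj L i)"
        using cmp_assoc[OF T0_Hom hi \<rho>i] \<rho>h[OF b] cmp_zer_right[OF \<rho>i HomD(4)[OF T0_Hom]] by simp
    qed (rule seq_HomD(3)[OF u])
    let ?K = "src C (k (Suc i))"
    note K = HomD(4)[OF kH(1)]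
    \<comment> \<open>The kernel of \<open>h\<close> is killed by every projection to
      S/I^\<beta>(S), so it lies in each stage of the other tower, hence in each stage of this one
      and in their intersection.\<close>
    have "\<exists>w. w \<in> Hom C ?K (Ob \<kappa> (Suc i)) \<and> T zero_ord \<kappa> (Suc i) \<cdot> w = k (Suc i)"
    proof (rule limit_factor[OF \<kappa> K])
      fix \<beta> assume \<beta>: "\<beta> < \<kappa>"
      then have b: "\<beta> \<in> {..<\<kappa>}" by simp
      note pi = seq_HomD(3)[OF p(1)[OF \<beta>], of "Suc i"] and \<rho>i = seq_HomD(3)[OF \<rho>[OF b], of "Suc i"]
      have pk: "level (p \<beta>) (Suc i) \<cdot> k (Suc i) = zer C ?K (obj (Q' \<beta>) (Suc i))"
        using cmp_assoc[OF kH(1) hi \<rho>i] \<rho>h[OF b] kH(2)[of "Suc i"] cmp_zer_right[OF \<rho>i K] by simp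
      obtain v where v: "v \<in> Hom C ?K (T'.Ob \<beta> (Suc i))" "T'.T zero_ord \<beta> (Suc i) \<cdot> v = k (Suc i)"
        using is_kernel_lift[OF kernel_of_cokernel[OF T'.T0_mono T'.T0_Hom pc[OF \<beta>]] pi T'.T0_Hom kH(1) pk] .
      obtain \<phi> where \<phi>: "\<phi> \<in> Hom C (T'.Ob \<beta> (Suc i)) (Ob \<beta> (Suc i))"
        "T zero_ord \<beta> (Suc i) \<cdot> \<phi> = T'.T zero_ord \<beta> (Suc i)"
        using T'.compare[OF image_tower_axioms] by blast
      have "T zero_ord \<beta> (Suc i) \<cdot> (\<phi> \<cdot> v) = k (Suc i)"
        using cmp_assoc[OF v(1) \<phi>(1) T0_Hom] \<phi>(2) v(2) by simp
      then show "\<exists>w. w \<in> Hom C ?K (Ob \<beta> (Suc i)) \<and> T zero_ord \<beta> (Suc i) \<cdot> w = k (Suc i)"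
        using cmp_Hom[OF v(1) \<phi>(1)] by blast
    qed
    then obtain w where w: "w \<in> Hom C ?K (Ob \<kappa> (Suc i))" "T zero_ord \<kappa> (Suc i) \<cdot> w = k (Suc i)" by blast
    note q0 = is_cokernelD(2)[OF q(1)[of i] T0_Hom]
    note Jw = cmp_Hom[OF w(1) J_bond]
    have "q i \<cdot> bond S i \<cdot> k (Suc i) = (q i \<cdot> bond S i \<cdot> T zero_ord \<kappa> (Suc i)) \<cdot> w"
      using w(2) cmp_assoc[OF w(1) T0_Hom cmp_Hom[OF S_bond q(2)]] by simp
    also have "q i \<cdot> bond S i \<cdot> T zero_ord \<kappa> (Suc i) = q i \<cdot> T zero_ord \<kappa> i \<cdot> bond (J \<kappa>) i"
      using cmp_assoc[OF T0_Hom S_bond q(2)] T0_bond[of \<kappa> i] cmp_assoc[OF J_bond T0_Hom q(2)] by simp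
    also have "\<dots> = zer C (Ob \<kappa> (Suc i)) (Q i)"
      using q0 HomD[OF q(2)[of i]] cmp_zer_left[OF J_bond HomD(5)[OF q(2)]] by simp
    also have "\<dots> \<cdot> w = zer C ?K (Q i)" using cmp_zer_left[OF w(1) HomD(5)[OF q(2)]] .
    finally show "q i \<cdot> bond S i \<cdot> k (Suc i) = zer C ?K (Q i)" .
  qed
qed

end

context abelian_category
begin

text \<open>The induction generalizes over the tower and the quotient, since the limit case appeals
  to smaller ordinals in the tower supplied by completeness.\<close>

lemma quotient_solvable:
  assumes U: "universe_type (U :: 'u::wellorder itself)"
    and complete: "\<forall>\<kappa>::'u. limit_ord \<kappa> \<longrightarrow> is_complete C S \<kappa>"
    and tower: "image_tower C U S J t"
    and Q: "is_quotient_seq S (level (t zero_ord \<beta>)) Q b q"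
  shows "uniquely_solvable Q b"
  using tower Q
proof (induction \<beta> arbitrary: J t Q b q rule: less_induct)
  case (less \<beta>)
  interpret image_tower C U S J t by fact
  from U show ?case
  proof (cases rule: ord_cases[where \<beta> = \<beta>])
    case zero
    then show ?thesis using quotient_zero_solvable less.prems(2) by simp
  next
    case (succ \<alpha>)
    have "t zero_ord \<alpha> \<in> Hom (seq_cat C) (J \<alpha>) S"
      using t_Hom[OF zero_ord_le, of \<alpha>] by (simp add: J_zero)
    then obtain Q0 b0 q0 where Q0: "is_quotient_seq S (T zero_ord \<alpha>) Q0 b0 q0"
      by (rule quotient_seq_exists)
    show ?thesis
      using quotient_succ_solvable[OF Q0 less.IH[OF succ(1) less.prems(1) Q0]] less.prems(2) succ(2) by simp
  next
    case limit
    then have c: "is_complete C S \<beta>" using complete by blast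
    show ?thesis by (rule quotient_limit_solvable[OF limit c less.IH less.prems(2)])
  qed
qed

text \<open>A map g killing \<open>f\<close> factors through the cokernel of \<open>f\<close>, hence
  kills the image inclusion \<open>m\<close>, which is epi.\<close>

lemma image_epi:
  assumes m: "is_image C f m" "m \<in> Hom C I B" "is_epi C m" and f: "f \<in> Hom C A B"
  shows "is_epi C f"
  unfolding is_epi_iff[OF f]
proof (intro ballI impI)
  obtain q where q: "is_cokernel C f q" "is_kernel C q m" using m(1) unfolding is_image_def by blast
  note qH = is_cokernelD[OF q(1) f]
  fix X g assume X: "X \<in> ob C" and g: "g \<in> Hom C B X" and z: "g \<cdot> f = zer C A X"
  obtain u where u: "u \<in> Hom C (tgt C q) X" "u \<cdot> q = g" using is_cokernel_desc[OF q(1) f qH(1) g z] .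
  have "q \<cdot> m = zer C I (tgt C q)" using is_kernelD(2)[OF q(2) qH(1)] HomD[OF m(2)] by simp
  then have "g \<cdot> m = zer C I X"
    using cmp_assoc[OF m(2) qH(1) u(1)] u(2) cmp_zer_right[OF u(1) HomD(4)[OF m(2)]] by simp
  then show "g = zer C B X" using m(3) X g unfolding is_epi_iff[OF m(2)] by blast
qed

end

section \<open>Vanishing of the first derived limit\<close>

context exact_products_category
begin

(* The sets of those x : G -> \<Prod> S whose components factor through the tower at \<beta> decrease with \<beta>
   inside a small power set, so they cannot all be distinct. *)
lemma image_tower_stabilizes:
  assumes "image_tower C U S J t"
  shows "\<exists>\<alpha>. \<forall>i. is_epi C (bond (J \<alpha>) i)"
proof -
  interpret image_tower C U S J t by fact
  have So: "obj S i \<in> ob C" for i using S_ob by (simp add: seq_ob_iff)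
  obtain P \<pi> where P: "is_product C UNIV (obj S) P \<pi>"
    using small_product_exists[OF products small_nat, of UNIV "obj S"] So by blast
  have Pob: "P \<in> ob C" using P by (simp add: is_product_def)
  \<comment> \<open>One set for all places together, so that a single \<alpha> will serve every
    i.\<close>
  define E where "E \<beta> = {x \<in> Hom C G P. \<forall>i. \<exists>w\<in>Hom C G (Ob \<beta> i). T zero_ord \<beta> i \<cdot> w = \<pi> i \<cdot> x}" for \<beta>
  have E_mono: "E \<beta> \<subseteq> E \<alpha>" if le: "\<alpha> \<le> \<beta>" for \<alpha> \<beta>
  proof -
    have "\<exists>w'\<in>Hom C G (Ob \<alpha> i). T zero_ord \<alpha> i \<cdot> w' = x"
      if "w \<in> Hom C G (Ob \<beta> i)" "T zero_ord \<beta> i \<cdot> w = x" for w x i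
      using cmp_assoc[OF that(1) T_Hom[OF le] T0_Hom] T_cmp[OF zero_ord_le le, of i] that(2)
        cmp_Hom[OF that(1) T_Hom[OF le]] by auto
    then show ?thesis unfolding E_def by blast
  qed
  have "small U (Pow (Hom C G P))" by (rule small_Pow[OF universe small_Hom[OF G_ob Pob]])
  moreover have "range E \<subseteq> Pow (Hom C G P)" unfolding E_def by blast
  \<comment> \<open>An injective \<open>E\<close> would embed all of \<open>'u\<close> into a small
    set.\<close>
  ultimately have "\<not> inj E" unfolding small_def lesspoll_def lepoll_def
    by (metis inj_on_iff_surj lepoll_antisym lepoll_def)
  then obtain \<alpha> \<beta> where "\<alpha> < \<beta>" "E \<alpha> = E \<beta>"
    unfolding inj_on_def by (metis linorder_cases)
  \<comment> \<open>\<open>E\<close> is decreasing and the successor of \<alpha> is at most \<beta>,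
    so its set is squeezed between two equal ones.\<close>
  then have "E \<alpha> \<subseteq> E (succ_ord \<alpha>)" using E_mono[OF succ_ord_le] by blast
  then have E: "x \<in> E (succ_ord \<alpha>)" if "x \<in> E \<alpha>" for x using that by blast
  let ?s = "succ_ord \<alpha>"
  have "is_epi C (bond (J \<alpha>) i)" for i
  proof (rule image_epi[OF T_image T_Hom[OF succ_greater] _ J_bond])
    note m = T_Hom[OF succ_greater[of \<alpha>], of i]
    show "is_epi C (T \<alpha> ?s i)" unfolding is_epi_iff[OF m]
    proof (intro ballI impI)
      fix X a assume X: "X \<in> ob C" and a: "a \<in> Hom C (Ob \<alpha> i) X" and z: "a \<cdot> T \<alpha> ?s i = zer C (Ob ?s i) X"
      show "a = zer C (Ob \<alpha> i) X"
      proof (rule is_generator_eqI[OF gen a zer_Hom[OF HomD(4,5)[OF a]]])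
        fix y assume y: "y \<in> Hom C G (Ob \<alpha> i)"
        \<comment> \<open>To use equality of the sets at the single place i, \<open>y\<close> is
          extended by zero at the other places. The result shows that \<open>y\<close> factors
          through the next stage, on which \<open>a\<close> vanishes.\<close>
        define v where "v j = (if j = i then y else zer C G (Ob \<alpha> j))" for j
        have v: "v j \<in> Hom C G (Ob \<alpha> j)" for j
          unfolding v_def using y zer_Hom[OF G_ob HomD(4)[OF T0_Hom]] by simp
        obtain x where x: "x \<in> Hom C G P \<and> (\<forall>j\<in>UNIV. \<pi> j \<cdot> x = T zero_ord \<alpha> j \<cdot> v j)"
          using ex1_implies_ex[OF is_product_ex1[OF P G_ob cmp_Hom[OF v T0_Hom]]] ..
        then have "x \<in> E \<alpha>" unfolding E_def using v by auto
        then obtain w where w: "w \<in> Hom C G (Ob ?s i)" "T zero_ord ?s i \<cdot> w = \<pi> i \<cdot> x"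
          using E unfolding E_def by blast
        have "T zero_ord \<alpha> i \<cdot> (T \<alpha> ?s i \<cdot> w) = T zero_ord \<alpha> i \<cdot> y"
          using cmp_assoc[OF w(1) m T0_Hom] T_cmp[OF zero_ord_le succ_greater] w(2) x by (simp add: v_def)
        then have "T \<alpha> ?s i \<cdot> w = y" by (rule T0_monoD[OF cmp_Hom[OF w(1) m] y])
        then show "a \<cdot> y = zer C (Ob \<alpha> i) X \<cdot> y"
          using cmp_assoc[OF w(1) m a] z cmp_zer_left[OF w(1) X] cmp_zer_left[OF y X] by simp
      qed
    qed
  qed
  then show ?thesis by blast
qed

text \<open>The case of epimorphic bonds shows that \<open>a\<close> vanishes on the product of the
  stable stage, so \<open>a\<close> factors through the product of the quotients. The factor is
  again invariant, and there 1 - B has a right inverse.\<close>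

lemma invariant_zero:
  assumes complete: "\<forall>\<kappa>::'u. limit_ord \<kappa> \<longrightarrow> is_complete C S \<kappa>"
    and P: "is_product C UNIV (obj S) P \<pi>"
    and F: "F \<in> Hom C P P" "\<And>i. \<pi> i \<cdot> F = bond S i \<cdot> \<pi> (Suc i)"
    and a: "a \<in> Hom C P Y" "a = a \<cdot> F"
  shows "a = zer C P Y"
proof -
  obtain \<kappa> :: 'u where "limit_ord \<kappa>" using limit_ord_exists[OF universe] by blast
  then have "is_complete C S \<kappa>" using complete by blast
  then obtain J :: "'u \<Rightarrow> ('o, 'm) invseq" and t where "is_image_tower C S J t"
    unfolding is_complete_def by (elim exE conjE) rule
  then interpret image_tower C U S J t using universe by unfold_locales
  obtain \<alpha> where \<alpha>: "\<forall>i. is_epi C (bond (J \<alpha>) i)"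
    using image_tower_stabilizes[OF image_tower_axioms] by blast
  have tH: "t zero_ord \<alpha> \<in> Hom (seq_cat C) (J \<alpha>) S"
    using t_Hom[OF zero_ord_le, of \<alpha>] by (simp add: J_zero)
  obtain Q b q where Q: "is_quotient_seq S (T zero_ord \<alpha>) Q b q" by (rule quotient_seq_exists[OF tH])
  note q = is_quotient_seqD[OF Q]
  have solv: "uniquely_solvable Q b"
    by (rule quotient_solvable[OF universe complete image_tower_axioms Q])
  obtain K \<sigma> where K: "is_product C UNIV (Ob \<alpha>) K \<sigma>"
    using small_product_exists[OF products small_nat, of UNIV "Ob \<alpha>"] HomD(4)[OF T0_Hom] by blast
  obtain R \<tau> where R: "is_product C UNIV Q R \<tau>"
    using small_product_exists[OF products small_nat, of UNIV Q] HomD(5)[OF q(2)] by blast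
  note \<pi> = is_product_Hom[OF P UNIV_I] and \<sigma> = is_product_Hom[OF K UNIV_I]
    and \<tau> = is_product_Hom[OF R UNIV_I]
  have ob: "K \<in> ob C" "R \<in> ob C" "P \<in> ob C" "Y \<in> ob C"
    using K R HomD[OF a(1)] by (simp_all add: is_product_def)
  obtain m where "m \<in> Hom C K P \<and> (\<forall>i\<in>UNIV. \<pi> i \<cdot> m = T zero_ord \<alpha> i \<cdot> \<sigma> i)"
    using ex1_implies_ex[OF is_product_ex1[OF P ob(1) cmp_Hom[OF \<sigma> T0_Hom]]] ..
  then have m: "m \<in> Hom C K P" "\<pi> i \<cdot> m = T zero_ord \<alpha> i \<cdot> \<sigma> i" for i by simp_all
  obtain r where "r \<in> Hom C P R \<and> (\<forall>i\<in>UNIV. \<tau> i \<cdot> r = q i \<cdot> \<pi> i)"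
    using ex1_implies_ex[OF is_product_ex1[OF R ob(3) cmp_Hom[OF \<pi> q(2)]]] ..
  then have r: "r \<in> Hom C P R" "\<tau> i \<cdot> r = q i \<cdot> \<pi> i" for i by simp_all
  have "short_exact C (T zero_ord \<alpha> i) (q i)" for i
    unfolding short_exact_def using q(1) kernel_of_cokernel[OF T0_mono T0_Hom q(1)] by blast
  \<comment> \<open>Exactness of products makes \<open>r\<close> the cokernel of \<open>m\<close>,
    which is what allows \<open>a\<close> to descend.\<close>
  then have "short_exact C m r"
    using product_short_exact[OF products_exact small_nat T0_Hom q(2) _ K P R m r] by blast
  then have mr: "is_cokernel C m r" by (simp add: short_exact_def)
  obtain A where "A \<in> Hom C K K \<and> (\<forall>i\<in>UNIV. \<sigma> i \<cdot> A = bond (J \<alpha>) i \<cdot> \<sigma> (Suc i))"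
    using ex1_implies_ex[OF is_product_ex1[OF K ob(1) cmp_Hom[OF \<sigma> J_bond]]] ..
  then have A: "A \<in> Hom C K K" "\<sigma> i \<cdot> A = bond (J \<alpha>) i \<cdot> \<sigma> (Suc i)" for i by simp_all
  obtain B where "B \<in> Hom C R R \<and> (\<forall>i\<in>UNIV. \<tau> i \<cdot> B = b i \<cdot> \<tau> (Suc i))"
    using ex1_implies_ex[OF is_product_ex1[OF R ob(2) cmp_Hom[OF \<tau> q(3)]]] ..
  then have B: "B \<in> Hom C R R" "\<tau> i \<cdot> B = b i \<cdot> \<tau> (Suc i)" for i by simp_all
  have Fm: "F \<cdot> m = m \<cdot> A"
  proof (rule is_product_eqI[OF P cmp_Hom[OF m(1) F(1)] cmp_Hom[OF A(1) m(1)]])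
    fix i
    have "\<pi> i \<cdot> (F \<cdot> m) = bond S i \<cdot> (T zero_ord \<alpha> (Suc i) \<cdot> \<sigma> (Suc i))"
      using cmp_assoc[OF m(1) F(1) \<pi>[of i]] F(2)[of i] cmp_assoc[OF m(1) \<pi> S_bond[of i]] m(2) by simp
    also have "\<dots> = T zero_ord \<alpha> i \<cdot> (bond (J \<alpha>) i \<cdot> \<sigma> (Suc i))"
      using cmp_assoc[OF \<sigma> T0_Hom S_bond[of i]] cmp_assoc[OF \<sigma> J_bond[of \<alpha> i] T0_Hom] T0_bond[of \<alpha> i] by simp
    also have "\<dots> = \<pi> i \<cdot> (m \<cdot> A)"
      using cmp_assoc[OF A(1) m(1) \<pi>[of i]] m(2) A(2)[of i] cmp_assoc[OF A(1) \<sigma>[of i] T0_Hom] by simp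
    finally show "\<pi> i \<cdot> (F \<cdot> m) = \<pi> i \<cdot> (m \<cdot> A)" .
  qed
  have rF: "r \<cdot> F = B \<cdot> r"
  proof (rule is_product_eqI[OF R cmp_Hom[OF F(1) r(1)] cmp_Hom[OF r(1) B(1)]])
    fix i
    have "\<tau> i \<cdot> (r \<cdot> F) = q i \<cdot> (bond S i \<cdot> \<pi> (Suc i))"
      using cmp_assoc[OF F(1) r(1) \<tau>[of i]] r(2) cmp_assoc[OF F(1) \<pi>[of i] q(2)] F(2)[of i] by simp
    also have "\<dots> = b i \<cdot> (q (Suc i) \<cdot> \<pi> (Suc i))"
      using cmp_assoc[OF \<pi> S_bond[of i] q(2)] cmp_assoc[OF \<pi> q(2) q(3)[of i]] q(4)[of i] by simp
    also have "\<dots> = \<tau> i \<cdot> (B \<cdot> r)"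
      using cmp_assoc[OF r(1) B(1) \<tau>[of i]] B(2)[of i] cmp_assoc[OF r(1) \<tau> q(3)[of i]] r(2) by simp
    finally show "\<tau> i \<cdot> (r \<cdot> F) = \<tau> i \<cdot> (B \<cdot> r)" .
  qed
  note am = cmp_Hom[OF m(1) a(1)]
  have "a \<cdot> m = zer C K Y"
  proof (rule epi_bonds_invariant_zero[OF J_bond _ K A am])
    show "is_epi C (bond (J \<alpha>) i)" for i using \<alpha> by blast
    show "a \<cdot> m = a \<cdot> m \<cdot> A"
      using cmp_assoc[OF A(1) m(1) a(1)] Fm cmp_assoc[OF m(1) F(1) a(1)] a(2) by simp
  qed
  then obtain c where c: "c \<in> Hom C R Y" "c \<cdot> r = a" using is_cokernel_desc[OF mr m(1) r(1) a(1)] by blast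
  \<comment> \<open>Invariance descends to the factor \<open>c\<close> because \<open>r\<close> is
    epi and intertwines F with B.\<close>
  have cB: "c \<cdot> B = c"
  proof (rule is_epiD[OF is_cokernel_epi[OF mr] r(1) cmp_Hom[OF B(1) c(1)] c(1)])
    show "c \<cdot> B \<cdot> r = c \<cdot> r"
      using cmp_assoc[OF r(1) B(1) c(1)] rF cmp_assoc[OF F(1) r(1) c(1)] c(2) a(2) by simp
  qed
  \<comment> \<open>The system is solved for the generic right-hand side, the projections of
    \<open>R\<close> themselves. The solution assembles to h with h = 1 + B h, so h is a right
    inverse of 1 - B.\<close>
  obtain y where y: "is_solution Q b R \<tau> y"
    using solv[unfolded uniquely_solvable_def, THEN bspec, OF ob(2), THEN spec, THEN mp, of \<tau>] \<tau>
    by (metis (no_types, lifting))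
  have yi: "y i \<in> Hom C R (Q i)" "y i = add C (\<tau> i) (b i \<cdot> y (Suc i))" for i
    using y[unfolded is_solution_def, THEN spec, of i] by (rule conjunct1, rule conjunct2)
  obtain h where "h \<in> Hom C R R \<and> (\<forall>i\<in>UNIV. \<tau> i \<cdot> h = y i)"
    using ex1_implies_ex[OF is_product_ex1[OF R ob(2) yi(1)]] ..
  then have h: "h \<in> Hom C R R" "\<tau> i \<cdot> h = y i" for i by simp_all
  note id = idn_Hom[OF ob(2)]
  note Bh = cmp_Hom[OF h(1) B(1)]
  have "h = add C (idn C R) (B \<cdot> h)"
  proof (rule is_product_eqI[OF R h(1) add_Hom[OF id Bh]])
    fix i
    have "\<tau> i \<cdot> (B \<cdot> h) = b i \<cdot> y (Suc i)"
      using cmp_assoc[OF h(1) B(1) \<tau>[of i]] B(2)[of i] cmp_assoc[OF h(1) \<tau> q(3)[of i]] h(2) by simp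
    then show "\<tau> i \<cdot> h = \<tau> i \<cdot> add C (idn C R) (B \<cdot> h)"
      using cmp_add_right[OF id Bh \<tau>[of i]] idn_right[OF \<tau>[of i]] h(2)[of i] yi(2)[of i] by simp
  qed
  then have "c \<cdot> h = add C c (c \<cdot> h)"
    using cmp_add_right[OF id Bh c(1)] idn_right[OF c(1)] cmp_assoc[OF h(1) B(1) c(1)] cB by simp
  then have "c = zer C R Y" using add_eq_self_iff[OF cmp_Hom[OF h(1) c(1)] c(1)] by blast
  then show ?thesis using c(2) cmp_zer_left[OF r(1) ob(4)] by simp
qed

text \<open>\<open>is_lim1\<close> leaves the product, F and the cokernel open, so vanishing is
  proved for every choice; the existence part keeps this from being vacuous.\<close>

lemma lim1_is_zero:
  assumes S: "S \<in> ob (seq_cat C)" and complete: "\<forall>\<kappa>::'u. limit_ord \<kappa> \<longrightarrow> is_complete C S \<kappa>"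
  shows "(\<exists>L. is_lim1 C S L) \<and> (\<forall>L. is_lim1 C S L \<longrightarrow> is_zero C L)"
proof
  have So: "obj S i \<in> ob C" and Sb: "bond S i \<in> Hom C (obj S (Suc i)) (obj S i)" for i
    using S by (simp_all add: seq_ob_iff)
  obtain P \<pi> where P: "is_product C UNIV (obj S) P \<pi>"
    using small_product_exists[OF products small_nat, of UNIV "obj S"] So by blast
  have Pob: "P \<in> ob C" using P by (simp add: is_product_def)
  note \<pi> = is_product_Hom[OF P UNIV_I]
  obtain F where F: "F \<in> Hom C P P \<and> (\<forall>i\<in>UNIV. \<pi> i \<cdot> F = bond S i \<cdot> \<pi> (Suc i))"
    using ex1_implies_ex[OF is_product_ex1[OF P Pob cmp_Hom[OF \<pi> Sb]]] ..
  then have "sub C (idn C P) F \<in> Hom C P P" using sub_Hom idn_Hom[OF Pob] by blast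
  then obtain q where "is_cokernel C (sub C (idn C P) F) q" using ex_cokernel HomD(1) by blast
  then show "\<exists>L. is_lim1 C S L" unfolding is_lim1_def using P F by blast
  show "\<forall>L. is_lim1 C S L \<longrightarrow> is_zero C L"
  proof (intro allI impI)
    fix L assume "is_lim1 C S L"
    then obtain P \<pi> F q where P: "is_product C UNIV (obj S) P \<pi>"
      and F: "F \<in> Hom C P P" "\<And>j. \<pi> j \<cdot> F = bond S j \<cdot> \<pi> (Suc j)"
      and q: "is_cokernel C (sub C (idn C P) F) q" and L: "L = tgt C q"
      unfolding is_lim1_def by blast
    have Pob: "P \<in> ob C" using P by (simp add: is_product_def)
    note id = idn_Hom[OF Pob]
    note qH = is_cokernelD[OF q sub_Hom[OF id F(1)], folded L]
    \<comment> \<open>The cokernel of an epi is zero; being epi as well, it has a zero object as its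
      target.\<close>
    have "is_epi C (sub C (idn C P) F)"
      using sub_idn_epi_iff[OF F(1)] invariant_zero[OF complete P F] by blast
    then have "q = zer C P L"
      using qH HomD(5)[OF qH(1)] unfolding is_epi_iff[OF sub_Hom[OF id F(1)]] by blast
    note Lob = HomD(5)[OF qH(1)]
    have "idn C L \<cdot> q = zer C L L \<cdot> q"
      using \<open>q = zer C P L\<close> cmp_zer_right[OF idn_Hom[OF Lob] Pob] cmp_zer_left[OF qH(1) Lob] by simp
    then have "idn C L = zer C L L"
      by (rule is_epiD[OF is_cokernel_epi[OF q] qH(1) idn_Hom[OF Lob] zer_Hom[OF Lob Lob]])
    then show "is_zero C L" by (rule is_zeroI[OF Lob])
  qed
qed

end

theorem corollary3p2:
  fixes C :: "('o, 'm) cat" and S :: "('o, 'm) invseq"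
  assumes "universe_type TYPE('u::wellorder)"
    and "abelian_category C"
    and "locally_small TYPE('u) C"
    and "\<exists>G. is_generator C G"
    and "has_small_coproducts TYPE('u) C"
    and "has_small_products TYPE('u) C"
    and "small_products_exact TYPE('u) C"
    and "S \<in> ob (seq_cat C)"
    and "\<forall>\<kappa>::'u. limit_ord \<kappa> \<longrightarrow> is_complete C S \<kappa>"
  shows "(\<exists>L. is_lim1 C S L) \<and> (\<forall>L. is_lim1 C S L \<longrightarrow> is_zero C L)"
proof -
  obtain G where G: "is_generator C G" using assms(4) by blast
  interpret abelian_category C by fact
  interpret exact_products_category C "TYPE('u)" G
    using assms(1,3,5-7) G by unfold_locales
  show ?thesis by (rule lim1_is_zero[OF assms(8,9)])
qed

end
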